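(* Let $\{\phi_\alpha:\alpha\in A\}$ be a spline-like family of cardinal interpolators, let $1<p<\infty$, and let $f=\{f(j)\}_{j\in\mathbb{Z}}\in l^p$. Then $$\lim_{\alpha\to\infty}\big\|\mathscr{I}_{\phi_\alpha}[f]-\mathscr{W}[f]\big\|_{L^p(\mathbb{R})}=0.$$
   Context: Fourier transform convention: $\hat f(\xi)=(2\pi)^{-1/2}\int_{\mathbb{R}}f(x)e^{-ix\xi}dx$, extended to tempered distributions. $l^p=l^p(\mathbb{Z})$. A function $\phi$ satisfies the interpolating conditions if: (A1) $\phi$ is a real valued slowly increasing function on $\mathbb{R}$; (A2) $\hat\phi(\xi)\ge 0$, and $\hat\phi(\xi)\ge m>0$ in $[-\pi,\pi]$ for some constant $m$; (A3) $\hat\phi\in C^1(\mathbb{R}\setminus\{0\})$; (A4) there is $\epsilon>0$ such that for $j=0,1$, $\hat\phi^{(j)}(\xi)=O(|\xi|^{-(1+\epsilon)})$ as $|\xi|\to\infty$. (Here $\hat\phi$ is the distributional Fourier transform, identified with a function on $\mathbb{R}\setminus\{0\}$; it may be singular at $0$.) Let $A\subset(0,\infty)$ be an unbounded index set (discrete or continuous). A collection $\{\phi_\alpha:\alpha\in A\}$ is a spline-like family of cardinal interpolators if: (B1) every $\phi_\alpha$ satisfies the interpolating conditions; (B2) there is a constant $C$ independent of $\alpha$ with $\sum_{j\in\mathbb{Z}}\sum_{k\ne j}\int_{-\pi}^{\pi}\left|\frac{\hat\phi_\alpha(\xi+2\pi j)}{\hat\phi_\alpha(\xi)}\cdot\frac{\hat\phi_\alpha'(\xi+2\pi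 k)}{\hat\phi_\alpha(\xi)}\right|d\xi\le C$ for all $\alpha\in A$; (B3) for each $j\in\mathbb{Z}$, $j\neq 0$, $\lim_{\alpha\to\infty}\frac{\hat\phi_\alpha(\xi+2\pi j)}{\hat\phi_\alpha(\xi)}=0$ for almost every $|\xi|\le\pi$; (B4) there is $\{\mathscr{M}_j\}\in l^1$ such that $\frac{\hat\phi_\alpha(\xi+2\pi j)}{\hat\phi_\alpha(\xi)}\le\mathscr{M}_j$ for all $|\xi|\le\pi$, $j\ne0$, $\alpha\in A$. The fundamental function $L_{\phi}$ is defined by its Fourier transform $\hat L_{\phi}(\xi)=(2\pi)^{-1/2}\,\hat\phi(\xi)\big/\sum_{j\in\mathbb{Z}}\hat\phi(\xi+2\pi j)$. For a sequence $f=\{f(j)\}_{j\in\mathbb{Z}}$, the interpolation operator is $\mathscr{I}_{\phi}[f](x)=\sum_{j\in\mathbb{Z}}f(j)L_{\phi}(x-j)$. The Whittaker map is $\mathscr{W}[\{c_k\}](x)=\sum_{k\in\mathbb{Z}}c_k\frac{\sin(\pi(x-k))}{\pi(x-k)}$. *)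

theory Defs
  imports "HOL-Probability.Sinc_Integral" "HOL-Library.Landau_Symbols"
begin

section \<open>Fourier transforms\<close>

definition fourier :: "(real \<Rightarrow> complex) \<Rightarrow> real \<Rightarrow> complex" where
  "fourier f \<xi> = of_real (1 / sqrt (2 * pi)) * (LINT x|lborel. f x * exp (- (\<i> * of_real (x * \<xi>))))"

definition inverse_fourier :: "(real \<Rightarrow> complex) \<Rightarrow> real \<Rightarrow> complex" where
  "inverse_fourier g x = of_real (1 / sqrt (2 * pi)) * (LINT \<xi>|lborel. g \<xi> * exp (\<i> * of_real (x * \<xi>)))"

definition smooth :: "(real \<Rightarrow> complex) \<Rightarrow> bool" where
  "smooth f \<longleftrightarrow> (\<exists>D :: nat \<Rightarrow> real \<Rightarrow> complex. D 0 = f \<and>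
     (\<forall>n x. (D n has_vector_derivative D (Suc n) x) (at x)))"

definition test_function_on :: "real set \<Rightarrow> (real \<Rightarrow> complex) \<Rightarrow> bool" where
  "test_function_on U \<psi> \<longleftrightarrow> smooth \<psi> \<and>
     compact (closure {x. \<psi> x \<noteq> 0}) \<and> closure {x. \<psi> x \<noteq> 0} \<subseteq> U"

text \<open>Slowly increasing: measurable and of at most polynomial growth, so that integration
  against the function is a tempered distribution.\<close>

definition slowly_increasing :: "(real \<Rightarrow> real) \<Rightarrow> bool" where
  "slowly_increasing \<phi> \<longleftrightarrow> \<phi> \<in> borel_measurable lebesgue \<and>
     (\<exists>C::real. \<exists>N::nat. \<forall>x. \<bar>\<phi> x\<bar> \<le> C * (1 + \<bar>x\<bar>) ^ N)"

text \<open>Distributions are represented by their action on test functions.\<close>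

definition regular_distribution :: "(real \<Rightarrow> real) \<Rightarrow> (real \<Rightarrow> complex) \<Rightarrow> complex" where
  "regular_distribution \<phi> \<psi> = (LINT x|lebesgue. of_real (\<phi> x) * \<psi> x)"

definition fourier_distribution ::
    "((real \<Rightarrow> complex) \<Rightarrow> complex) \<Rightarrow> (real \<Rightarrow> complex) \<Rightarrow> complex" where
  "fourier_distribution T \<psi> = T (fourier \<psi>)"

text \<open>The distributional Fourier transform of \<open>\<phi>\<close> coincides with the continuous function \<open>g\<close>
  on the complement of the origin. Nothing is required at the origin, where the
  transform may be singular; the value \<open>g 0\<close> carries no information.\<close>

definition is_fourier_off_origin :: "(real \<Rightarrow> real) \<Rightarrow> (real \<Rightarrow> real) \<Rightarrow> bool" where
  "is_fourier_off_origin \<phi> g \<longleftrightarrow> continuous_on (- {0}) g \<and>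
     (\<forall>\<psi>. test_function_on (- {0}) \<psi> \<longrightarrow>
        fourier_distribution (regular_distribution \<phi>) \<psi> = regular_distribution g \<psi>)"

text \<open>A function \<open>g\<close> as above is determined by \<open>\<phi>\<close> except for the value \<open>g 0\<close>, which is left
  unspecified here. The point \<open>0\<close> is excluded from all pointwise conditions below, and
  it is a null set for all integrals. \<open>fhat \<phi>\<close> is meaningful only if such a \<open>g\<close> exists, which is
  part of \<open>interpolating_conditions\<close>.\<close>

definition fhat :: "(real \<Rightarrow> real) \<Rightarrow> real \<Rightarrow> real" where
  "fhat \<phi> = (SOME g. is_fourier_off_origin \<phi> g)"

section \<open>Families of cardinal interpolators\<close>

definition interpolating_conditions :: "(real \<Rightarrow> real) \<Rightarrow> bool" where
  "interpolating_conditions \<phi> \<longleftrightarrow>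
     slowly_increasing \<phi> \<and>
     (\<exists>g. is_fourier_off_origin \<phi> g) \<and>
     (\<forall>\<xi>. \<xi> \<noteq> 0 \<longrightarrow> fhat \<phi> \<xi> \<ge> 0) \<and>
     (\<exists>m>0. \<forall>\<xi>\<in>{-pi..pi} - {0}. fhat \<phi> \<xi> \<ge> m) \<and>
     (\<forall>\<xi>. \<xi> \<noteq> 0 \<longrightarrow> fhat \<phi> field_differentiable at \<xi>) \<and>
     continuous_on (- {0}) (deriv (fhat \<phi>)) \<and>
     (\<exists>\<epsilon>>0. fhat \<phi> \<in> O[at_infinity](\<lambda>\<xi>. \<bar>\<xi>\<bar> powr (- (1 + \<epsilon>))) \<and>
             deriv (fhat \<phi>) \<in> O[at_infinity](\<lambda>\<xi>. \<bar>\<xi>\<bar> powr (- (1 + \<epsilon>))))"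

text \<open>The limit \<open>\<alpha> \<rightarrow> \<infinity>\<close> with \<open>\<alpha>\<close> ranging over the index set \<open>A\<close>.\<close>

abbreviation at_top_in :: "real set \<Rightarrow> real filter" where
  "at_top_in A \<equiv> inf at_top (principal A)"

text \<open>The double series of integrals is taken in \<open>[0,\<infinity>]\<close>, so that
  the bound includes the convergence of all integrals and of the series.\<close>

definition spline_like_family :: "real set \<Rightarrow> (real \<Rightarrow> real \<Rightarrow> real) \<Rightarrow> bool" where
  "spline_like_family A \<phi> \<longleftrightarrow>
     (\<forall>\<alpha>\<in>A. interpolating_conditions (\<phi> \<alpha>)) \<and>
     (\<exists>C::real. \<forall>\<alpha>\<in>A.
        (\<Sum>\<^sub>\<infinity>j\<in>(UNIV :: int set). \<Sum>\<^sub>\<infinity>k\<in>UNIV - {j}.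
           \<integral>\<^sup>+\<xi>\<in>{-pi..pi}. ennreal \<bar>fhat (\<phi> \<alpha>) (\<xi> + 2 * pi * of_int j) / fhat (\<phi> \<alpha>) \<xi> *
              (deriv (fhat (\<phi> \<alpha>)) (\<xi> + 2 * pi * of_int k) / fhat (\<phi> \<alpha>) \<xi>)\<bar> \<partial>lborel)
        \<le> ennreal C) \<and>
     (\<forall>j::int. j \<noteq> 0 \<longrightarrow> (AE \<xi> in lborel. \<bar>\<xi>\<bar> \<le> pi \<longrightarrow>
        ((\<lambda>\<alpha>. fhat (\<phi> \<alpha>) (\<xi> + 2 * pi * of_int j) / fhat (\<phi> \<alpha>) \<xi>) \<longlongrightarrow> 0) (at_top_in A))) \<and>
     (\<exists>M :: int \<Rightarrow> real. (\<lambda>j. \<bar>M j\<bar>) summable_on UNIV \<and>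
        (\<forall>\<alpha>\<in>A. \<forall>j. j \<noteq> 0 \<longrightarrow> (\<forall>\<xi>. \<bar>\<xi>\<bar> \<le> pi \<and> \<xi> \<noteq> 0 \<longrightarrow>
           fhat (\<phi> \<alpha>) (\<xi> + 2 * pi * of_int j) / fhat (\<phi> \<alpha>) \<xi> \<le> M j)))"

text \<open>Off the null set of integer multiples of \<open>2\<pi>\<close>, every term of the series below is independent
  of the unspecified value at the origin.\<close>

definition fundamental_hat :: "(real \<Rightarrow> real) \<Rightarrow> real \<Rightarrow> real" where
  "fundamental_hat \<phi> \<xi> =
     1 / sqrt (2 * pi) * (fhat \<phi> \<xi> / (\<Sum>\<^sub>\<infinity>j\<in>(UNIV :: int set). fhat \<phi> (\<xi> + 2 * pi * of_int j)))"

text \<open>Under the interpolating conditions \<open>fundamental_hat \<phi>\<close> is integrable, so the function with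
  this Fourier transform is given by the inversion integral.\<close>

definition fundamental :: "(real \<Rightarrow> real) \<Rightarrow> real \<Rightarrow> complex" where
  "fundamental \<phi> = inverse_fourier (\<lambda>\<xi>. of_real (fundamental_hat \<phi> \<xi>))"

definition interpolation :: "(real \<Rightarrow> real) \<Rightarrow> (int \<Rightarrow> complex) \<Rightarrow> real \<Rightarrow> complex" where
  "interpolation \<phi> f x = (\<Sum>\<^sub>\<infinity>j\<in>UNIV. f j * fundamental \<phi> (x - of_int j))"

definition whittaker :: "(int \<Rightarrow> complex) \<Rightarrow> real \<Rightarrow> complex" where
  "whittaker c x = (\<Sum>\<^sub>\<infinity>k\<in>UNIV. c k * of_real (sinc (pi * (x - of_int k))))"

section \<open>Sequence and function spaces\<close>

definition in_lp :: "real \<Rightarrow> (int \<Rightarrow> complex) \<Rightarrow> bool" where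
  "in_lp p f \<longleftrightarrow> (\<lambda>j. norm (f j) powr p) summable_on UNIV"

text \<open>The \<open>L\<^sup>p\<close> norm with value \<open>\<infinity>\<close> outside of \<open>L\<^sup>p\<close>.\<close>

definition Lp_norm :: "real \<Rightarrow> (real \<Rightarrow> complex) \<Rightarrow> ennreal" where
  "Lp_norm p h =
     (if h \<in> borel_measurable lebesgue \<and> (\<integral>\<^sup>+x. ennreal (norm (h x) powr p) \<partial>lebesgue) < \<infinity>
      then ennreal (enn2real (\<integral>\<^sup>+x. ennreal (norm (h x) powr p) \<partial>lebesgue) powr (1 / p))
      else \<infinity>)"

end

theory Submission
  imports Defs "HOL-Complex_Analysis.Cauchy_Integral_Theorem" "HOL-Real_Asymp.Real_Asymp"
begin

text \<open>Divide the transform of the fundamental function by its periodization and cut the line into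
translates of \<open>[-\<pi>, \<pi>]\<close>. The pieces \<open>u\<^sub>j(\<xi>) = g(\<xi> + 2\<pi>j) / (\<Sum>k. g(\<xi> + 2\<pi>k))\<close>, where \<open>g\<close> is the transform
of \<open>\<phi>\<close>, are nonnegative with sum 1, and in the numerator of the derivative
of \<open>u\<^sub>j\<close> the diagonal product \<open>k = j\<close> cancels. The double series of the definition of a spline-like
family therefore bounds the total variation of all the \<open>u\<^sub>j\<close> together on the two halves of the period, uniformly
in \<open>\<alpha>\<close>. A function of bounded variation is a superposition of indicators of intervals, so interpolation is a
superposition of convolutions with the kernels \<open>D\<^sub>t(x) = \<integral>\<^sub>0\<^sup>t e\<^sup>i\<^sup>x\<^sup>s ds\<close>, \<open>|t| \<le> \<pi>\<close>, and up to summable errors these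
are modulated discrete Hilbert transforms. Uniform boundedness from \<open>l\<^sup>p\<close> to \<open>L\<^sup>p\<close> is thus reduced to the theorem of M. Riesz
on the integers.

That theorem is proved for the kernel \<open>x / (1 + x\<^sup>2)\<close>. For \<open>1 < p \<le> 2\<close> and a nonnegative finite sequence,
\<open>\<Sum>j. a\<^sub>j \<i> / (z - j + \<i>)\<close> has positive real part in the upper half plane, its \<open>p\<close>-th power integrates to 0
along the real line (\<open>half_plane_integral_tendsto_0\<close>), and a pointwise inequality
(\<open>Im_powr_le_Re\<close>) bounds its imaginary part by its real part in the mean of order \<open>p\<close>. The real part is a
convolution with a summable kernel. The range \<open>p \<ge> 2\<close> follows by duality because the kernel is odd
(\<open>conj_conv_lp_bound\<close>).

All estimates are made for the truncated sums over \<open>|k| \<le> N\<close>, where differentiation is elementary; they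
survive the limit \<open>N \<rightarrow> \<infinity>\<close> by Fatou's lemma. The error kernel, the difference between the fundamental function and the sinc
function, then satisfies, uniformly in \<open>\<alpha>\<close>, an \<open>l\<^sup>p\<close> to \<open>L\<^sup>p\<close> bound (\<open>full_err_lp_bound\<close>) and a decay
\<open>O(1 / (1 + |x|))\<close> (\<open>full_err_decay\<close>). It tends to 0 pointwise, because the pieces with \<open>j \<noteq> 0\<close> tend to 0 in
mean over a period, and because the pieces sum to 1 the piece \<open>j = 0\<close> then tends to the indicator of the
period (\<open>full_err_small\<close>, \<open>family_error_tendsto_0\<close>). For a finitely supported sequence, dominated convergence yields
convergence in \<open>L\<^sup>p\<close>, since \<open>(1 + |x|)\<^sup>-\<^sup>p\<close> is integrable for \<open>p > 1\<close>; density of these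
sequences and the uniform bound give the general case (\<open>kernel_convergence\<close>).\<close>

section \<open>Weighted power means\<close>

text \<open>Young's inequality, written so that it says that \<open>g\<^sup>p\<close> lies above its tangent at \<open>c\<close>. In this form it
can be integrated in \<open>g\<close> against any weight while \<open>c\<close> is still free.\<close>

lemma powr_tangent:
  fixes g c p :: real
  assumes "1 < p" "0 \<le> g" "0 \<le> c"
  shows "p * (g * c powr (p - 1)) \<le> g powr p + (p - 1) * c powr p"
proof -
  define q where "q = p / (p - 1)"
  have q: "q > 1" "1 / p + 1 / q = 1" "(p - 1) * q = p"
    using assms unfolding q_def by (auto simp: field_simps)
  have "g * c powr (p - 1) \<le> g powr p / p + (c powr (p - 1)) powr q / q"
    by (rule Youngs_inequality) (use assms q in auto)
  then have "g * c powr (p - 1) \<le> g powr p / p + c powr p / q"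
    by (simp add: powr_powr q)
  moreover have "c powr p / q = (p - 1) * c powr p / p"
    using assms by (simp add: q_def)
  ultimately have "g * c powr (p - 1) \<le> (g powr p + (p - 1) * c powr p) / p"
    by (simp add: add_divide_distrib)
  then show ?thesis
    using assms by (simp add: field_simps)
qed

text \<open>Jensen's inequality for \<open>x\<^sup>p\<close>, once its tangents have been integrated: \<open>W\<close> is the mass of the weight,
\<open>I\<close> the integral of the function and \<open>J\<close> that of its \<open>p\<close>-th power. The best tangent is the one at the mean
\<open>I / W\<close>.\<close>

lemma powr_mean_of_tangents:
  fixes W I J p :: real
  assumes "1 < p" "0 \<le> W" "0 \<le> I" "W = 0 \<Longrightarrow> I = 0"
    and tan: "\<And>c. 0 \<le> c \<Longrightarrow> p * (I * c powr (p - 1)) \<le> J + (p - 1) * (W * c powr p)"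
  shows "I powr p \<le> W powr (p - 1) * J"
proof (cases "W = 0")
  case True
  then show ?thesis using assms by simp
next
  case False
  then have W: "W > 0" using assms by simp
  define c where "c = I / W"
  have c: "c \<ge> 0" using assms W by (simp add: c_def)
  have I: "I = W * c" using W by (simp add: c_def)
  have cp: "c * c powr (p - 1) = c powr p"
    using c by (cases "c = 0") (auto simp: powr_diff)
  have "p * (W * c powr p) \<le> J + (p - 1) * (W * c powr p)"
    using tan[OF c] I cp by (simp add: mult.assoc)
  then have "W * c powr p \<le> J" by (simp add: algebra_simps)
  then have "W powr (p - 1) * (W * c powr p) \<le> W powr (p - 1) * J"
    by (intro mult_left_mono) auto
  moreover have "W powr (p - 1) * (W * c powr p) = I powr p"
    using W c by (simp add: I powr_mult powr_diff)
  ultimately show ?thesis by simp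
qed

lemma powr_integral_le:
  fixes w g :: "'a \<Rightarrow> real"
  assumes p: "1 < p" and w: "integrable M w" "\<And>x. x \<in> space M \<Longrightarrow> 0 \<le> w x" and g: "\<And>x. x \<in> space M \<Longrightarrow> 0 \<le> g x"
    and wg: "integrable M (\<lambda>x. w x * g x)" and wgp: "integrable M (\<lambda>x. w x * g x powr p)"
  shows "(\<integral>x. w x * g x \<partial>M) powr p \<le> (\<integral>x. w x \<partial>M) powr (p - 1) * (\<integral>x. w x * g x powr p \<partial>M)"
proof (rule powr_mean_of_tangents[OF p])
  show "0 \<le> integral\<^sup>L M w" "0 \<le> (\<integral>x. w x * g x \<partial>M)" using w g by (auto intro!: Bochner_Integration.integral_nonneg)
  show "(\<integral>x. w x * g x \<partial>M) = 0" if "integral\<^sup>L M w = 0"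
  proof -
    have "AE x in M. w x = 0"
      using that w integral_nonneg_eq_0_iff_AE[OF w(1)] by auto
    then have "AE x in M. w x * g x = 0" by eventually_elim auto
    then show ?thesis by (rule integral_eq_zero_AE)
  qed
  fix c :: real assume c: "0 \<le> c"
  have "(\<integral>x. p * c powr (p - 1) * (w x * g x) \<partial>M) \<le> (\<integral>x. w x * g x powr p + (p - 1) * c powr p * w x \<partial>M)"
  proof (rule integral_mono)
    fix x assume x: "x \<in> space M"
    have "w x * (p * (g x * c powr (p - 1))) \<le> w x * (g x powr p + (p - 1) * c powr p)"
      by (intro mult_left_mono powr_tangent p g c w x)
    then show "p * c powr (p - 1) * (w x * g x) \<le> w x * g x powr p + (p - 1) * c powr p * w x"
      by (simp add: algebra_simps)
  qed (use w wg wgp in auto)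
  moreover have "(\<integral>x. p * c powr (p - 1) * (w x * g x) \<partial>M) = p * ((\<integral>x. w x * g x \<partial>M) * c powr (p - 1))"
    by simp
  moreover have "(\<integral>x. w x * g x powr p + (p - 1) * c powr p * w x \<partial>M) =
     (\<integral>x. w x * g x powr p \<partial>M) + (p - 1) * (integral\<^sup>L M w * c powr p)"
    using w wgp by simp
  ultimately show "p * ((\<integral>x. w x * g x \<partial>M) * c powr (p - 1)) \<le> 
     (\<integral>x. w x * g x powr p \<partial>M) + (p - 1) * (integral\<^sup>L M w * c powr p)"
    by linarith
qed

lemma powr_sum_weighted_le:
  fixes w g :: "'a \<Rightarrow> real"
  assumes p: "1 < p" and w: "\<And>x. x \<in> I \<Longrightarrow> 0 \<le> w x" and g: "\<And>x. x \<in> I \<Longrightarrow> 0 \<le> g x"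
  shows "(\<Sum>x\<in>I. w x * g x) powr p \<le> (\<Sum>x\<in>I. w x) powr (p - 1) * (\<Sum>x\<in>I. w x * g x powr p)"
proof (cases "finite I")
  case True
  then show ?thesis
    using powr_integral_le[OF p, of "count_space I" w g] w g
    by (simp add: integrable_count_space lebesgue_integral_count_space_finite)
qed auto

lemma powr_sum_le:
  fixes g :: "'a \<Rightarrow> real"
  assumes p: "1 < p" and g: "\<And>x. x \<in> I \<Longrightarrow> 0 \<le> g x"
  shows "(\<Sum>x\<in>I. g x) powr p \<le> real (card I) powr p * (\<Sum>x\<in>I. g x powr p)"
proof (cases "card I = 0")
  case True
  then show ?thesis
    by (metis card_eq_0_iff sum.empty sum.infinite powr_zero_eq_one mult_eq_0_iff order.refl powr_0)
next
  case False
  have "(\<Sum>x\<in>I. g x) powr p \<le> real (card I) powr (p - 1) * (\<Sum>x\<in>I. g x powr p)"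
    using powr_sum_weighted_le[OF p, of I "\<lambda>_. 1" g] g by simp
  also have "\<dots> \<le> real (card I) powr p * (\<Sum>x\<in>I. g x powr p)"
    using False by (intro mult_right_mono powr_mono sum_nonneg) auto
  finally show ?thesis .
qed

lemma powr_add_le:
  fixes a b p :: real
  assumes "1 < p" "0 \<le> a" "0 \<le> b"
  shows "(a + b) powr p \<le> 2 powr p * (a powr p + b powr p)"
  using powr_sum_le[OF assms(1), of "{True, False}" "\<lambda>t. if t then a else b"] assms by simp

lemma powr_add3_le:
  fixes a b c p :: real
  assumes "1 < p" "0 \<le> a" "0 \<le> b" "0 \<le> c"
  shows "(a + b + c) powr p \<le> 3 powr p * (a powr p + b powr p + c powr p)"
proof -
  have "card {0::nat, 1, 2} = 3" by simp
  then show ?thesis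
  using powr_sum_le[OF assms(1), of "{0::nat, 1, 2}" "\<lambda>t. if t = 0 then a else if t = 1 then b else c"] assms
  by (simp add: add.assoc)
qed

section \<open>The conjugate Poisson kernel on the integers\<close>

abbreviation expi :: "real \<Rightarrow> complex" where
  "expi x \<equiv> exp (\<i> * of_real x)"

text \<open>The pointwise inequality behind the theorem of M. Riesz. On \<open>w = r cis s\<close> it reads
\<open>|sin s|\<^sup>p \<le> A (cos s)\<^sup>p - B cos(p s)\<close>. Close to \<open>|s| = \<pi>/2\<close> the angle \<open>p s\<close> lies between \<open>\<pi>/2\<close> and \<open>\<pi>\<close> in absolute value, so
the last term alone suffices; elsewhere \<open>cos s\<close> is bounded below. The gain is that the integral of \<open>w\<^sup>p\<close>
vanishes for analytic \<open>w\<close>.\<close>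

lemma Im_powr_le_Re:
  fixes p :: real
  assumes "1 < p" "p \<le> 2"
  shows "\<exists>A B. 0 \<le> A \<and> 0 \<le> B \<and> (\<forall>w::complex. 0 < Re w \<longrightarrow>
     \<bar>Im w\<bar> powr p \<le> A * Re w powr p - B * Re (w powr of_real p))"
proof -
  \<comment> \<open>The threshold angle is the midpoint of \<open>\<pi>/(2p)\<close>, where \<open>cos(p s)\<close> changes sign, and \<open>\<pi>/2\<close>.\<close>
  define t where "t = (pi / (2 * p) + pi / 2) / 2"
  have t: "pi / 2 < p * t" "t < pi / 2" "0 < t" "p * t < pi"
  proof -
    have "pi / (2 * p) < pi / 2" using assms by (simp add: field_simps)
    then show "t < pi / 2" by (simp add: t_def)
    show "0 < t" using assms by (simp add: t_def add_pos_pos)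
    have "p * t = pi / 4 + p * pi / 4" using assms by (simp add: t_def field_simps)
    moreover have "pi < p * pi" "p * pi \<le> 2 * pi" using assms by auto
    ultimately show "pi / 2 < p * t" "p * t < pi" using pi_gt_zero by linarith+
  qed
  have ct: "cos t > 0" using t by (intro cos_gt_zero) auto
  have "cos (p * t) < cos (pi / 2)" using t by (intro cos_monotone_0_pi) auto
  then have cpt: "cos (p * t) < 0" by simp
  define B where "B = - 1 / cos (p * t)"
  define A where "A = (1 + B) / cos t powr p"
  have B: "B > 0" using cpt by (simp add: B_def divide_neg_neg)
  have A: "A > 0" using B ct by (simp add: A_def)
  have angle: "\<bar>sin s\<bar> powr p \<le> A * cos s powr p - B * cos (p * s)" if "0 \<le> s" "s < pi / 2" for s
  proof -
    have sin1: "\<bar>sin s\<bar> powr p \<le> 1"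
      using assms by (intro powr_le1) auto
    show ?thesis
    proof (cases "s \<ge> t")
      case True
      have "p * s \<le> pi"
        using assms that mult_mono[of p 2 s "pi/2"] by simp
      then have "cos (p * s) \<le> cos (p * t)"
        using True t assms by (intro cos_monotone_0_pi_le) auto
      then have "B * cos (p * s) \<le> B * cos (p * t)" using B by simp
      also have "\<dots> = -1" using cpt by (simp add: B_def)
      finally have "1 \<le> - B * cos (p * s)" by simp
      moreover have "0 \<le> A * cos s powr p" using A by simp
      ultimately show ?thesis using sin1 by linarith
    next
      case False
      then have "cos t \<le> cos s" using that t by (intro cos_monotone_0_pi_le) auto
      then have "A * cos t powr p \<le> A * cos s powr p"
        using A ct assms by (intro mult_left_mono powr_mono2) auto
      moreover have "A * cos t powr p = 1 + B" using ct by (simp add: A_def)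
      moreover have "B * cos (p * s) \<le> B" using B by simp
      ultimately show ?thesis using sin1 by linarith
    qed
  qed
  have "\<bar>Im w\<bar> powr p \<le> A * Re w powr p - B * Re (w powr of_real p)" if w: "0 < Re w" for w :: complex
  proof -
    define s r where "s = Arg w" and "r = cmod w"
    have r: "r > 0" and w0: "w \<noteq> 0" using w by (auto simp: r_def)
    have s: "\<bar>s\<bar> < pi / 2" using Arg_Re_pos w by (metis s_def Re_Ln_pos_lt Arg_def w0 Arg_eq_Im_Ln)
    have weq: "w = of_real r * cis s" using w0 by (simp add: r_def s_def rcis_cmod_Arg flip: rcis_def)
    have "Re (w powr of_real p) = r powr p * cos (p * s)"
    proof -
      have "Ln w = of_real (ln r) + \<i> * of_real s"
        using w0 by (simp add: complex_eq_iff r_def s_def Arg_eq_Im_Ln)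
      then have "w powr of_real p = exp (of_real (p * ln r)) * expi (p * s)"
        using w0 by (simp add: powr_def exp_add[symmetric] algebra_simps)
      also have "\<dots> = of_real (exp (p * ln r)) * cis (p * s)"
        by (simp only: exp_of_real cis_conv_exp)
      also have "Re \<dots> = r powr p * cos (p * s)"
        using r by (simp add: powr_def)
      finally show ?thesis .
    qed
    moreover have "Re w = r * cos s" "\<bar>Im w\<bar> = r * \<bar>sin s\<bar>" using r by (auto simp: weq abs_mult)
    moreover have "cos s > 0" using s cos_gt_zero_pi[of s] by (auto simp: abs_less_iff)
    moreover have "\<bar>sin \<bar>s\<bar>\<bar> powr p \<le> A * cos \<bar>s\<bar> powr p - B * cos (p * \<bar>s\<bar>)" by (rule angle) (use s in auto)
    then have "\<bar>sin s\<bar> powr p \<le> A * cos s powr p - B * cos (p * s)"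
    proof (cases "s \<ge> 0")
      case False
      moreover from this have "\<bar>s\<bar> = - s" by simp
      ultimately show ?thesis using \<open>\<bar>sin \<bar>s\<bar>\<bar> powr p \<le> _\<close> by simp
    qed auto
    then have "r powr p * \<bar>sin s\<bar> powr p \<le> r powr p * (A * cos s powr p - B * cos (p * s))"
      by (intro mult_left_mono) auto
    ultimately show ?thesis using r by (simp add: powr_mult algebra_simps)
  qed
  then show ?thesis using A B by (intro exI[of _ A] exI[of _ B]) auto
qed

text \<open>Cauchy's theorem on the triangle with vertices \<open>-n\<close>, \<open>n\<close>, \<open>\<i> n\<close>. Its two upper sides have length
at most \<open>2 n\<close> and stay at distance at least \<open>n / 2\<close> from 0, so decay of order \<open>p > 1\<close> makes their
contribution vanish.\<close>

lemma half_plane_integral_tendsto_0: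
  fixes f :: "complex \<Rightarrow> complex" and c p R0 :: real
  assumes hol: "f holomorphic_on {z. Im z > - 1}" and p: "1 < p" and c: "0 \<le> c"
    and bound: "\<And>z. 0 \<le> Im z \<Longrightarrow> R0 \<le> cmod z \<Longrightarrow> cmod (f z) \<le> c * cmod z powr (- p)"
  shows "(\<lambda>n. integral {- real n..real n} (\<lambda>x. f (of_real x))) \<longlonglongrightarrow> 0"
proof -
  have est: "norm (integral {- real n..real n} (\<lambda>x. f (of_real x))) \<le> 4 * c * (real n / 2) powr (- p) * real n"
    if n: "real n \<ge> 2 * R0" "n > 0" for n :: nat
  proof -
    define R where "R = real n"
    have R: "R > 0" using n by (simp add: R_def)
    let ?a = "of_real (- R) :: complex" and ?b = "of_real R :: complex" and ?d = "\<i> * of_real R"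
    have sub: "convex hull {?a, ?b, ?d} \<subseteq> {z. Im z \<ge> 0}"
      by (intro hull_minimal) (use R in \<open>auto simp: convex_halfspace_Im_ge\<close>)
    have "f holomorphic_on (convex hull {?a, ?b, ?d})"
      by (rule holomorphic_on_subset[OF hol]) (use sub in force)
    note ci = Cauchy_theorem_triangle[OF this]
    have sum0: "contour_integral (linepath ?a ?b) f + contour_integral (linepath ?b ?d) f
        + contour_integral (linepath ?d ?a) f = 0"
      by (rule has_chain_integral_chain_integral3[OF ci])
    have cont: "continuous_on {z. Im z > - 1} f" using hol by (rule holomorphic_on_imp_continuous_on)
    have hci: "(f has_contour_integral contour_integral (linepath u v) f) (linepath u v)"
      if "Im u \<ge> 0" "Im v \<ge> 0" for u v
    proof (rule has_contour_integral_integral, rule contour_integrable_continuous_linepath,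
           rule continuous_on_subset[OF cont])
      have "closed_segment u v \<subseteq> {z. Im z \<ge> 0}"
        using that by (intro closed_segment_subset) (auto simp: convex_halfspace_Im_ge)
      then show "closed_segment u v \<subseteq> {z. Im z > - 1}" by force
    qed
    let ?B = "c * (R / 2) powr (- p)"
    \<comment> \<open>On the two upper sides of the triangle \<open>|Re z| + Im z = R\<close>, hence \<open>|z| \<ge> R / 2\<close>.\<close>
    have small: "norm (f z) \<le> ?B" if z: "Im z \<ge> 0" "\<bar>Re z\<bar> + Im z \<ge> R" for z
    proof -
      have "R / 2 \<le> cmod z"
        using z abs_Re_le_cmod[of z] abs_Im_le_cmod[of z] by linarith
      moreover from this have "cmod (f z) \<le> c * cmod z powr (- p)"
        using z n by (intro bound) (auto simp: R_def)
      moreover from calculation(1) have "cmod z powr (- p) \<le> (R / 2) powr (- p)"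
        using R p by (intro powr_mono2') auto
      ultimately show ?thesis using c by (meson mult_left_mono order_trans)
    qed
    have seg1: "Im z \<ge> 0 \<and> \<bar>Re z\<bar> + Im z \<ge> R" if "z \<in> closed_segment ?b ?d" for z
    proof -
      from that obtain u where u: "0 \<le> u" "u \<le> 1" "z = (1 - u) *\<^sub>R ?b + u *\<^sub>R ?d"
        by (auto simp: in_segment)
      then have z: "Re z = (1 - u) * R" "Im z = u * R" by auto
      show ?thesis unfolding z using u(1,2) R by (simp add: abs_mult algebra_simps)
    qed
    have seg2: "Im z \<ge> 0 \<and> \<bar>Re z\<bar> + Im z \<ge> R" if "z \<in> closed_segment ?d ?a" for z
    proof -
      from that obtain u where u: "0 \<le> u" "u \<le> 1" "z = (1 - u) *\<^sub>R ?d + u *\<^sub>R ?a"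
        by (auto simp: in_segment)
      then have z: "Re z = - (u * R)" "Im z = (1 - u) * R" by auto
      show ?thesis unfolding z using u(1,2) R by (simp add: abs_mult algebra_simps)
    qed
    have B0: "?B \<ge> 0" using c by simp
    have n1: "norm (contour_integral (linepath ?b ?d) f) \<le> ?B * norm (?d - ?b)"
      by (rule has_contour_integral_bound_linepath[OF hci B0 small]) (use seg1 R in auto)
    have n2: "norm (contour_integral (linepath ?d ?a) f) \<le> ?B * norm (?a - ?d)"
      by (rule has_contour_integral_bound_linepath[OF hci B0 small]) (use seg2 R in auto)
    have d1: "norm (?d - ?b) \<le> 2 * R" "norm (?a - ?d) \<le> 2 * R"
      using R norm_triangle_ineq4[of ?d ?b] norm_triangle_ineq4[of ?a ?d] by (auto simp: norm_mult)
    have "contour_integral (linepath ?a ?b) f = - (contour_integral (linepath ?b ?d) f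
        + contour_integral (linepath ?d ?a) f)"
      using sum0 unfolding add.assoc by (rule eq_neg_iff_add_eq_0[THEN iffD2])
    then have "norm (contour_integral (linepath ?a ?b) f) \<le> 
       norm (contour_integral (linepath ?b ?d) f) + norm (contour_integral (linepath ?d ?a) f)"
      by (simp only: norm_minus_cancel norm_triangle_ineq)
    also have "\<dots> \<le> ?B * (2 * R) + ?B * (2 * R)"
      using n1 n2 mult_left_mono[OF d1(1) B0] mult_left_mono[OF d1(2) B0] by linarith
    finally have *: "norm (contour_integral (linepath ?a ?b) f) \<le> 4 * c * (R / 2) powr (- p) * R"
      by (simp add: algebra_simps)
    have "contour_integral (linepath ?a ?b) f = integral {- R..R} (\<lambda>x. f (of_real x))"
      using R by (subst contour_integral_linepath_Reals_eq) auto
    with * show ?thesis by (simp add: R_def)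
  qed
  have "(\<lambda>n. 4 * c * (real n / 2) powr (- p) * real n) \<longlonglongrightarrow> 0"
    using p by real_asymp
  moreover have "eventually (\<lambda>n. norm (integral {- real n..real n} (\<lambda>x. f (of_real x))) 
     \<le> 4 * c * (real n / 2) powr (- p) * real n) sequentially"
    using eventually_gt_at_top[of 0] eventually_ge_at_top[of "nat \<lceil>2 * R0\<rceil>"]
    by eventually_elim (rule est, linarith+)
  ultimately show ?thesis by (rule Lim_null_comparison[rotated])
qed

text \<open>These two kernels are the real and imaginary parts of \<open>\<i> / (x + \<i>)\<close>. The second one plays the role of \<open>1 / x\<close>: the two differ
by at most \<open>poisson x\<close> for \<open>|x| \<ge> 1\<close>, a summable error, and it has no singularity at 0, so it can be
sampled at integers and shifted by bounded amounts.\<close>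

definition poisson :: "real \<Rightarrow> real" where "poisson x = 1 / (1 + x\<^sup>2)"
definition conj_poisson :: "real \<Rightarrow> real" where "conj_poisson x = x / (1 + x\<^sup>2)"

lemma one_plus_square_pos [simp]: "0 < 1 + (x::real)\<^sup>2" "1 + x\<^sup>2 \<noteq> 0"
proof -
  show "0 < 1 + x\<^sup>2" by (rule add_pos_nonneg) auto
  then show "1 + x\<^sup>2 \<noteq> 0" by simp
qed

lemma poisson_pos [simp]: "0 < poisson x" "0 \<le> poisson x"
  by (simp_all add: poisson_def less_imp_le)

lemma poisson_le_1: "poisson x \<le> 1"
  by (simp add: poisson_def)

lemma continuous_on_poisson [continuous_intros]:
  "continuous_on S f \<Longrightarrow> continuous_on S (\<lambda>x. poisson (f x))"
  unfolding poisson_def by (intro continuous_intros) auto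

lemma continuous_on_conj_poisson [continuous_intros]:
  "continuous_on S f \<Longrightarrow> continuous_on S (\<lambda>x. conj_poisson (f x))"
  unfolding conj_poisson_def by (intro continuous_intros) auto

lemma conj_poisson_minus [simp]: "conj_poisson (- x) = - conj_poisson x"
  by (simp add: conj_poisson_def)

lemma poisson_minus [simp]: "poisson (- x) = poisson x"
  by (simp add: poisson_def)

lemma square_le_near:
  fixes x y :: real
  assumes "\<bar>x - y\<bar> \<le> 1"
  shows "y\<^sup>2 \<le> 2 + 2 * x\<^sup>2"
proof -
  have "(y - x)\<^sup>2 \<le> 1" using assms by (simp add: abs_square_le_1 abs_minus_commute)
  moreover have "2 + 2 * x\<^sup>2 - y\<^sup>2 = 2 * (1 - (y - x)\<^sup>2) + (y - 2 * x)\<^sup>2"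
    by (simp add: power2_eq_square algebra_simps)
  moreover have "0 \<le> 2 * (1 - (y - x)\<^sup>2) + (y - 2 * x)\<^sup>2"
    using calculation(1) by (intro add_nonneg_nonneg mult_nonneg_nonneg) auto
  ultimately have "0 \<le> 2 + 2 * x\<^sup>2 - y\<^sup>2" by (simp only:)
  then show ?thesis by simp
qed

lemma poisson_shift_le:
  assumes "\<bar>x - y\<bar> \<le> 1"
  shows "poisson x \<le> 3 * poisson y"
proof -
  have "1 + y\<^sup>2 \<le> 3 * (1 + x\<^sup>2)"
    using square_le_near[OF assms] zero_le_power2[of x] unfolding distrib_left by linarith
  then show ?thesis by (simp add: poisson_def field_simps)
qed

text \<open>Moving the argument by at most 1 costs only a summable kernel. This is what allows
operators to be compared at integers and at real points.\<close>

lemma conj_poisson_shift_le: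
  assumes "\<bar>x - y\<bar> \<le> 1"
  shows "\<bar>conj_poisson x - conj_poisson y\<bar> \<le> 2 * poisson y"
proof -
  have eq: "conj_poisson x - conj_poisson y = (x - y) * ((1 - x * y) * (poisson x * poisson y))"
  proof -
    have "conj_poisson x - conj_poisson y = (x * (1 + y\<^sup>2) - y * (1 + x\<^sup>2)) / ((1 + x\<^sup>2) * (1 + y\<^sup>2))"
      by (simp add: conj_poisson_def diff_frac_eq)
    moreover have "x * (1 + y\<^sup>2) - y * (1 + x\<^sup>2) = (x - y) * (1 - x * y)"
      by (simp add: power2_eq_square algebra_simps)
    ultimately show ?thesis by (simp add: poisson_def)
  qed
  have "\<bar>1 - x * y\<bar> \<le> 2 * (1 + x\<^sup>2)"
  proof -
    have "2 * \<bar>x * y\<bar> \<le> x\<^sup>2 + y\<^sup>2"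
      using zero_le_power2[of "\<bar>x\<bar> - \<bar>y\<bar>"] by (simp add: power2_eq_square algebra_simps abs_mult)
    then have "\<bar>x * y\<bar> \<le> 1 + 2 * x\<^sup>2"
      using square_le_near[OF assms] zero_le_power2[of x] by linarith
    moreover have "\<bar>1 - x * y\<bar> \<le> 1 + \<bar>x * y\<bar>"
      using abs_triangle_ineq4[of 1 "x * y"] by simp
    ultimately show ?thesis unfolding distrib_left by linarith
  qed
  then have "\<bar>1 - x * y\<bar> * poisson x \<le> 2 * (1 + x\<^sup>2) * poisson x"
    by (intro mult_right_mono) auto
  also have "\<dots> = 2" unfolding poisson_def by (metis mult.assoc mult.right_neutral one_plus_square_pos(2) nonzero_mult_div_cancel_right times_divide_eq_right)
  finally have "\<bar>1 - x * y\<bar> * poisson x * poisson y \<le> 2 * poisson y"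
    by (intro mult_right_mono) auto
  moreover have "\<bar>x - y\<bar> * (\<bar>1 - x * y\<bar> * poisson x * poisson y) \<le> 1 * (\<bar>1 - x * y\<bar> * poisson x * poisson y)"
    using assms by (intro mult_right_mono) auto
  then have "\<bar>conj_poisson x - conj_poisson y\<bar> \<le> \<bar>1 - x * y\<bar> * poisson x * poisson y"
    by (simp add: eq abs_mult mult.assoc)
  ultimately show ?thesis by linarith
qed

lemma sum_poisson_bounded: "\<exists>W>0. \<forall>F::int set. finite F \<longrightarrow> (\<Sum>n\<in>F. poisson (of_int n)) \<le> W"
proof -
  have s: "summable (\<lambda>n. 1 / (real n)\<^sup>2)"
    using inverse_power_summable[of 2, where ?'a = real] by (simp add: inverse_eq_divide)
  define S where "S = (\<Sum>n. 1 / (real n)\<^sup>2)"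
  have "(\<Sum>n\<in>F. poisson (of_int n)) \<le> 1 + (S + S)" if F: "finite F" for F :: "int set"
  proof -
    have half: "(\<Sum>n\<in>G. poisson (of_int n)) \<le> S" if G: "finite G" "\<And>n. n \<in> G \<Longrightarrow> n \<noteq> 0" 
       "inj_on (\<lambda>n. nat \<bar>n\<bar>) G" for G :: "int set"
    proof -
      have "(\<Sum>n\<in>G. poisson (of_int n)) \<le> (\<Sum>n\<in>G. 1 / (real (nat \<bar>n\<bar>))\<^sup>2)"
      proof (rule sum_mono)
        fix n assume "n \<in> G"
        then have "n \<noteq> 0" using G by auto
        then show "poisson (real_of_int n) \<le> 1 / (real (nat \<bar>n\<bar>))\<^sup>2"
          by (simp add: poisson_def field_simps)
      qed
      also have "\<dots> = (\<Sum>k\<in>(\<lambda>n. nat \<bar>n\<bar>) ` G. 1 / (real k)\<^sup>2)"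
        using G by (subst sum.reindex) auto
      also have "\<dots> \<le> S" unfolding S_def by (rule sum_le_suminf[OF s]) (use G in auto)
      finally show ?thesis .
    qed
    have "(\<Sum>n\<in>F. poisson (of_int n)) \<le> (\<Sum>n\<in>{0} \<union> ({n\<in>F. n > 0} \<union> {n\<in>F. n < 0}). poisson (of_int n))"
      by (rule sum_mono2) (use F in \<open>auto simp: less_imp_le\<close>)
    also have "\<dots> = poisson 0 + ((\<Sum>n\<in>{n\<in>F. n > 0}. poisson (of_int n)) + (\<Sum>n\<in>{n\<in>F. n < 0}. poisson (of_int n)))"
      using F by (subst sum.union_disjoint, (force+)[3])+ simp
    also have "\<dots> \<le> 1 + (S + S)"
      by (intro add_mono half poisson_le_1) (use F in \<open>auto simp: inj_on_def\<close>)
    finally show ?thesis .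
  qed
  moreover have "S \<ge> 0" unfolding S_def by (rule suminf_nonneg[OF s]) auto
  ultimately show ?thesis by (intro exI[of _ "1 + (S + S)"]) auto
qed

abbreviation lp_sum :: "real \<Rightarrow> int set \<Rightarrow> (int \<Rightarrow> complex) \<Rightarrow> real" where
  "lp_sum p J a \<equiv> \<Sum>j\<in>J. cmod (a j) powr p"

definition conj_conv :: "int set \<Rightarrow> (int \<Rightarrow> complex) \<Rightarrow> real \<Rightarrow> complex" where
  "conj_conv J a x = (\<Sum>j\<in>J. a j * of_real (conj_poisson (x - of_int j)))"

definition poisson_conv :: "int set \<Rightarrow> (int \<Rightarrow> complex) \<Rightarrow> real \<Rightarrow> real" where
  "poisson_conv J a x = (\<Sum>j\<in>J. cmod (a j) * poisson (x - of_int j))"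

lemma poisson_conv_nonneg [simp]: "0 \<le> poisson_conv J a x"
  unfolding poisson_conv_def by (intro sum_nonneg) auto

text \<open>Young's convolution inequality: the kernel is summable over the integers.\<close>

lemma poisson_conv_lp_bound:
  assumes p: "1 < p"
  shows "\<exists>K\<ge>0. \<forall>J F a. finite J \<longrightarrow> finite F \<longrightarrow>
    (\<Sum>n\<in>F. poisson_conv J a (of_int n) powr p) \<le> K * lp_sum p J a"
proof -
  obtain W where W: "W > 0" "\<And>F::int set. finite F \<Longrightarrow> (\<Sum>n\<in>F. poisson (of_int n)) \<le> W"
    using sum_poisson_bounded by blast
  have shift: "(\<Sum>j\<in>J. poisson (of_int n - of_int j)) \<le> W" if "finite J" for J and n :: int
  proof -
    have "(\<Sum>j\<in>J. poisson (of_int n - of_int j)) = (\<Sum>m\<in>(\<lambda>j. n - j) ` J. poisson (of_int m))"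
      by (subst sum.reindex) (auto simp: inj_on_def)
    also have "\<dots> \<le> W" by (rule W) (use that in auto)
    finally show ?thesis .
  qed
  have "(\<Sum>n\<in>F. poisson_conv J a (of_int n) powr p) \<le> W powr p * lp_sum p J a"
    if J: "finite J" and F: "finite F" for J F a
  proof -
    have "poisson_conv J a (of_int n) powr p \<le> W powr (p - 1) * (\<Sum>j\<in>J. poisson (of_int n - of_int j) * cmod (a j) powr p)" for n
    proof -
      have "poisson_conv J a (of_int n) powr p \<le> (\<Sum>j\<in>J. poisson (of_int n - of_int j)) powr (p - 1) * 
          (\<Sum>j\<in>J. poisson (of_int n - of_int j) * cmod (a j) powr p)"
        unfolding poisson_conv_def
        by (subst mult.commute, rule powr_sum_weighted_le[OF p]) auto
      also have "\<dots> \<le> W powr (p - 1) * (\<Sum>j\<in>J. poisson (of_int n - of_int j) * cmod (a j) powr p)"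
        using p by (intro mult_right_mono powr_mono2 shift J sum_nonneg) (auto intro!: sum_nonneg)
      finally show ?thesis .
    qed
    then have "(\<Sum>n\<in>F. poisson_conv J a (of_int n) powr p) \<le> 
       (\<Sum>n\<in>F. W powr (p - 1) * (\<Sum>j\<in>J. poisson (of_int n - of_int j) * cmod (a j) powr p))"
      by (rule sum_mono)
    also have "\<dots> = W powr (p - 1) * (\<Sum>j\<in>J. cmod (a j) powr p * (\<Sum>n\<in>F. poisson (of_int j - of_int n)))"
      unfolding sum_distrib_left[symmetric]
      by (subst sum.swap) (simp add: sum_distrib_left mult.commute poisson_def power2_commute)
    also have "\<dots> \<le> W powr (p - 1) * (\<Sum>j\<in>J. cmod (a j) powr p * W)"
      by (intro mult_left_mono sum_mono shift F) auto
    also have "\<dots> = W powr p * lp_sum p J a"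
      using W by (simp add: sum_distrib_right[symmetric] powr_diff)
    finally show ?thesis .
  qed
  then show ?thesis by (intro exI[of _ "W powr p"]) auto
qed

lemma integral_split_unit:
  fixes g :: "real \<Rightarrow> real"
  assumes "continuous_on UNIV g"
  shows "integral {- real M..real M} g = (\<Sum>n\<in>{- int M..<int M}. integral {of_int n..of_int n + 1} g)"
proof (induction M)
  case (Suc M)
  have io: "g integrable_on {u..v}" for u v
    by (rule integrable_continuous_real) (use assms continuous_on_subset in blast)
  have e: "{- int (Suc M)..<int (Suc M)} = insert (- int M - 1) (insert (int M) {- int M..<int M})" by auto
  have h: "integral {- real (Suc M)..real (Suc M)} g = integral {- real (Suc M)..- real M} g 
     + (integral {- real M..real M} g + integral {real M..real (Suc M)} g)"
    using Henstock_Kurzweil_Integration.integral_combine[OF _ _ io, of "- real (Suc M)" "- real M" "real (Suc M)"]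
      Henstock_Kurzweil_Integration.integral_combine[OF _ _ io, of "- real M" "real M" "real (Suc M)"] by simp
  define I where "I n = integral {of_int n..of_int n + 1} g" for n :: int
  have s: "(\<Sum>n\<in>{- int (Suc M)..<int (Suc M)}. I n) = I (- int M - 1) + (I (int M) + (\<Sum>n\<in>{- int M..<int M}. I n))"
    unfolding e by simp
  have i: "I (- int M - 1) = integral {- real (Suc M)..- real M} g" "I (int M) = integral {real M..real (Suc M)} g"
    unfolding I_def by (rule arg_cong[where f = "\<lambda>S. integral S g"], simp add: add.commute)+
  show ?case using Suc unfolding I_def[symmetric] h s i by (simp only: add_ac)
qed auto

lemma conj_conv_shift_le:
  assumes "\<bar>x - y\<bar> \<le> 1"
  shows "cmod (conj_conv J a x - conj_conv J a y) \<le> 2 * poisson_conv J a y"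
proof -
  have "cmod (conj_conv J a x - conj_conv J a y) \<le>
     (\<Sum>j\<in>J. cmod (a j * of_real (conj_poisson (x - of_int j) - conj_poisson (y - of_int j))))"
    unfolding conj_conv_def sum_subtractf[symmetric] by (rule order_trans[OF norm_sum]) (simp add: algebra_simps)
  also have "\<dots> \<le> (\<Sum>j\<in>J. cmod (a j) * (2 * poisson (y - of_int j)))"
    unfolding norm_mult norm_of_real
    by (intro sum_mono mult_left_mono conj_poisson_shift_le) (use assms in auto)
  finally show ?thesis by (simp add: poisson_conv_def sum_distrib_left mult_ac)
qed

lemma poisson_conv_shift_le:
  assumes "\<bar>x - y\<bar> \<le> 1"
  shows "poisson_conv J a x \<le> 3 * poisson_conv J a y"
proof -
  have "poisson_conv J a x \<le> (\<Sum>j\<in>J. cmod (a j) * (3 * poisson (y - of_int j)))"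
    unfolding poisson_conv_def
    by (intro sum_mono mult_left_mono poisson_shift_le) (use assms in auto)
  then show ?thesis by (simp add: poisson_conv_def sum_distrib_left mult_ac)
qed

text \<open>For \<open>a \<ge> 0\<close> the function \<open>w(z) = \<Sum>j. a\<^sub>j \<i> / (z - j + \<i>)\<close> equals \<open>U + \<i> V\<close> on the real line, with \<open>V\<close> the
convolution to be estimated and \<open>U \<ge> 0\<close> a Poisson convolution. The inequality for \<open>|Im w|\<^sup>p\<close> and the
vanishing of the integral of \<open>w\<^sup>p\<close> bound \<open>V\<close> by \<open>U\<close> in \<open>L\<^sup>p\<close>; the comparison between real points and integers
turns this into a bound between sums.\<close>

lemma conj_conv_lp_bound_nonneg:
  assumes p: "1 < p" "p \<le> 2"
  shows "\<exists>K\<ge>0. \<forall>J F (a::int \<Rightarrow> real). finite J \<longrightarrow> finite F \<longrightarrow> (\<forall>j. 0 \<le> a j) \<longrightarrow>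
    (\<Sum>n\<in>F. cmod (conj_conv J (\<lambda>j. of_real (a j)) (of_int n)) powr p) \<le> K * (\<Sum>j\<in>J. a j powr p)"
proof -
  obtain K where K: "K \<ge> 0" "\<And>J F a. finite J \<Longrightarrow> finite F \<Longrightarrow>
      (\<Sum>n\<in>F. poisson_conv J a (of_int n) powr p) \<le> K * lp_sum p J a"
    using poisson_conv_lp_bound[OF p(1)] by blast
  obtain A B where AB: "0 \<le> A" "0 \<le> B" "\<And>w::complex. 0 < Re w \<Longrightarrow>
     \<bar>Im w\<bar> powr p \<le> A * Re w powr p - B * Re (w powr of_real p)"
    using Im_powr_le_Re[OF p] by blast
  define K' where "K' = (2 powr p * A * 3 powr p + 4 powr p) * K"
  have "(\<Sum>n\<in>F. cmod (conj_conv J (\<lambda>j. of_real (a j)) (of_int n)) powr p) \<le> K' * (\<Sum>j\<in>J. a j powr p)"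
    if J: "finite J" and F: "finite F" and a: "\<And>j. 0 \<le> a j" for J F and a :: "int \<Rightarrow> real"
  proof (cases "\<forall>j\<in>J. a j = 0")
    case True
    then show ?thesis using p by (simp add: conj_conv_def)
  next
    case False
    then obtain k where k: "k \<in> J" "a k > 0" using a by (metis less_eq_real_def)
    let ?a = "\<lambda>j. complex_of_real (a j)"
    define w where "w z = (\<Sum>j\<in>J. of_real (a j) * (\<i> / (z - of_int j + \<i>)))" for z
    define V where "V x = (\<Sum>j\<in>J. a j * conj_poisson (x - of_int j))" for x
    define U where "U x = poisson_conv J ?a x" for x
    define T where "T = (\<Sum>j\<in>J. a j powr p)"
    have Vc: "conj_conv J ?a x = of_real (V x)" for x
      by (simp add: conj_conv_def V_def)
    have Ueq: "U x = (\<Sum>j\<in>J. a j * poisson (x - of_int j))" for x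
      using a by (simp add: U_def poisson_conv_def)
    have U0: "U x \<ge> 0" for x by (simp add: U_def)
    have Kp: "(\<Sum>n\<in>G. U (of_int n) powr p) \<le> K * T" if "finite G" for G
      using K(2)[OF J that, of ?a] a by (simp add: U_def T_def)
    have w_real: "w (of_real x) = Complex (U x) (V x)" for x
    proof -
      have "\<i> / (of_real x - of_int j + \<i>) = Complex (poisson (x - of_int j)) (conj_poisson (x - of_int j))" for j :: int
        by (simp add: complex_eq_iff Re_divide Im_divide poisson_def conj_poisson_def add.commute)
      then have "Re (w (of_real x)) = U x" "Im (w (of_real x)) = V x"
        unfolding w_def Ueq V_def by simp_all
      then show ?thesis by (simp add: complex_eq_iff)
    qed
    have Re_w: "Re (w z) > 0" if z: "Im z > - 1" for z
    proof -
      have *: "Re (\<i> / (z - of_int j + \<i>)) > 0" for j :: int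
      proof -
        have "Im z + 1 > 0" using z by simp
        then have "(Re z - of_int j)\<^sup>2 + (Im z + 1)\<^sup>2 > 0" by (intro add_nonneg_pos) auto
        then show ?thesis using z by (simp add: Re_divide)
      qed
      have "0 < (\<Sum>j\<in>J. a j * Re (\<i> / (z - of_int j + \<i>)))"
        by (rule sum_pos2[OF J k(1)]) (use k * a in \<open>auto simp: less_imp_le intro!: mult_nonneg_nonneg\<close>)
      then show ?thesis by (simp add: w_def del: times_divide_eq_right)
    qed
    define f where "f z = w z powr of_real p" for z
    have hol: "f holomorphic_on {z. Im z > - 1}"
    proof -
      have "z - of_int j + \<i> \<noteq> 0" if "Im z > - 1" for z and j :: int
        using that by (auto simp: complex_eq_iff)
      then have "w holomorphic_on {z. Im z > - 1}"
        unfolding w_def by (intro holomorphic_intros) auto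
      then have "(\<lambda>z. exp (of_real p * Ln (w z))) holomorphic_on {z. Im z > - 1}"
        by (intro holomorphic_intros) (use Re_w complex_nonpos_Reals_iff in fastforce)
      then show ?thesis
      proof (rule holomorphic_transform)
        fix z assume "z \<in> {z. Im z > - 1}"
        then have "w z \<noteq> 0" using Re_w[of z] by auto
        then show "exp (of_real p * Ln (w z)) = f z" by (simp add: f_def powr_def)
      qed
    qed
    define R0 where "R0 = 1 + 2 * (\<Sum>j\<in>J. \<bar>real_of_int j\<bar>)"
    define S where "S = (\<Sum>j\<in>J. a j)"
    have decay: "cmod (f z) \<le> (2 * S) powr p * cmod z powr (- p)" if z: "0 \<le> Im z" "R0 \<le> cmod z" for z
    proof -
      have z0: "cmod z > 0" using z sum_nonneg[of J "\<lambda>j. \<bar>real_of_int j\<bar>", OF abs_ge_zero] unfolding R0_def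
        by linarith
      have "cmod (w z) \<le> (\<Sum>j\<in>J. a j * (2 / cmod z))"
        unfolding w_def
      proof (rule order_trans[OF norm_sum], rule sum_mono)
        fix j assume j: "j \<in> J"
        have "\<bar>real_of_int j\<bar> \<le> (\<Sum>j\<in>J. \<bar>real_of_int j\<bar>)"
          using J j by (intro member_le_sum) auto
        then have "2 * \<bar>real_of_int j\<bar> \<le> cmod z" using z by (simp add: R0_def)
        then have "cmod z / 2 \<le> cmod (z - of_int j)"
          using norm_triangle_ineq2[of z "of_int j"] by simp
        also have "\<dots> \<le> cmod (z - of_int j + \<i>)"
          using z by (auto simp: cmod_def intro!: real_sqrt_le_mono power_mono add_mono)
        finally have "1 / cmod (z - of_int j + \<i>) \<le> 2 / cmod z"
          using z0 frac_le[of 1 1 "cmod z / 2" "cmod (z - of_int j + \<i>)"] by simp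
        then show "cmod (of_real (a j) * (\<i> / (z - of_int j + \<i>))) \<le> a j * (2 / cmod z)"
          using a[of j] by (simp add: norm_mult norm_divide mult_left_mono del: times_divide_eq_right)
      qed
      also have "\<dots> = 2 * S / cmod z"
        by (simp add: S_def sum_divide_distrib sum_distrib_right mult.commute)
      finally have "cmod (w z) powr p \<le> (2 * S / cmod z) powr p"
        using p by (intro powr_mono2) auto
      also have "\<dots> = (2 * S) powr p * cmod z powr (- p)"
        using z0 a by (simp add: powr_divide S_def sum_nonneg powr_minus_divide)
      finally show ?thesis by (simp add: f_def norm_powr_real_powr')
    qed
    have lim: "(\<lambda>n. integral {- real n..real n} (\<lambda>x. f (of_real x))) \<longlonglongrightarrow> 0"
      by (rule half_plane_integral_tendsto_0[OF hol p(1) _ decay]) auto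
    have contV: "continuous_on UNIV (\<lambda>x. \<bar>V x\<bar> powr p)"
      unfolding V_def using p by (intro continuous_on_powr' continuous_intros) auto
    have contU: "continuous_on UNIV (\<lambda>x. U x powr p)"
      using p U0 unfolding Ueq by (intro continuous_on_powr' continuous_intros) auto
    have contf: "continuous_on UNIV (\<lambda>x. f (of_real x))"
      by (rule continuous_on_compose2[OF holomorphic_on_imp_continuous_on[OF hol]])
         (auto intro: continuous_intros)
    have io: "h integrable_on {u..v}" if "continuous_on UNIV h" for h :: "real \<Rightarrow> 'z::banach" and u v
      by (rule integrable_continuous_real) (use that continuous_on_subset in blast)
    let ?F = "\<lambda>M::nat. integral {- real M..real M} (\<lambda>x. f (of_real x))"
    have main: "(\<Sum>n\<in>{- int M..<int M}. \<bar>V (of_int n)\<bar> powr p) \<le> 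
       K' * T - 2 powr p * B * Re (?F M)" for M
    proof -
      have V1: "\<bar>V (of_int n)\<bar> powr p \<le> 2 powr p * integral {of_int n..of_int n + 1} (\<lambda>x. \<bar>V x\<bar> powr p) 
          + 4 powr p * U (of_int n) powr p" for n
      proof -
        have "\<bar>V (of_int n)\<bar> powr p \<le> 2 powr p * \<bar>V x\<bar> powr p + 4 powr p * U (of_int n) powr p"
          if x: "x \<in> {of_int n..of_int n + 1}" for x
        proof -
          have "cmod (conj_conv J ?a x - conj_conv J ?a (of_int n)) \<le> 2 * U (of_int n)"
            unfolding U_def by (rule conj_conv_shift_le) (use x in auto)
          then have "\<bar>V x - V (of_int n)\<bar> \<le> 2 * U (of_int n)"
            unfolding Vc by (metis norm_of_real of_real_diff real_norm_def)
          then have "\<bar>V (of_int n)\<bar> powr p \<le> (\<bar>V x\<bar> + 2 * U (of_int n)) powr p"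
            using p by (intro powr_mono2) auto
          also have "\<dots> \<le> 2 powr p * (\<bar>V x\<bar> powr p + (2 * U (of_int n)) powr p)"
            using U0 by (intro powr_add_le p) auto
          also have "\<dots> = 2 powr p * \<bar>V x\<bar> powr p + 4 powr p * U (of_int n) powr p"
            using U0 powr_mult[of 2 2 p] by (simp add: powr_mult algebra_simps)
          finally show ?thesis .
        qed
        then have "integral {of_int n..of_int n + 1} (\<lambda>x::real. \<bar>V (of_int n)\<bar> powr p) \<le>
           integral {of_int n..of_int n + 1} (\<lambda>x. 2 powr p * \<bar>V x\<bar> powr p + 4 powr p * U (of_int n) powr p)"
          by (intro integral_le io continuous_on_mult_left continuous_on_add continuous_on_diff continuous_on_const continuous_on_Re contV)
        also have "\<dots> = 2 powr p * integral {of_int n..of_int n + 1} (\<lambda>x. \<bar>V x\<bar> powr p) 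
          + 4 powr p * U (of_int n) powr p"
          by (subst Henstock_Kurzweil_Integration.integral_add) (auto intro!: io continuous_on_mult_left continuous_on_add continuous_on_diff continuous_on_const continuous_on_Re contV)
        finally show ?thesis by simp
      qed
      have U1: "integral {of_int n..of_int n + 1} (\<lambda>x. U x powr p) \<le> 3 powr p * U (of_int n) powr p" for n
      proof -
        have "U x powr p \<le> 3 powr p * U (of_int n) powr p" if x: "x \<in> {of_int n..of_int n + 1}" for x
        proof -
          have "U x \<le> 3 * U (of_int n)"
            unfolding U_def by (rule poisson_conv_shift_le) (use x in auto)
          then have "U x powr p \<le> (3 * U (of_int n)) powr p"
            using p U0 by (intro powr_mono2) auto
          then show ?thesis using U0 by (simp add: powr_mult)
        qed
        then have "integral {of_int n..of_int n + 1} (\<lambda>x. U x powr p) \<le>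
           integral {of_int n..of_int n + 1} (\<lambda>x::real. 3 powr p * U (of_int n) powr p)"
          by (intro integral_le io continuous_on_mult_left continuous_on_add continuous_on_diff continuous_on_const continuous_on_Re contU)
        then show ?thesis by simp
      qed
      let ?I = "{- int M..<int M}"
      have "integral {- real M..real M} (\<lambda>x. \<bar>V x\<bar> powr p) \<le> 
         integral {- real M..real M} (\<lambda>x. A * U x powr p - B * Re (f (of_real x)))"
      proof (intro integral_le io continuous_on_mult_left continuous_on_add continuous_on_diff continuous_on_const continuous_on_Re contV contU contf)
        fix x :: real
        show "\<bar>V x\<bar> powr p \<le> A * U x powr p - B * Re (f (of_real x))"
          using AB(3)[of "w (of_real x)"] Re_w[of "of_real x"] by (simp add: f_def w_real)
      qed
      also have "\<dots> = A * integral {- real M..real M} (\<lambda>x. U x powr p) 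
         - B * integral {- real M..real M} (\<lambda>x. Re (f (of_real x)))"
        by (subst Henstock_Kurzweil_Integration.integral_diff) (auto intro!: io continuous_on_mult_left continuous_on_add continuous_on_diff continuous_on_const continuous_on_Re contU contf)
      also have "integral {- real M..real M} (\<lambda>x. Re (f (of_real x))) = 
          Re (?F M)"
        using integral_linear[OF io[OF contf] bounded_linear_Re] by (simp add: o_def)
      also have "integral {- real M..real M} (\<lambda>x. U x powr p) \<le> 3 powr p * (K * T)"
      proof -
        have "integral {- real M..real M} (\<lambda>x. U x powr p) = (\<Sum>n\<in>?I. integral {of_int n..of_int n + 1} (\<lambda>x. U x powr p))"
          by (rule integral_split_unit[OF contU])
        also have "\<dots> \<le> 3 powr p * (\<Sum>n\<in>?I. U (of_int n) powr p)"
          unfolding sum_distrib_left by (intro sum_mono U1)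
        also have "\<dots> \<le> 3 powr p * (K * T)" by (intro mult_left_mono Kp) auto
        finally show ?thesis .
      qed
      finally have V2: "integral {- real M..real M} (\<lambda>x. \<bar>V x\<bar> powr p) \<le> 
         A * (3 powr p * (K * T)) - B * Re (?F M)"
        using AB by (simp add: mult_left_mono)
      have "(\<Sum>n\<in>?I. \<bar>V (of_int n)\<bar> powr p) \<le> 2 powr p * (\<Sum>n\<in>?I. integral {of_int n..of_int n + 1} (\<lambda>x. \<bar>V x\<bar> powr p)) 
          + 4 powr p * (\<Sum>n\<in>?I. U (of_int n) powr p)"
        unfolding sum_distrib_left sum.distrib[symmetric] by (intro sum_mono V1)
      also have "\<dots> \<le> 2 powr p * (A * (3 powr p * (K * T)) - B * Re (?F M))
          + 4 powr p * (K * T)"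
        unfolding integral_split_unit[OF contV, symmetric] by (intro add_mono mult_left_mono V2 Kp) auto
      finally show ?thesis by (simp add: K'_def algebra_simps)
    qed
    have "(\<Sum>n\<in>F. \<bar>V (of_int n)\<bar> powr p) \<le> K' * T - 2 powr p * B * Re 0"
    proof (rule LIMSEQ_le_const)
      show "(\<lambda>M. K' * T - 2 powr p * B * Re (?F M)) 
         \<longlonglongrightarrow> K' * T - 2 powr p * B * Re 0"
        by (intro tendsto_intros lim)
      obtain M0 where M0: "F \<subseteq> {- int M0..<int M0}"
      proof -
        define b where "b = (\<Sum>n\<in>F. \<bar>n\<bar>)"
        have "\<bar>n\<bar> \<le> b" if "n \<in> F" for n
          unfolding b_def using F that by (intro member_le_sum) auto
        then show ?thesis using that[of "nat b + 1"] by force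
      qed
      have "(\<Sum>n\<in>F. \<bar>V (of_int n)\<bar> powr p) \<le> K' * T - 2 powr p * B * Re (?F M)"
        if "M \<ge> M0" for M
        by (rule order_trans[OF sum_mono2 main]) (use M0 that in force)+
      then show "\<exists>N. \<forall>M\<ge>N. (\<Sum>n\<in>F. \<bar>V (of_int n)\<bar> powr p) \<le> K' * T - 2 powr p * B * Re (?F M)"
        by blast
    qed
    then show ?thesis by (simp add: Vc T_def)
  qed
  moreover have "K' \<ge> 0" using AB K by (auto simp: K'_def)
  ultimately show ?thesis by (intro exI[of _ K']) auto
qed

lemma conj_conv_add: "conj_conv J (\<lambda>j. a j + b j) x = conj_conv J a x + conj_conv J b x"
  by (simp add: conj_conv_def distrib_right sum.distrib)

lemma conj_conv_cmult: "conj_conv J (\<lambda>j. c * a j) x = c * conj_conv J a x"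
  by (simp add: conj_conv_def sum_distrib_left mult.assoc)

text \<open>Two applications of this step, to the positive and negative parts and then to the real and imaginary parts,
extend the bound from nonnegative to complex sequences.\<close>

lemma conj_conv_lp_bound_split:
  assumes p: "1 < p" and "0 \<le> K"
    and split: "\<And>x. cmod (conj_conv J a x) \<le> cmod (conj_conv J b x) + cmod (conj_conv J c x)"
    and le: "\<And>j. cmod (b j) \<le> cmod (a j)" "\<And>j. cmod (c j) \<le> cmod (a j)"
    and b: "(\<Sum>n\<in>F. cmod (conj_conv J b (of_int n)) powr p) \<le> K * (\<Sum>j\<in>J. cmod (b j) powr p)"
    and c: "(\<Sum>n\<in>F. cmod (conj_conv J c (of_int n)) powr p) \<le> K * (\<Sum>j\<in>J. cmod (c j) powr p)"
  shows "(\<Sum>n\<in>F. cmod (conj_conv J a (of_int n)) powr p) \<le> 2 powr p * (2 * K) * lp_sum p J a"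
proof -
  have "cmod (conj_conv J a x) powr p \<le> 2 powr p * (cmod (conj_conv J b x) powr p + cmod (conj_conv J c x) powr p)" for x
    by (rule order_trans[OF powr_mono2 powr_add_le]) (use p split in auto)
  then have "(\<Sum>n\<in>F. cmod (conj_conv J a (of_int n)) powr p) \<le> 
      2 powr p * ((\<Sum>n\<in>F. cmod (conj_conv J b (of_int n)) powr p) + (\<Sum>n\<in>F. cmod (conj_conv J c (of_int n)) powr p))"
    unfolding sum.distrib[symmetric] sum_distrib_left by (rule sum_mono)
  also have "\<dots> \<le> 2 powr p * (K * lp_sum p J a + K * lp_sum p J a)"
    using p le \<open>0 \<le> K\<close>
    by (intro mult_left_mono add_mono order_trans[OF b] order_trans[OF c] sum_mono powr_mono2) auto
  finally show ?thesis by (simp add: algebra_simps)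
qed

lemma conj_conv_lp_bound_le2:
  assumes p: "1 < p" "p \<le> 2"
  shows "\<exists>K\<ge>0. \<forall>J F a. finite J \<longrightarrow> finite F \<longrightarrow>
    (\<Sum>n\<in>F. cmod (conj_conv J a (of_int n)) powr p) \<le> K * lp_sum p J a"
proof -
  obtain K where K: "K \<ge> 0" "\<And>J F a. finite J \<Longrightarrow> finite F \<Longrightarrow> (\<And>j. 0 \<le> a j) \<Longrightarrow>
    (\<Sum>n\<in>F. cmod (conj_conv J (\<lambda>j. of_real (a j)) (of_int n)) powr p) \<le> K * (\<Sum>j\<in>J. a j powr p)"
    using conj_conv_lp_bound_nonneg[OF p] by metis
  define K1 where "K1 = 2 powr p * (2 * K)"
  have K1: "K1 \<ge> 0" using K by (simp add: K1_def)
  have real: "(\<Sum>n\<in>F. cmod (conj_conv J (\<lambda>j. of_real (r j)) (of_int n)) powr p) \<le> 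
      K1 * (\<Sum>j\<in>J. cmod (of_real (r j) :: complex) powr p)"
    if J: "finite J" and F: "finite F" for J F and r :: "int \<Rightarrow> real"
    unfolding K1_def
  proof (rule conj_conv_lp_bound_split[OF p(1) K(1), of J "\<lambda>j. of_real (r j)" 
        "\<lambda>j. of_real (max (r j) 0)" "\<lambda>j. of_real (max (- r j) 0)" F])
    fix x
    have "(\<lambda>j. complex_of_real (r j)) = (\<lambda>j. of_real (max (r j) 0) + (- 1) * of_real (max (- r j) 0))"
      by (auto simp: max_def)
    then have "conj_conv J (\<lambda>j. of_real (r j)) x = 
        conj_conv J (\<lambda>j. of_real (max (r j) 0)) x + (- 1) * conj_conv J (\<lambda>j. of_real (max (- r j) 0)) x"
      by (simp only: conj_conv_add conj_conv_cmult)
    then show "cmod (conj_conv J (\<lambda>j. of_real (r j)) x) \<le> 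
        cmod (conj_conv J (\<lambda>j. of_real (max (r j) 0)) x) + cmod (conj_conv J (\<lambda>j. of_real (max (- r j) 0)) x)"
      by (simp add: norm_triangle_ineq4)
  qed (use K(2)[OF J F, of "\<lambda>j. max (r j) 0"] K(2)[OF J F, of "\<lambda>j. max (- r j) 0"] in simp_all)
  have "(\<Sum>n\<in>F. cmod (conj_conv J a (of_int n)) powr p) \<le> 2 powr p * (2 * K1) * lp_sum p J a"
    if J: "finite J" and F: "finite F" for J F a
  proof (rule conj_conv_lp_bound_split[OF p(1) K1 _ _ _ real[OF J F] real[OF J F], of a "\<lambda>j. Re (a j)" "\<lambda>j. Im (a j)"])
    fix x
    have "a = (\<lambda>j. of_real (Re (a j)) + \<i> * of_real (Im (a j)))"
      by (auto simp: complex_eq_iff)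
    then have "conj_conv J a x = conj_conv J (\<lambda>j. of_real (Re (a j)) + \<i> * of_real (Im (a j))) x"
      by (rule arg_cong)
    also have "\<dots> = conj_conv J (\<lambda>j. of_real (Re (a j))) x + \<i> * conj_conv J (\<lambda>j. of_real (Im (a j))) x"
      by (simp only: conj_conv_add conj_conv_cmult)
    finally show "cmod (conj_conv J a x) \<le> 
        cmod (conj_conv J (\<lambda>j. of_real (Re (a j))) x) + cmod (conj_conv J (\<lambda>j. of_real (Im (a j))) x)"
      by (simp only:) (rule order_trans[OF norm_triangle_ineq], simp add: norm_mult)
  qed (simp_all add: abs_Re_le_cmod abs_Im_le_cmod)
  then show ?thesis using K1 by (intro exI[of _ "2 powr p * (2 * K1)"]) auto
qed

text \<open>Duality. Because the kernel is odd, the operator is minus its own transpose. Pairing \<open>N = conj_conv J a\<close> with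
\<open>b = cnj N |N|\<^sup>p\<^sup>-\<^sup>2\<close> gives the sum \<open>X\<close> of \<open>|N|\<^sup>p\<close> on one side; on the other side the operator acts on \<open>b\<close>, where the
bound for the conjugate exponent \<open>q \<le> 2\<close> is available and \<open>|b|\<^sup>q = |N|\<^sup>p\<close>. Young's inequality with the
parameter \<open>l\<close> lets half of \<open>X\<close> be absorbed.\<close>

lemma conj_conv_lp_bound_ge2:
  assumes p: "2 \<le> p"
  shows "\<exists>K\<ge>0. \<forall>J F a. finite J \<longrightarrow> finite F \<longrightarrow>
    (\<Sum>n\<in>F. cmod (conj_conv J a (of_int n)) powr p) \<le> K * lp_sum p J a"
proof -
  define q where "q = p / (p - 1)"
  have q: "1 < q" "q \<le> 2" "1 / p + 1 / q = 1" "(p - 1) * q = p"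
    using p unfolding q_def by (auto simp: field_simps)
  obtain K where K: "K \<ge> 0" "\<And>J F a. finite J \<Longrightarrow> finite F \<Longrightarrow>
    (\<Sum>n\<in>F. cmod (conj_conv J a (of_int n)) powr q) \<le> K * (\<Sum>j\<in>J. cmod (a j) powr q)"
    using conj_conv_lp_bound_le2[OF q(1,2)] by metis
  \<comment> \<open>Chosen such that \<open>K / l\<^sup>q \<le> 1/2\<close>.\<close>
  define l where "l = (2 * K + 1) powr (1 / q)"
  have l: "l > 0" "l powr (- q) * K \<le> 1 / 2"
  proof -
    show "l > 0" using K by (simp add: l_def)
    have "l powr (- q) = 1 / (2 * K + 1)"
      using K q by (simp add: l_def powr_powr powr_minus divide_inverse)
    moreover have "1 / (2 * K + 1) * K \<le> 1 / 2" using K by (simp add: field_simps)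
    ultimately show "l powr (- q) * K \<le> 1 / 2" by (simp only:)
  qed
  have "(\<Sum>n\<in>F. cmod (conj_conv J a (of_int n)) powr p) \<le> 2 * l powr p * lp_sum p J a"
    if J: "finite J" and F: "finite F" for J F a
  proof -
    define N where "N n = conj_conv J a (of_int n)" for n
    \<comment> \<open>For \<open>N n = 0\<close> the value is 0, in agreement with \<open>0 powr x = 0\<close>.\<close>
    define b where "b n = cnj (N n) * of_real (cmod (N n) powr (p - 2))" for n
    define h where "h j = conj_conv F b (of_int j)" for j
    define X where "X = (\<Sum>n\<in>F. cmod (N n) powr p)"
    have Nb: "N n * b n = of_real (cmod (N n) powr p)" for n
    proof (cases "N n = 0")
      case False
      have "N n * b n = of_real ((cmod (N n))\<^sup>2 * cmod (N n) powr (p - 2))"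
        by (simp add: b_def mult.assoc[symmetric] complex_norm_square[symmetric])
      also have "(cmod (N n))\<^sup>2 * cmod (N n) powr (p - 2) = cmod (N n) powr p"
        using False by (simp add: powr_diff)
      finally show ?thesis .
    qed (use p in \<open>simp add: b_def\<close>)
    have nb: "cmod (b n) powr q = cmod (N n) powr p" for n
    proof (cases "N n = 0")
      case False
      have "cmod (b n) = cmod (N n) * cmod (N n) powr (p - 2)"
        by (simp add: b_def norm_mult)
      also have "\<dots> = cmod (N n) powr (p - 1)"
        using False powr_add[of "cmod (N n)" 1 "p - 2"] by simp
      finally show ?thesis by (simp add: powr_powr q)
    qed (use p in \<open>simp add: b_def\<close>)
    have "of_real X = (\<Sum>n\<in>F. N n * b n)" by (simp add: X_def Nb)
    also have "\<dots> = (\<Sum>n\<in>F. \<Sum>j\<in>J. a j * of_real (conj_poisson (of_int n - of_int j)) * b n)"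
      by (simp add: N_def conj_conv_def sum_distrib_right)
    also have "\<dots> = (\<Sum>j\<in>J. \<Sum>n\<in>F. a j * of_real (conj_poisson (of_int n - of_int j)) * b n)"
      by (rule sum.swap)
    also have "\<dots> = (\<Sum>j\<in>J. - (a j * h j))"
    proof (rule sum.cong[OF refl])
      fix j
      have "conj_poisson (of_int n - of_int j) = - conj_poisson (of_int j - of_int n)" for n
        using conj_poisson_minus[of "of_int j - of_int n"] by simp
      then have "a j * of_real (conj_poisson (of_int n - of_int j)) * b n = - (a j * (b n * of_real (conj_poisson (of_int j - of_int n))))" for n
        by (simp only: of_real_minus) (simp add: mult_ac)
      then show "(\<Sum>n\<in>F. a j * of_real (conj_poisson (of_int n - of_int j)) * b n) = - (a j * h j)"
        by (simp only: h_def conj_conv_def sum_distrib_left sum_negf)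
    qed
    finally have "cmod (of_real X) = cmod (\<Sum>j\<in>J. - (a j * h j))"
      by (rule arg_cong)
    moreover have "X \<ge> 0" by (auto simp: X_def intro: sum_nonneg)
    ultimately have "X = cmod (\<Sum>j\<in>J. - (a j * h j))"
      by (simp only: norm_of_real abs_of_nonneg)
    also have "\<dots> \<le> (\<Sum>j\<in>J. cmod (a j) * cmod (h j))"
      by (rule order_trans[OF norm_sum]) (simp add: norm_mult)
    also have "\<dots> \<le> (\<Sum>j\<in>J. l powr p * cmod (a j) powr p + l powr (- q) * cmod (h j) powr q)"
    proof (rule sum_mono)
      fix j
      have "cmod (a j) * cmod (h j) = (l * cmod (a j)) * (cmod (h j) / l)" using l(1) by simp
      also have "\<dots> \<le> (l * cmod (a j)) powr p / p + (cmod (h j) / l) powr q / q"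
        using p q(1,3) l(1) by (intro Youngs_inequality) simp_all
      also have "\<dots> \<le> (l * cmod (a j)) powr p + (cmod (h j) / l) powr q"
        using p q(1) divide_left_mono[of 1 p "(l * cmod (a j)) powr p"]
          divide_left_mono[of 1 q "(cmod (h j) / l) powr q"] by simp
      also have "\<dots> = l powr p * cmod (a j) powr p + l powr (- q) * cmod (h j) powr q"
        using l(1) by (simp add: powr_mult powr_divide powr_minus_divide)
      finally show "cmod (a j) * cmod (h j) \<le> l powr p * cmod (a j) powr p + l powr (- q) * cmod (h j) powr q" .
    qed
    also have "\<dots> = l powr p * lp_sum p J a + l powr (- q) * (\<Sum>j\<in>J. cmod (h j) powr q)"
      by (simp add: sum.distrib sum_distrib_left)
    also have "(\<Sum>j\<in>J. cmod (h j) powr q) \<le> K * X"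
      using K(2)[OF F J, of b] by (simp add: h_def nb X_def)
    finally have "X \<le> l powr p * lp_sum p J a + l powr (- q) * (K * X)"
      by (simp add: mult_left_mono)
    also have "l powr (- q) * (K * X) \<le> 1 / 2 * X"
      unfolding mult.assoc[symmetric] by (rule mult_right_mono[OF l(2)]) (auto simp: X_def intro: sum_nonneg)
    finally show ?thesis by (simp add: X_def N_def)
  qed
  then show ?thesis by (intro exI[of _ "2 * l powr p"]) auto
qed

lemma conj_conv_lp_bound:
  assumes p: "1 < p"
  shows "\<exists>K\<ge>0. \<forall>J F a. finite J \<longrightarrow> finite F \<longrightarrow>
    (\<Sum>n\<in>F. cmod (conj_conv J a (of_int n)) powr p) \<le> K * lp_sum p J a"
proof (cases "p \<le> 2")
  case True
  then show ?thesis by (rule conj_conv_lp_bound_le2[OF p])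
next
  case False
  then show ?thesis by (intro conj_conv_lp_bound_ge2) simp
qed

abbreviation lp_mass :: "real \<Rightarrow> (real \<Rightarrow> complex) \<Rightarrow> ennreal" where
  "lp_mass p h \<equiv> \<integral>\<^sup>+x. ennreal (cmod (h x) powr p) \<partial>lborel"

abbreviation period_integrable :: "(real \<Rightarrow> 'a::{banach, second_countable_topology}) \<Rightarrow> bool" where
  "period_integrable \<equiv> set_integrable lborel {- pi..pi}"

section \<open>Primitives of exponentials as convolution kernels\<close>

text \<open>The integral of \<open>e\<^sup>i\<^sup>x\<^sup>s\<close> over \<open>s\<close> from 0 to \<open>t\<close>, in closed form. Up to a constant it is the kernel
whose Fourier transform is the indicator of the interval between 0 and \<open>t\<close>, with a sign.\<close>

definition exp_primitive :: "real \<Rightarrow> real \<Rightarrow> complex" where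
  "exp_primitive t x = (if x = 0 then of_real t else (expi (x * t) - 1) / (\<i> * of_real x))"

lemma exp_primitive_0 [simp]: "exp_primitive 0 x = 0"
  by (simp add: exp_primitive_def)

lemma exp_primitive_has_derivative:
  "((\<lambda>t. exp_primitive t x) has_vector_derivative expi (x * t)) (at t within S)"
proof (cases "x = 0")
  case True
  then show ?thesis
    by (auto simp: exp_primitive_def intro!: derivative_eq_intros)
next
  case False
  have "((\<lambda>z. (exp (\<i> * (of_real x * z)) - 1) / (\<i> * of_real x)) has_field_derivative exp (\<i> * (of_real x * of_real t))) (at (of_real t))"
  proof -
    have "- (\<i> * (e * \<i>)) = e" for e by (simp add: complex_eq_iff)
    then show ?thesis using False by (auto intro!: derivative_eq_intros)
  qed
  from has_vector_derivative_real_field[OF this]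
  have "((\<lambda>t. (exp (\<i> * (of_real x * of_real t)) - 1) / (\<i> * of_real x)) has_vector_derivative exp (\<i> * (of_real x * of_real t))) (at t within S)" .
  then show ?thesis using False by (simp add: exp_primitive_def)
qed

lemma continuous_on_exp_primitive: "continuous_on S (\<lambda>t. exp_primitive t x)"
  by (rule continuous_on_vector_derivative, rule exp_primitive_has_derivative)

lemma cmod_exp_i_minus_1: "cmod (expi y - 1) \<le> \<bar>y\<bar>"
proof -
  have "cmod (expi y - 1) = 2 * \<bar>sin (y / 2)\<bar>"
    using dist_exp_i_1[of y] by (simp add: dist_norm)
  also have "\<dots> \<le> 2 * \<bar>y / 2\<bar>" by (intro mult_left_mono abs_sin_x_le_abs_x) auto
  finally show ?thesis by simp
qed

lemma cmod_exp_primitive_le: "cmod (exp_primitive t x) \<le> \<bar>t\<bar>"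
  using cmod_exp_i_minus_1[of "x * t"]
  by (auto simp: exp_primitive_def norm_divide norm_mult abs_mult field_simps)

lemma cmod_exp_primitive_le_inverse: 
  assumes "x \<noteq> 0" shows "cmod (exp_primitive t x) \<le> 2 / \<bar>x\<bar>"
proof -
  have "cmod (expi (x * t) - 1) \<le> 1 + 1"
    by (rule order_trans[OF norm_triangle_ineq4]) (simp add: norm_exp_i_times del: of_real_mult)
  then show ?thesis using assms by (simp add: exp_primitive_def norm_divide norm_mult divide_right_mono)
qed

lemma exp_primitive_decay:
  assumes t: "\<bar>t\<bar> \<le> pi"
  shows "cmod (exp_primitive t x) \<le> 8 / (1 + \<bar>x\<bar>)"
proof (cases "\<bar>x\<bar> \<le> 1")
  case True
  have "cmod (exp_primitive t x) \<le> 4" using cmod_exp_primitive_le[of t x] t pi_less_4 by linarith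
  also have "\<dots> \<le> 8 / (1 + \<bar>x\<bar>)" using True by (simp add: field_simps)
  finally show ?thesis .
next
  case False
  then have "cmod (exp_primitive t x) \<le> 2 / \<bar>x\<bar>" by (intro cmod_exp_primitive_le_inverse) auto
  also have "\<dots> \<le> 8 / (1 + \<bar>x\<bar>)" using False by (simp add: field_simps)
  finally show ?thesis .
qed

lemma exp_primitive_measurable [measurable]:
  "(\<lambda>z. exp_primitive (fst z) (snd z)) \<in> borel_measurable (borel \<Otimes>\<^sub>M borel)"
  unfolding exp_primitive_def by measurable

text \<open>Writing \<open>1 = x\<^sup>2 / (1 + x\<^sup>2) + 1 / (1 + x\<^sup>2)\<close> removes the denominator \<open>x\<close> from the kernel and leaves a modulated
conjugate Poisson kernel plus a term dominated by the Poisson kernel.\<close>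

lemma exp_primitive_conj_poisson:
  "exp_primitive t x = - \<i> * (expi (x * t) - 1) * of_real (conj_poisson x) + exp_primitive t x * of_real (poisson x)"
proof (cases "x = 0")
  case False
  define e where "e = expi (x * t) - 1"
  have "poisson x = 1 - x * conj_poisson x"
    by (simp add: poisson_def conj_poisson_def power2_eq_square[symmetric] diff_divide_eq_iff)
  then have p: "of_real (poisson x) = 1 - complex_of_real x * of_real (conj_poisson x)"
    by simp
  have D: "exp_primitive t x = e / (\<i> * of_real x)" using False by (simp add: exp_primitive_def e_def)
  have E: "e / (\<i> * of_real x) = - \<i> * e * of_real (conj_poisson x) + e / (\<i> * of_real x) * (1 - of_real x * of_real (conj_poisson x))"
    using False by (simp add: field_simps)
  show ?thesis unfolding p e_def[symmetric] D by (rule E)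
qed (simp add: exp_primitive_def conj_poisson_def poisson_def)

definition exp_conv :: "int set \<Rightarrow> (int \<Rightarrow> complex) \<Rightarrow> real \<Rightarrow> real \<Rightarrow> complex" where
  "exp_conv J a t x = (\<Sum>j\<in>J. a j * exp_primitive t (x - of_int j))"

text \<open>The factor \<open>e\<^sup>i\<^sup>(\<^sup>x\<^sup>-\<^sup>j\<^sup>)\<^sup>t\<close> splits into a phase depending on \<open>x\<close> alone and a modulation of the sequence, which changes no
absolute value. Hence the conjugate Poisson bounds apply uniformly in \<open>t\<close>. The constant 16 collects the
shift from \<open>x\<close> to \<open>n\<close> in the two conjugate Poisson terms (2 each) and in the Poisson term (3 times \<open>4 > \<pi>\<close>).\<close>

lemma exp_conv_le:
  fixes n :: int
  assumes t: "\<bar>t\<bar> \<le> pi" and x: "x \<in> {of_int n..of_int n + 1}"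
  shows "cmod (exp_conv J a t x) \<le>
     cmod (conj_conv J (\<lambda>j. a j * exp (- (\<i> * of_real (of_int j * t)))) (of_int n)) +
     cmod (conj_conv J a (of_int n)) + 16 * poisson_conv J a (of_int n)"
proof -
  define b where "b j = a j * exp (- (\<i> * of_real (of_int j * t)))" for j
  have nb: "cmod (b j) = cmod (a j)" for j
    by (simp add: b_def norm_mult)
  then have pb: "poisson_conv J b y = poisson_conv J a y" for y
    by (simp add: poisson_conv_def)
  define R where "R = (\<Sum>j\<in>J. a j * (exp_primitive t (x - of_int j) * of_real (poisson (x - of_int j))))"
  have "exp_conv J a t x = (\<Sum>j\<in>J. - \<i> * (expi (x * t) * (b j * of_real (conj_poisson (x - of_int j))) 
      - a j * of_real (conj_poisson (x - of_int j))) + a j * (exp_primitive t (x - of_int j) * of_real (poisson (x - of_int j))))"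
    unfolding exp_conv_def
  proof (rule sum.cong[OF refl])
    fix j
    have "expi ((x - of_int j) * t) * a j = expi (x * t) * b j"
      unfolding b_def by (simp add: exp_diff exp_minus left_diff_distrib right_diff_distrib divide_inverse)
    then show "a j * exp_primitive t (x - of_int j) = - \<i> * (expi (x * t) * (b j * of_real (conj_poisson (x - of_int j))) 
      - a j * of_real (conj_poisson (x - of_int j))) + a j * (exp_primitive t (x - of_int j) * of_real (poisson (x - of_int j)))"
      by (subst exp_primitive_conj_poisson) (simp add: algebra_simps)
  qed
  also have "\<dots> = - \<i> * (expi (x * t) * conj_conv J b x - conj_conv J a x) + R"
    by (simp add: sum.distrib sum_subtractf sum_distrib_left conj_conv_def R_def right_diff_distrib sum_negf)
  finally have "cmod (exp_conv J a t x) \<le> cmod (expi (x * t) * conj_conv J b x - conj_conv J a x) + cmod R"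
    by (simp only:) (rule order_trans[OF norm_triangle_ineq], simp add: norm_mult)
  also have "cmod (expi (x * t) * conj_conv J b x - conj_conv J a x) \<le> cmod (conj_conv J b x) + cmod (conj_conv J a x)"
    by (rule order_trans[OF norm_triangle_ineq4]) (simp add: norm_mult norm_exp_i_times del: of_real_mult)
  also have "cmod (conj_conv J b x) \<le> cmod (conj_conv J b (of_int n)) + 2 * poisson_conv J a (of_int n)"
    using conj_conv_shift_le[of x "of_int n" J b] x norm_triangle_ineq2[of "conj_conv J b x" "conj_conv J b (of_int n)"]
    by (simp add: pb)
  also have "cmod (conj_conv J a x) \<le> cmod (conj_conv J a (of_int n)) + 2 * poisson_conv J a (of_int n)"
    using conj_conv_shift_le[of x "of_int n" J a] x norm_triangle_ineq2[of "conj_conv J a x" "conj_conv J a (of_int n)"]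
    by simp
  also have "cmod R \<le> (\<Sum>j\<in>J. cmod (a j) * (4 * poisson (x - of_int j)))"
    unfolding R_def
  proof (rule order_trans[OF norm_sum], rule sum_mono)
    fix j
    have "cmod (exp_primitive t (x - of_int j)) \<le> 4"
      using cmod_exp_primitive_le[of t "x - of_int j"] t pi_less_4 by linarith
    then show "cmod (a j * (exp_primitive t (x - of_int j) * of_real (poisson (x - of_int j)))) \<le> cmod (a j) * (4 * poisson (x - of_int j))"
      unfolding norm_mult by (intro mult_left_mono mult_mono) auto
  qed
  also have "\<dots> = 4 * poisson_conv J a x"
    by (simp add: poisson_conv_def sum_distrib_left mult_ac)
  also have "poisson_conv J a x \<le> 3 * poisson_conv J a (of_int n)"
    by (rule poisson_conv_shift_le) (use x in auto)
  finally show ?thesis by (simp add: b_def)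
qed

lemma nn_integral_le_unit_steps:
  fixes h :: "real \<Rightarrow> real" and b :: "int \<Rightarrow> real"
  assumes h [measurable]: "h \<in> borel_measurable borel"
    and b0: "\<And>n. 0 \<le> b n"
    and hb: "\<And>n x. x \<in> {of_int n..<of_int n + 1} \<Longrightarrow> h x \<le> b n"
    and B: "\<And>F. finite F \<Longrightarrow> sum b F \<le> B"
  shows "(\<integral>\<^sup>+x. ennreal (h x) \<partial>lborel) \<le> ennreal B"
proof -
  define H where "H M x = ennreal (h x) * indicator {- real M..<real M} x" for M :: nat and x
  have inc: "incseq H"
    unfolding H_def incseq_def le_fun_def
    by (auto intro!: mult_left_mono simp: indicator_def)
  have sup: "(SUP M. H M x) = ennreal (h x)" for x
  proof (rule antisym)
    show "(SUP M. H M x) \<le> ennreal (h x)"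
      by (rule SUP_least) (auto simp: H_def indicator_def)
    obtain M :: nat where "\<bar>x\<bar> < real M" using reals_Archimedean2 by blast
    then have "H M x = ennreal (h x)" by (auto simp: H_def indicator_def)
    then show "ennreal (h x) \<le> (SUP M. H M x)" by (metis SUP_upper UNIV_I)
  qed
  have "(\<integral>\<^sup>+x. H M x \<partial>lborel) \<le> ennreal B" for M
  proof -
    have "(\<integral>\<^sup>+x. H M x \<partial>lborel) \<le> (\<integral>\<^sup>+x. (\<Sum>n\<in>{- int M..<int M}. ennreal (b n) * indicator {real_of_int n..<real_of_int n + 1} x) \<partial>lborel)"
    proof (rule nn_integral_mono)
      fix x :: real
      show "H M x \<le> (\<Sum>n\<in>{- int M..<int M}. ennreal (b n) * indicator {of_int n..<of_int n + 1} x)"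
      proof (cases "x \<in> {- real M..<real M}")
        case True
        define k where "k = \<lfloor>x\<rfloor>"
        have k: "k \<in> {- int M..<int M}" "of_int k \<le> x" "x < of_int k + 1"
          using True unfolding k_def by (auto simp: le_floor_iff floor_less_iff)
        have "H M x \<le> ennreal (b k) * indicator {of_int k..<of_int k + 1} x"
          using True k hb[of x k] by (auto simp: H_def intro!: ennreal_leI)
        also have "\<dots> \<le> (\<Sum>n\<in>{- int M..<int M}. ennreal (b n) * indicator {of_int n..<of_int n + 1} x)"
          by (rule member_le_sum[OF k(1)]) auto
        finally show ?thesis .
      qed (simp add: H_def)
    qed
    also have "\<dots> = (\<Sum>n\<in>{- int M..<int M}. ennreal (b n))"
      by (subst nn_integral_sum) (auto simp: nn_integral_cmult)
    also have "\<dots> = ennreal (\<Sum>n\<in>{- int M..<int M}. b n)"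
      using b0 by (intro sum_ennreal) auto
    also have "\<dots> \<le> ennreal B" by (intro ennreal_leI B) auto
    finally show ?thesis .
  qed
  moreover have "(\<integral>\<^sup>+x. ennreal (h x) \<partial>lborel) = (SUP M. \<integral>\<^sup>+x. H M x \<partial>lborel)"
    unfolding sup[symmetric] by (rule nn_integral_monotone_convergence_SUP[OF inc]) (auto simp: H_def[abs_def])
  ultimately show ?thesis by (auto intro: SUP_least)
qed

lemma exp_conv_measurable [measurable]:
  "(\<lambda>z. exp_conv J a (fst z) (snd z)) \<in> borel_measurable (borel \<Otimes>\<^sub>M borel)"
proof -
  have "(\<lambda>z::real \<times> real. (fst z, snd z - of_int j)) \<in> borel \<Otimes>\<^sub>M borel \<rightarrow>\<^sub>M borel \<Otimes>\<^sub>M borel" for j :: int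
    by measurable
  from measurable_compose[OF this exp_primitive_measurable]
  have "(\<lambda>z. exp_primitive (fst z) (snd z - of_int j)) \<in> borel_measurable (borel \<Otimes>\<^sub>M borel)" for j :: int
    by simp
  then show ?thesis unfolding exp_conv_def
    by (intro borel_measurable_sum borel_measurable_times) auto
qed

lemma exp_conv_measurable1 [measurable]:
  "exp_conv J a t \<in> borel_measurable borel"
  using measurable_compose[OF measurable_Pair1' exp_conv_measurable, of t] by simp

lemma exp_conv_lp_bound:
  assumes p: "1 < p"
  shows "\<exists>K\<ge>0. \<forall>J a t. finite J \<longrightarrow> \<bar>t\<bar> \<le> pi \<longrightarrow>
    lp_mass p (exp_conv J a t) \<le> ennreal (K * lp_sum p J a)"
proof -
  obtain K1 where K1: "K1 \<ge> 0" "\<And>J F a. finite J \<Longrightarrow> finite F \<Longrightarrow>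
    (\<Sum>n\<in>F. cmod (conj_conv J a (of_int n)) powr p) \<le> K1 * lp_sum p J a"
    using conj_conv_lp_bound[OF p] by metis
  obtain K2 where K2: "K2 \<ge> 0" "\<And>J F a. finite J \<Longrightarrow> finite F \<Longrightarrow>
    (\<Sum>n\<in>F. poisson_conv J a (of_int n) powr p) \<le> K2 * lp_sum p J a"
    using poisson_conv_lp_bound[OF p] by metis
  define K where "K = 3 powr p * (K1 + K1 + 16 powr p * K2)"
  have "lp_mass p (exp_conv J a t) \<le> ennreal (K * lp_sum p J a)"
    if J: "finite J" and t: "\<bar>t\<bar> \<le> pi" for J a t
  proof -
    define b where "b j = a j * exp (- (\<i> * of_real (of_int j * t)))" for j
    have nb: "cmod (b j) = cmod (a j)" for j
      by (simp add: b_def norm_mult)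
    define c where "c n = 3 powr p * (cmod (conj_conv J b (of_int n)) powr p + cmod (conj_conv J a (of_int n)) powr p
       + 16 powr p * poisson_conv J a (of_int n) powr p)" for n :: int
    show ?thesis
    proof (rule nn_integral_le_unit_steps[where b = c])
      fix n :: int and x :: real assume "x \<in> {of_int n..<of_int n + 1}"
      then have x: "x \<in> {of_int n..of_int n + 1}" by auto
      have "cmod (exp_conv J a t x) powr p \<le> (cmod (conj_conv J b (of_int n)) + cmod (conj_conv J a (of_int n)) + 16 * poisson_conv J a (of_int n)) powr p"
        using exp_conv_le[OF t x, of J a] p unfolding b_def by (intro powr_mono2) auto
      also have "\<dots> \<le> c n"
        using powr_add3_le[OF p, of "cmod (conj_conv J b (of_int n))" "cmod (conj_conv J a (of_int n))" "16 * poisson_conv J a (of_int n)"]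
        by (simp add: c_def powr_mult)
      finally show "cmod (exp_conv J a t x) powr p \<le> c n" .
    next
      fix F :: "int set" assume F: "finite F"
      have "sum c F = 3 powr p * ((\<Sum>n\<in>F. cmod (conj_conv J b (of_int n)) powr p) + (\<Sum>n\<in>F. cmod (conj_conv J a (of_int n)) powr p)
       + 16 powr p * (\<Sum>n\<in>F. poisson_conv J a (of_int n) powr p))"
        by (simp add: c_def sum.distrib sum_distrib_left distrib_left)
      also have "\<dots> \<le> 3 powr p * (K1 * lp_sum p J a + K1 * lp_sum p J a + 16 powr p * (K2 * lp_sum p J a))"
        using K1(2)[OF J F, of b, unfolded nb] K1(2)[OF J F, of a] mult_left_mono[OF K2(2)[OF J F, of a], of "16 powr p"]
        by (intro mult_left_mono add_mono) simp_all
      also have "\<dots> = K * lp_sum p J a" by (simp add: K_def algebra_simps)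
      finally show "sum c F \<le> K * lp_sum p J a" .
    next
      show "(\<lambda>x. cmod (exp_conv J a t x) powr p) \<in> borel_measurable borel" by measurable
    qed (simp add: c_def)
  qed
  moreover have "K \<ge> 0" using K1 K2 by (simp add: K_def)
  ultimately show ?thesis by (intro exI[of _ K]) simp
qed

section \<open>Superpositions and integration by parts\<close>

lemma exp_primitive_measurable' [measurable (raw)]:
  assumes [measurable]: "f \<in> borel_measurable M" "h \<in> borel_measurable M"
  shows "(\<lambda>z. exp_primitive (f z) (h z)) \<in> borel_measurable M"
  using measurable_compose[OF measurable_Pair[OF assms] exp_primitive_measurable] by simp

lemma exp_conv_measurable' [measurable (raw)]:
  assumes [measurable]: "f \<in> borel_measurable M" "h \<in> borel_measurable M"
  shows "(\<lambda>z. exp_conv J a (f z) (h z)) \<in> borel_measurable M"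
  using measurable_compose[OF measurable_Pair[OF assms] exp_conv_measurable] by simp

lemma cmod_exp_conv_le:
  "cmod (exp_conv J a t x) \<le> \<bar>t\<bar> * (\<Sum>j\<in>J. cmod (a j))"
  unfolding exp_conv_def sum_distrib_left
  by (rule order_trans[OF norm_sum], rule sum_mono)
     (simp add: norm_mult mult.commute[of "\<bar>t\<bar>"] mult_left_mono cmod_exp_primitive_le)

text \<open>Minkowski's integral inequality in disguise: Jensen's inequality for the weight \<open>w\<close> and Tonelli's theorem. It
transfers the \<open>L\<^sup>p\<close> bound of the individual kernels to their superposition; the two terms at \<open>\<plusminus>\<pi>\<close> are the
boundary terms of an integration by parts.\<close>

lemma nn_integral_superposition_le:
  fixes w :: "real \<Rightarrow> real" and G :: "real \<Rightarrow> complex"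
  assumes p: "1 < p" and B: "0 \<le> B" and C: "0 \<le> C"
    and S: "\<And>t. \<bar>t\<bar> \<le> pi \<Longrightarrow> lp_mass p (exp_conv J a t) \<le> ennreal B"
    and w: "integrable lborel w" "\<And>t. 0 \<le> w t" "\<And>t. \<bar>t\<bar> > pi \<Longrightarrow> w t = 0" "(\<integral>t. w t \<partial>lborel) \<le> C"
    and G: "\<And>x. cmod (G x) \<le> 2 * cmod (exp_conv J a pi x) + 2 * cmod (exp_conv J a (- pi) x)
        + (\<integral>t. w t * cmod (exp_conv J a t x) \<partial>lborel)"
  shows "lp_mass p G \<le> ennreal (3 powr p * (2 * 2 powr p + C powr p) * B)"
proof -
  have [measurable]: "w \<in> borel_measurable borel" using w(1) by simp
  define s where "s t x = cmod (exp_conv J a t x)" for t x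
  define R where "R = pi * (\<Sum>j\<in>J. cmod (a j))"
  have R: "0 \<le> R" by (simp add: R_def sum_nonneg)
  have sR: "s t x \<le> R" if "\<bar>t\<bar> \<le> pi" for t x
    using cmod_exp_conv_le[of J a t x] mult_right_mono[OF that, of "\<Sum>j\<in>J. cmod (a j)"]
    by (simp add: s_def R_def sum_nonneg)
  have s0: "0 \<le> s t x" for t x by (simp add: s_def)
  have i1: "integrable lborel (\<lambda>t. w t * s t x)" for x
  proof (rule Bochner_Integration.integrable_bound)
    show "integrable lborel (\<lambda>t. w t * R)" using w by simp
    show "AE t in lborel. norm (w t * s t x) \<le> norm (w t * R)"
    proof (rule AE_I2)
      fix t show "norm (w t * s t x) \<le> norm (w t * R)"
        using w(2)[of t] w(3)[of t] sR[of t x] s0[of t x] R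
        by (cases "\<bar>t\<bar> \<le> pi") (auto simp: abs_mult intro!: mult_left_mono)
    qed
  qed (unfold s_def, measurable)
  have i2: "integrable lborel (\<lambda>t. w t * s t x powr p)" for x
  proof (rule Bochner_Integration.integrable_bound)
    show "integrable lborel (\<lambda>t. w t * R powr p)" using w by simp
    show "AE t in lborel. norm (w t * s t x powr p) \<le> norm (w t * R powr p)"
    proof (rule AE_I2)
      fix t show "norm (w t * s t x powr p) \<le> norm (w t * R powr p)"
        using w(2)[of t] w(3)[of t] sR[of t x] s0[of t x] R p
        by (cases "\<bar>t\<bar> \<le> pi") (auto simp: abs_mult intro!: mult_left_mono powr_mono2)
    qed
  qed (unfold s_def, measurable)
  define Q where "Q x = (\<integral>t. w t * s t x \<partial>lborel)" for x
  have Q0: "0 \<le> Q x" for x unfolding Q_def using w s0 by (intro integral_nonneg_AE AE_I2) auto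
  have Wn: "0 \<le> (\<integral>t. w t \<partial>lborel)" using w by (intro integral_nonneg_AE AE_I2) auto
  have Qp: "ennreal (Q x powr p) \<le> ennreal (C powr (p - 1)) * (\<integral>\<^sup>+t. ennreal (w t) * ennreal (s t x powr p) \<partial>lborel)" for x
  proof -
    have "Q x powr p \<le> (\<integral>t. w t \<partial>lborel) powr (p - 1) * (\<integral>t. w t * s t x powr p \<partial>lborel)"
      unfolding Q_def by (rule powr_integral_le[OF p w(1,2) s0 i1 i2])
    also have "\<dots> \<le> C powr (p - 1) * (\<integral>t. w t * s t x powr p \<partial>lborel)"
      using p w Wn by (intro mult_right_mono powr_mono2 integral_nonneg_AE AE_I2) auto
    finally have "ennreal (Q x powr p) \<le> ennreal (C powr (p - 1)) * ennreal (\<integral>t. w t * s t x powr p \<partial>lborel)"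
      by (subst ennreal_mult'[symmetric]) (auto intro: ennreal_leI)
    also have "ennreal (\<integral>t. w t * s t x powr p \<partial>lborel) = (\<integral>\<^sup>+t. ennreal (w t * s t x powr p) \<partial>lborel)"
      using i2 w by (intro nn_integral_eq_integral[symmetric]) auto
    also have "\<dots> = (\<integral>\<^sup>+t. ennreal (w t) * ennreal (s t x powr p) \<partial>lborel)"
      using w by (simp add: ennreal_mult)
    finally show ?thesis .
  qed
  have swap: "(\<integral>\<^sup>+x. \<integral>\<^sup>+t. ennreal (w t) * ennreal (s t x powr p) \<partial>lborel \<partial>lborel) \<le> ennreal C * ennreal B"
  proof -
    have "(\<integral>\<^sup>+x. \<integral>\<^sup>+t. ennreal (w t) * ennreal (s t x powr p) \<partial>lborel \<partial>lborel)
        = (\<integral>\<^sup>+t. \<integral>\<^sup>+x. ennreal (w t) * ennreal (s t x powr p) \<partial>lborel \<partial>lborel)"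
      unfolding s_def by (rule lborel_pair.Fubini') measurable
    also have "\<dots> = (\<integral>\<^sup>+t. ennreal (w t) * (\<integral>\<^sup>+x. ennreal (s t x powr p) \<partial>lborel) \<partial>lborel)"
      unfolding s_def by (intro nn_integral_cong nn_integral_cmult) measurable
    also have "\<dots> \<le> (\<integral>\<^sup>+t. ennreal (w t) * ennreal B \<partial>lborel)"
    proof (rule nn_integral_mono)
      fix t show "ennreal (w t) * (\<integral>\<^sup>+x. ennreal (s t x powr p) \<partial>lborel) \<le> ennreal (w t) * ennreal B"
        using S[of t] w(3)[of t] by (cases "\<bar>t\<bar> \<le> pi") (auto simp: s_def intro!: mult_left_mono)
    qed
    also have "\<dots> = (\<integral>\<^sup>+t. ennreal (w t) \<partial>lborel) * ennreal B"
      by (rule nn_integral_multc) measurable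
    also have "(\<integral>\<^sup>+t. ennreal (w t) \<partial>lborel) = ennreal (\<integral>t. w t \<partial>lborel)"
      using w by (intro nn_integral_eq_integral) auto
    also have "\<dots> * ennreal B \<le> ennreal C * ennreal B"
      using w by (intro mult_right_mono ennreal_leI) auto
    finally show ?thesis .
  qed
  define T where "T x = (\<integral>\<^sup>+t. ennreal (w t) * ennreal (s t x powr p) \<partial>lborel)" for x
  have T [measurable]: "T \<in> borel_measurable borel"
    unfolding T_def s_def by measurable
  have ms [measurable]: "(\<lambda>x. s t x) \<in> borel_measurable borel" for t unfolding s_def by measurable
  have "lp_mass p G \<le> 
     (\<integral>\<^sup>+x. ennreal (3 powr p * 2 powr p) * ennreal (s pi x powr p) + ennreal (3 powr p * 2 powr p) * ennreal (s (- pi) x powr p)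
        + ennreal (3 powr p * C powr (p - 1)) * T x \<partial>lborel)"
  proof (rule nn_integral_mono)
    fix x
    have "cmod (G x) powr p \<le> (2 * s pi x + 2 * s (- pi) x + Q x) powr p"
      using G[of x] p by (intro powr_mono2) (auto simp: s_def Q_def)
    also have "\<dots> \<le> 3 powr p * ((2 * s pi x) powr p + (2 * s (- pi) x) powr p + Q x powr p)"
      by (rule powr_add3_le[OF p]) (auto simp: s0 Q0)
    also have "\<dots> = 3 powr p * 2 powr p * s pi x powr p + 3 powr p * 2 powr p * s (- pi) x powr p + 3 powr p * Q x powr p"
      using s0 by (simp add: powr_mult algebra_simps)
    finally have "ennreal (cmod (G x) powr p) \<le> ennreal (3 powr p * 2 powr p) * ennreal (s pi x powr p) 
       + ennreal (3 powr p * 2 powr p) * ennreal (s (- pi) x powr p) + ennreal (3 powr p) * ennreal (Q x powr p)"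
      by (simp add: ennreal_mult[symmetric] ennreal_plus[symmetric] ennreal_leI del: ennreal_plus)
    also have "ennreal (3 powr p) * ennreal (Q x powr p) \<le> ennreal (3 powr p) * (ennreal (C powr (p - 1)) * T x)"
      using Qp[of x] unfolding T_def by (intro mult_left_mono) auto
    also have "\<dots> = ennreal (3 powr p * C powr (p - 1)) * T x"
      by (simp add: ennreal_mult mult.assoc)
    finally show "ennreal (cmod (G x) powr p) \<le> ennreal (3 powr p * 2 powr p) * ennreal (s pi x powr p) 
       + ennreal (3 powr p * 2 powr p) * ennreal (s (- pi) x powr p) + ennreal (3 powr p * C powr (p - 1)) * T x"
      by (simp add: add_left_mono)
  qed
  also have "\<dots> = ennreal (3 powr p * 2 powr p) * (\<integral>\<^sup>+x. ennreal (s pi x powr p) \<partial>lborel)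
      + ennreal (3 powr p * 2 powr p) * (\<integral>\<^sup>+x. ennreal (s (- pi) x powr p) \<partial>lborel)
      + ennreal (3 powr p * C powr (p - 1)) * (\<integral>\<^sup>+x. T x \<partial>lborel)"
    by (simp add: nn_integral_add nn_integral_cmult)
  also have "\<dots> \<le> ennreal (3 powr p * 2 powr p) * ennreal B + ennreal (3 powr p * 2 powr p) * ennreal B
      + ennreal (3 powr p * C powr (p - 1)) * (ennreal C * ennreal B)"
    using S[of pi] S[of "- pi"] swap unfolding T_def s_def
    by (intro add_mono mult_left_mono) auto
  also have "\<dots> = ennreal (3 powr p * 2 powr p * B + 3 powr p * 2 powr p * B + 3 powr p * C powr (p - 1) * (C * B))"
    using B C by (simp add: ennreal_mult[symmetric] ennreal_plus[symmetric] del: ennreal_plus)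
  also have "3 powr p * 2 powr p * B + 3 powr p * 2 powr p * B + 3 powr p * C powr (p - 1) * (C * B) = 3 powr p * (2 * 2 powr p + C powr p) * B"
  proof -
    have "C powr (p - 1) * C = C powr p" using C p by (cases "C = 0") (auto simp: powr_diff)
    then have "3 powr p * C powr (p - 1) * (C * B) = 3 powr p * C powr p * B" by (metis mult.assoc)
    then show ?thesis by (simp add: algebra_simps)
  qed
  finally show ?thesis .
qed

lemma half_interval_by_parts:
  fixes u v :: "real \<Rightarrow> real" and a b c d :: real
  assumes ab: "a < b" and u: "\<And>t. t \<in> {a<..<b} \<Longrightarrow> (u has_real_derivative v t) (at t)"
    and v: "continuous_on {a<..<b} v"
    and int: "set_integrable lborel {a<..<b} (\<lambda>t. of_real (v t) * exp_primitive t x + of_real (u t) * expi (x * t))"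
    and A: "((\<lambda>t. of_real (u t) * exp_primitive t x) \<longlongrightarrow> A) (at_right a)"
    and B: "((\<lambda>t. of_real (u t) * exp_primitive t x) \<longlongrightarrow> B) (at_left b)"
  shows "(LINT t:{a<..<b}|lborel. of_real (v t) * exp_primitive t x + of_real (u t) * expi (x * t)) = B - A"
proof -
  have "(LBINT t=ereal a..ereal b. of_real (v t) * exp_primitive t x + of_real (u t) * expi (x * t)) = B - A"
  proof (rule interval_integral_FTC_integrable[where F = "\<lambda>t. of_real (u t) * exp_primitive t x"])
    fix t assume "ereal a < ereal t" "ereal t < ereal b"
    then have t: "t \<in> {a<..<b}" by simp
    have "((\<lambda>t. complex_of_real (u t)) has_vector_derivative of_real (v t)) (at t)"
      using u[OF t] by (simp add: has_vector_derivative_of_real has_real_derivative_iff_has_vector_derivative)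
    from has_vector_derivative_mult[OF this exp_primitive_has_derivative]
    show "((\<lambda>t. of_real (u t) * exp_primitive t x) has_vector_derivative
      of_real (v t) * exp_primitive t x + of_real (u t) * expi (x * t)) (at t)"
      by (simp add: add.commute)
    have "isCont u t" using u[OF t] by (rule DERIV_isCont)
    moreover have "isCont v t" using v t continuous_on_eq_continuous_at[of "{a<..<b}" v] by auto
    moreover have "isCont (\<lambda>t. exp_primitive t x) t"
      using continuous_on_exp_primitive[of UNIV x] by (simp add: continuous_on_eq_continuous_at)
    ultimately show "isCont (\<lambda>t. of_real (v t) * exp_primitive t x + of_real (u t) * expi (x * t)) t"
      by (intro continuous_intros)
  qed (use ab int A B in \<open>auto simp: ereal_tendsto_simps\<close>)
  then show ?thesis using ab by (simp add: interval_lebesgue_integral_def)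
qed

text \<open>The function \<open>u\<close> may jump at 0. The primitive of the exponential is normalized to vanish there, so the jump
produces no boundary term.\<close>

lemma fourier_integral_by_parts:
  fixes u v :: "real \<Rightarrow> real"
  assumes u: "\<And>t. t \<in> {- pi..pi} - {0} \<Longrightarrow> (u has_real_derivative v t) (at t)"
    and v: "continuous_on ({- pi<..<pi} - {0}) v"
    and u01: "\<And>t. t \<in> {- pi..pi} - {0} \<Longrightarrow> \<bar>u t\<bar> \<le> 1"
    and [measurable]: "u \<in> borel_measurable borel"
    and iv: "period_integrable v"
  shows "(LINT t:{- pi..pi}|lborel. of_real (u t) * expi (x * t)) =
    of_real (u pi) * exp_primitive pi x - of_real (u (- pi)) * exp_primitive (- pi) x
     - (LINT t:{- pi..pi}|lborel. of_real (v t) * exp_primitive t x)"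
proof -
  define f1 where "f1 t = of_real (u t) * expi (x * t)" for t
  define f2 where "f2 t = of_real (v t) * exp_primitive t x" for t
  have i1: "period_integrable f1"
    unfolding set_integrable_def
  proof (rule Bochner_Integration.integrable_bound)
    show "integrable lborel (\<lambda>t. indicator {- pi..pi} t *\<^sub>R (1::real))"
      by (simp add: integrable_indicator)
    show "AE t in lborel. norm (indicator {- pi..pi} t *\<^sub>R f1 t) \<le> norm (indicator {- pi..pi} t *\<^sub>R (1::real))"
      using AE_lborel_singleton[of 0]
    proof eventually_elim
      case (elim t)
      then show ?case using u01[of t] by (auto simp: indicator_def f1_def norm_mult simp del: of_real_mult)
    qed
  qed (unfold f1_def, measurable)
  have vm: "(\<lambda>t. indicator {- pi..pi} t *\<^sub>R v t) \<in> borel_measurable borel"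
    using iv unfolding set_integrable_def by auto
  have i2: "period_integrable f2"
    unfolding set_integrable_def
  proof (rule Bochner_Integration.integrable_bound)
    show "integrable lborel (\<lambda>t. pi * (indicator {- pi..pi} t *\<^sub>R v t))"
      using iv unfolding set_integrable_def by (rule integrable_mult_right)
    show "AE t in lborel. norm (indicator {- pi..pi} t *\<^sub>R f2 t) \<le> norm (pi * (indicator {- pi..pi} t *\<^sub>R v t))"
    proof (rule AE_I2)
      fix t
      have "cmod (exp_primitive t x) \<le> pi" if "t \<in> {- pi..pi}"
        using cmod_exp_primitive_le[of t x] that by (auto simp: abs_le_iff)
      then show "norm (indicator {- pi..pi} t *\<^sub>R f2 t) \<le> norm (pi * (indicator {- pi..pi} t *\<^sub>R v t))"
        by (auto simp: indicator_def f2_def norm_mult abs_mult mult.commute[of pi] intro!: mult_left_mono)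
    qed
    have "(\<lambda>t. indicator {- pi..pi} t *\<^sub>R f2 t) = (\<lambda>t. of_real (indicator {- pi..pi} t *\<^sub>R v t) * exp_primitive t x)"
      by (auto simp: f2_def scaleR_conv_of_real)
    also have "\<dots> \<in> borel_measurable lborel" using vm by measurable
    finally show "(\<lambda>t. indicator {- pi..pi} t *\<^sub>R f2 t) \<in> borel_measurable lborel" .
  qed
  have i: "period_integrable (\<lambda>t. f2 t + f1 t)"
    using i1 i2 by (rule set_integral_add(1)[rotated])
  have un: "(LINT t:{- pi..pi}|lborel. f2 t + f1 t) = 
     (LINT t:{- pi<..<0}|lborel. f2 t + f1 t) + (LINT t:{0<..<pi}|lborel. f2 t + f1 t)"
  proof -
    have "(LINT t:{- pi<..<0} \<union> {0<..<pi}|lborel. f2 t + f1 t) = 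
     (LINT t:{- pi<..<0}|lborel. f2 t + f1 t) + (LINT t:{0<..<pi}|lborel. f2 t + f1 t)"
      by (rule set_integral_Un) (auto intro: set_integrable_subset[OF i])
    moreover have "(LINT t:{- pi<..<0} \<union> {0<..<pi}|lborel. f2 t + f1 t) = (LINT t:{- pi..pi}|lborel. f2 t + f1 t)"
    proof (rule set_integral_cong_set)
      show "set_borel_measurable lborel ({- pi<..<0} \<union> {0<..<pi}) (\<lambda>t. f2 t + f1 t)"
      proof -
        have "set_integrable lborel ({- pi<..<0} \<union> {0<..<pi}) (\<lambda>t. f2 t + f1 t)"
          by (rule set_integrable_subset[OF i]) auto
        then show ?thesis unfolding set_integrable_def set_borel_measurable_def by simp
      qed
      show "set_borel_measurable lborel {- pi..pi} (\<lambda>t. f2 t + f1 t)"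
        using i by (auto simp: set_integrable_def set_borel_measurable_def)
      show "AE t in lborel. (t \<in> {- pi..pi}) = (t \<in> {- pi<..<0} \<union> {0<..<pi})"
        using AE_lborel_singleton[of 0] AE_lborel_singleton[of pi] AE_lborel_singleton[of "- pi"]
        by eventually_elim auto
    qed
    ultimately show ?thesis by simp
  qed
  have isC: "isCont (\<lambda>t. exp_primitive t x) t" for t
    using continuous_on_exp_primitive[of UNIV x] by (simp add: continuous_on_eq_continuous_at)
  have lim_end: "((\<lambda>t. of_real (u t) * exp_primitive t x) \<longlongrightarrow> of_real (u b) * exp_primitive b x) (at b within S)"
    if "b = pi \<or> b = - pi" for b S
  proof -
    have "isCont u b" using u[of b] that by (auto intro: DERIV_isCont)
    then have "isCont (\<lambda>t. of_real (u t) * exp_primitive t x) b"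
      using isC by (intro continuous_intros)
    then show ?thesis unfolding isCont_def by (rule tendsto_within_subset) simp
  qed
  \<comment> \<open>Boundedness of \<open>u\<close> suffices at 0, where the primitive vanishes.\<close>
  have lim_0: "((\<lambda>t. of_real (u t) * exp_primitive t x) \<longlongrightarrow> 0) (at 0 within S)" for S
  proof (rule Lim_null_comparison)
    have "eventually (\<lambda>t::real. dist t 0 < pi \<and> t \<noteq> 0) (at 0 within S)"
      unfolding eventually_at using pi_gt_zero by (intro exI[of _ pi]) auto
    then show "eventually (\<lambda>t. norm (of_real (u t) * exp_primitive t x) \<le> \<bar>t\<bar>) (at 0 within S)"
    proof eventually_elim
      case (elim t)
      then have "\<bar>u t\<bar> \<le> 1" by (intro u01) (auto simp: dist_real_def)
      then have "\<bar>u t\<bar> * cmod (exp_primitive t x) \<le> 1 * \<bar>t\<bar>"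
        by (intro mult_mono cmod_exp_primitive_le) auto
      then show ?case by (simp add: norm_mult)
    qed
    show "((\<lambda>t. \<bar>t\<bar>) \<longlongrightarrow> 0) (at (0::real) within S)"
      by (rule tendsto_eq_intros | simp)+
  qed
  have i3: "set_integrable lborel {- pi<..<0} (\<lambda>t. f2 t + f1 t)" "set_integrable lborel {0<..<pi} (\<lambda>t. f2 t + f1 t)"
    by (rule set_integrable_subset[OF i]; auto)+
  have p1: "(LINT t:{- pi<..<0}|lborel. f2 t + f1 t) = 0 - of_real (u (- pi)) * exp_primitive (- pi) x"
    unfolding f1_def f2_def
    by (rule half_interval_by_parts[OF _ u continuous_on_subset[OF v] i3(1)[unfolded f1_def f2_def] lim_end lim_0]) auto
  have p2: "(LINT t:{0<..<pi}|lborel. f2 t + f1 t) = of_real (u pi) * exp_primitive pi x - 0"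
    unfolding f1_def f2_def
    by (rule half_interval_by_parts[OF _ u continuous_on_subset[OF v] i3(2)[unfolded f1_def f2_def] lim_0 lim_end]) auto
  have "(LINT t:{- pi..pi}|lborel. f2 t + f1 t) = (LINT t:{- pi..pi}|lborel. f2 t) + (LINT t:{- pi..pi}|lborel. f1 t)"
    by (rule set_integral_add(2)[OF i2 i1])
  then show ?thesis using un p1 p2 by (simp add: f1_def f2_def algebra_simps)
qed

section \<open>Truncated fundamental functions\<close>

lemma sinc_eq_exp_primitive:
  "of_real (2 * pi) * of_real (sinc (pi * x)) = exp_primitive pi x - exp_primitive (- pi) x"
proof (cases "x = 0")
  case False
  have "expi (x * pi) - expi (x * - pi) = 2 * \<i> * of_real (sin (pi * x))"
    by (simp only: cis_conv_exp[symmetric]) (simp add: complex_eq_iff mult.commute)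
  then have "exp_primitive pi x - exp_primitive (- pi) x = 2 * \<i> * of_real (sin (pi * x)) / (\<i> * of_real x)"
    using False by (simp add: exp_primitive_def diff_divide_distrib[symmetric] del: of_real_mult)
  also have "\<dots> = of_real (2 * pi) * of_real (sinc (pi * x))"
    using False by simp
  finally show ?thesis by simp
qed (simp add: exp_primitive_def)

lemma AE_nonzero_on_period: "AE x in lborel. x \<in> {- pi..pi} \<longrightarrow> x \<in> {- pi..pi} - {0::real}"
  using AE_lborel_singleton[of 0] by eventually_elim auto

text \<open>The function \<open>g\<close> stands for the Fourier transform of an interpolator and \<open>g'\<close> for its derivative. The constant \<open>C\<close>
and the majorants \<open>M\<close> are those of the family, so that every estimate in terms of them is uniform over it.
The double sum is required for finite index sets only, which is all that truncated kernels need.\<close>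

locale periodized_quotient =
  fixes g g' :: "real \<Rightarrow> real" and m C :: real and M :: "int \<Rightarrow> real"
  assumes deriv: "\<And>x. x \<noteq> 0 \<Longrightarrow> (g has_real_derivative g' x) (at x)"
    and cont': "continuous_on (- {0}) g'"
    and nonneg: "\<And>x. x \<noteq> 0 \<Longrightarrow> 0 \<le> g x"
    and m: "0 < m" and lower: "\<And>x. x \<in> {- pi..pi} - {0} \<Longrightarrow> m \<le> g x"
    and C: "0 \<le> C"
    and cross: "\<And>J. finite J \<Longrightarrow> (\<Sum>j\<in>J. \<Sum>k\<in>J - {j}. \<integral>\<^sup>+\<xi>\<in>{- pi..pi}.
       ennreal \<bar>g (\<xi> + 2 * pi * of_int j) / g \<xi> * (g' (\<xi> + 2 * pi * of_int k) / g \<xi>)\<bar> \<partial>lborel) \<le> ennreal C"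
    and M_summable: "M summable_on UNIV"
    and majorant: "\<And>j x. j \<noteq> 0 \<Longrightarrow> x \<in> {- pi..pi} - {0} \<Longrightarrow> g (x + 2 * pi * of_int j) / g x \<le> M j"
begin

definition window :: "nat \<Rightarrow> int set" where "window N = {- int N..int N}"

definition den :: "nat \<Rightarrow> real \<Rightarrow> real" where
  "den N x = (\<Sum>k\<in>window N. g (x + 2 * pi * of_int k))"

definition quot :: "nat \<Rightarrow> int \<Rightarrow> real \<Rightarrow> real" where
  "quot N j x = g (x + 2 * pi * of_int j) / den N x"

definition quot' :: "nat \<Rightarrow> int \<Rightarrow> real \<Rightarrow> real" where
  "quot' N j x = (\<Sum>k\<in>window N - {j}. g' (x + 2 * pi * of_int j) * g (x + 2 * pi * of_int k)
     - g (x + 2 * pi * of_int j) * g' (x + 2 * pi * of_int k)) / (den N x)\<^sup>2"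

definition trunc_kernel :: "nat \<Rightarrow> real \<Rightarrow> complex" where
  "trunc_kernel N x = (\<Sum>k\<in>window N. expi (x * (2 * pi * of_int k)) *
     (LINT t:{- pi..pi}|lborel. of_real (quot N k t) * expi (x * t)))"

definition weight :: "nat \<Rightarrow> real \<Rightarrow> real" where
  "weight N t = indicator {- pi..pi} t * (\<Sum>k\<in>window N. \<bar>quot' N k t\<bar>)"

abbreviation (input) g_at :: "int \<Rightarrow> real \<Rightarrow> real" where
  "g_at k x \<equiv> g (x + 2 * pi * of_int k)"

abbreviation (input) g_at' :: "int \<Rightarrow> real \<Rightarrow> real" where
  "g_at' k x \<equiv> g' (x + 2 * pi * of_int k)"

lemma finite_window [simp]: "finite (window N)"
  by (simp add: window_def)

lemma zero_in_window [simp]: "0 \<in> window N"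
  by (simp add: window_def)

lemma g_measurable [measurable]: "g \<in> borel_measurable borel"
proof (rule borel_measurable_continuous_countable_exceptions)
  show "continuous_on (- {0}) g"
    using deriv by (intro continuous_at_imp_continuous_on) (auto intro: DERIV_isCont)
qed auto

lemma g'_measurable [measurable]: "g' \<in> borel_measurable borel"
  by (rule borel_measurable_continuous_countable_exceptions[OF _ cont']) auto

lemma den_measurable [measurable]: "den N \<in> borel_measurable borel"
  unfolding den_def[abs_def] by measurable

lemma quot_measurable [measurable]: "quot N j \<in> borel_measurable borel"
  unfolding quot_def[abs_def] by measurable

lemma quot'_measurable [measurable]: "quot' N j \<in> borel_measurable borel"
  unfolding quot'_def[abs_def] by measurable

lemma shift_nonzero:
  fixes k :: int
  assumes "x \<in> {- pi..pi} - {0}"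
  shows "x + 2 * pi * of_int k \<noteq> 0"
proof
  assume *: "x + 2 * pi * of_int k = 0"
  show False
  proof (cases "k = 0")
    case False
    then have "1 \<le> \<bar>real_of_int k\<bar>" by linarith
    then have "2 * pi * 1 \<le> 2 * pi * \<bar>real_of_int k\<bar>" by (intro mult_left_mono) auto
    moreover have "x = - (2 * pi * of_int k)" using * by linarith
    then have "\<bar>x\<bar> = 2 * pi * \<bar>real_of_int k\<bar>" by (simp add: abs_mult)
    moreover have "\<bar>x\<bar> \<le> pi" using assms by auto
    ultimately show False using pi_gt_zero by linarith
  qed (use * assms in auto)
qed

context
  fixes x :: real
  assumes x: "x \<in> {- pi..pi} - {0}"
begin

lemma g_shift_nonneg: "0 \<le> g_at k x"
  using nonneg shift_nonzero[OF x] by blast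

lemma g_pos: "0 < g x"
  using lower[OF x] m by linarith

lemma g_le_den: "g x \<le> den N x"
  using member_le_sum[of 0 "window N" "\<lambda>k. g_at k x"] g_shift_nonneg
  by (simp add: den_def)

lemma den_pos: "0 < den N x"
  using g_le_den g_pos by (rule less_le_trans[rotated])

lemma quot_nonneg: "0 \<le> quot N k x"
  unfolding quot_def using g_shift_nonneg den_pos by (simp add: less_imp_le)

lemma sum_quot: "(\<Sum>k\<in>window N. quot N k x) = 1"
  using den_pos by (simp add: quot_def sum_divide_distrib[symmetric] den_def[symmetric] less_imp_neq[symmetric])

lemma quot_le_1: "k \<in> window N \<Longrightarrow> quot N k x \<le> 1"
  using member_le_sum[of k "window N" "\<lambda>k. quot N k x"] quot_nonneg sum_quot by simp

lemma quot_le_ratio: "quot N k x \<le> g_at k x / g x"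
  unfolding quot_def by (intro divide_left_mono g_le_den g_shift_nonneg mult_pos_pos den_pos g_pos)

text \<open>In the numerator of the quotient rule the products with \<open>k = j\<close> cancel, which is why \<open>quot'\<close> omits that index.\<close>

lemma quot_has_derivative:
  assumes "j \<in> window N"
  shows "(quot N j has_real_derivative quot' N j x) (at x)"
proof -
  have d: "((\<lambda>x. g_at k x) has_real_derivative g_at' k x) (at x)" for k :: int
    using deriv[OF shift_nonzero[OF x, of k]] by (subst (asm) DERIV_shift) 
  have "(den N has_real_derivative (\<Sum>k\<in>window N. g_at' k x)) (at x)"
    unfolding den_def[abs_def] by (intro DERIV_sum d)
  then have "(quot N j has_real_derivative (g_at' j x * den N x - g_at j x * (\<Sum>k\<in>window N. g_at' k x))
      / (den N x * den N x)) (at x)"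
    unfolding quot_def[abs_def] by (intro DERIV_divide d) (use den_pos[of N] in simp_all)
  moreover have "g_at' j x * den N x - g_at j x * (\<Sum>k\<in>window N. g_at' k x)
     = (\<Sum>k\<in>window N - {j}. g_at' j x * g_at k x
     - g_at j x * g_at' k x)"
    using assms by (simp add: den_def sum.remove[of "window N" j] sum_subtractf sum_distrib_left algebra_simps)
  ultimately show ?thesis by (simp add: quot'_def power2_eq_square)
qed

lemma abs_quot'_le:
  "\<bar>quot' N j x\<bar> \<le> (\<Sum>k\<in>window N - {j}.
      \<bar>g_at k x / g x * (g_at' j x / g x)\<bar>
    + \<bar>g_at j x / g x * (g_at' k x / g x)\<bar>)"
proof -
  let ?t = "\<lambda>k. g_at' j x * g_at k x
     - g_at j x * g_at' k x"
  have "\<bar>quot' N j x\<bar> = \<bar>\<Sum>k\<in>window N - {j}. ?t k\<bar> / (den N x)\<^sup>2"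
    by (simp add: quot'_def)
  also have "\<dots> \<le> (\<Sum>k\<in>window N - {j}. \<bar>?t k\<bar>) / (g x)\<^sup>2"
    using g_pos g_le_den by (intro frac_le sum_abs sum_nonneg power_mono) auto
  also have "\<dots> \<le> (\<Sum>k\<in>window N - {j}.
      \<bar>g_at k x / g x * (g_at' j x / g x)\<bar>
    + \<bar>g_at j x / g x * (g_at' k x / g x)\<bar>)"
    unfolding sum_divide_distrib
  proof (rule sum_mono)
    fix k
    have "\<bar>?t k\<bar> \<le> \<bar>g_at' j x * g_at k x\<bar> + \<bar>g_at j x * g_at' k x\<bar>"
      by (rule abs_triangle_ineq4)
    then have "\<bar>?t k\<bar> / (g x)\<^sup>2 \<le> (\<bar>g_at' j x * g_at k x\<bar> + \<bar>g_at j x * g_at' k x\<bar>) / (g x)\<^sup>2"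
      by (rule divide_right_mono) simp
    then show "\<bar>?t k\<bar> / (g x)\<^sup>2 \<le> \<bar>g_at k x / g x * (g_at' j x / g x)\<bar>
      + \<bar>g_at j x / g x * (g_at' k x / g x)\<bar>"
      by (simp add: abs_mult power2_eq_square add_divide_distrib mult.commute)
  qed
  finally show ?thesis .
qed

end

lemma quot'_continuous: 
  assumes "j \<in> window N" shows "continuous_on ({- pi<..<pi} - {0}) (quot' N j)"
proof -
  have gc: "continuous_on (- {0}) g"
    using deriv by (intro continuous_at_imp_continuous_on) (auto intro: DERIV_isCont)
  have mem: "x + 2 * pi * of_int k \<in> - {0}" "den N x \<noteq> 0" if "x \<in> {- pi<..<pi} - {0}" for x and k :: int
  proof -
    have "x \<in> {- pi..pi} - {0}" using that by auto
    from shift_nonzero[OF this] den_pos[OF this, of N] show "x + 2 * pi * of_int k \<in> - {0}" "den N x \<noteq> 0" by auto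
  qed
  have c: "continuous_on ({- pi<..<pi} - {0}) (\<lambda>x. g_at k x)"
       "continuous_on ({- pi<..<pi} - {0}) (\<lambda>x. g_at' k x)" for k :: int
  proof -
    have sub: "(\<lambda>x. x + 2 * pi * of_int k) ` ({- pi<..<pi} - {0}) \<subseteq> - {0}"
      by (intro image_subsetI mem(1))
    have id: "continuous_on ({- pi<..<pi} - {0}) (\<lambda>x. x + 2 * pi * of_int k)"
      by (intro continuous_intros)
    show "continuous_on ({- pi<..<pi} - {0}) (\<lambda>x. g_at k x)"
       "continuous_on ({- pi<..<pi} - {0}) (\<lambda>x. g_at' k x)"
      by (rule continuous_on_compose2[OF gc id sub] continuous_on_compose2[OF cont' id sub])+
  qed
  show ?thesis
    unfolding quot'_def[abs_def] 
    by (intro continuous_on_divide continuous_on_sum continuous_on_diff continuous_on_mult continuous_on_power c)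
       (use c mem in \<open>auto simp: den_def[abs_def] intro!: continuous_on_sum\<close>)
qed

text \<open>The total variation of all the quotients together is at most \<open>2 C\<close>: each term of the quotient rule is an
off-diagonal product, and exchanging the two indices maps the first family of products to the second.\<close>

lemma weight_nn_integral: "(\<integral>\<^sup>+t. ennreal (weight N t) \<partial>lborel) \<le> ennreal (2 * C)"
proof -
  define c where "c j k t = \<bar>g_at j t / g t * (g_at' k t / g t)\<bar>" for j k :: int and t
  have [measurable]: "c j k \<in> borel_measurable borel" for j k unfolding c_def by measurable
  define d where "d j k t = ennreal (c j k t) * indicator {- pi..pi} t" for j k :: int and t
  have [measurable]: "d j k \<in> borel_measurable borel" for j k unfolding d_def by measurable
  have c0: "0 \<le> c j k t" for j k t by (simp add: c_def)
  let ?W = "window N"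
  have "(\<integral>\<^sup>+t. ennreal (weight N t) \<partial>lborel) \<le> (\<integral>\<^sup>+t. (\<Sum>j\<in>?W. \<Sum>k\<in>?W - {j}. d k j t
      + d j k t) \<partial>lborel)"
  proof (rule nn_integral_mono_AE)
    show "AE t in lborel. ennreal (weight N t) \<le> (\<Sum>j\<in>?W. \<Sum>k\<in>?W - {j}. d k j t
      + d j k t)"
      using AE_nonzero_on_period
    proof eventually_elim
      case (elim t)
      show ?case
      proof (cases "t \<in> {- pi..pi}")
        case True
        then have t: "t \<in> {- pi..pi} - {0}" using elim by blast
        have "weight N t \<le> (\<Sum>j\<in>?W. \<Sum>k\<in>?W - {j}. c k j t + c j k t)"
        proof -
          have "weight N t = (\<Sum>k\<in>?W. \<bar>quot' N k t\<bar>)" using True by (simp add: weight_def)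
          also have "\<dots> \<le> (\<Sum>j\<in>?W. \<Sum>k\<in>?W - {j}. c k j t + c j k t)"
            unfolding c_def by (intro sum_mono abs_quot'_le[OF t])
          finally show ?thesis .
        qed
        then have "ennreal (weight N t) \<le> ennreal (\<Sum>j\<in>?W. \<Sum>k\<in>?W - {j}. c k j t + c j k t)"
          by (rule ennreal_leI)
        also have "\<dots> = (\<Sum>j\<in>?W. \<Sum>k\<in>?W - {j}. ennreal (c k j t) + ennreal (c j k t))"
          by (simp add: c0 sum_nonneg ennreal_plus[symmetric] del: ennreal_plus)
        finally show ?thesis using True by (simp add: d_def)
      qed (simp add: weight_def)
    qed
  qed
  also have "\<dots> = (\<Sum>j\<in>?W. \<Sum>k\<in>?W - {j}. \<integral>\<^sup>+t. d k j t \<partial>lborel)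
      + (\<Sum>j\<in>?W. \<Sum>k\<in>?W - {j}. \<integral>\<^sup>+t. d j k t \<partial>lborel)"
    by (simp add: nn_integral_sum nn_integral_add sum.distrib)
  also have "(\<Sum>j\<in>?W. \<Sum>k\<in>?W - {j}. \<integral>\<^sup>+t. d k j t \<partial>lborel)
     = (\<Sum>j\<in>?W. \<Sum>k\<in>?W - {j}. \<integral>\<^sup>+t. d j k t \<partial>lborel)"
  proof -
    have s: "?W - {j} = {k\<in>?W. k \<noteq> j}" "?W - {j} = {k\<in>?W. j \<noteq> k}" for j by auto
    show ?thesis
      by (subst s(1), subst s(2), rule sum.swap_restrict) auto
  qed
  also have "\<dots> + \<dots> \<le> ennreal C + ennreal C"
    using cross[of ?W] unfolding d_def c_def by (intro add_mono) auto
  also have "\<dots> = ennreal (2 * C)" using C by (simp add: ennreal_plus[symmetric] del: ennreal_plus)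
  finally show ?thesis .
qed

lemma weight_nonneg: "0 \<le> weight N t"
  by (auto simp: weight_def intro!: mult_nonneg_nonneg sum_nonneg)

lemma weight_integrable: "integrable lborel (weight N)"
  and weight_integral_le: "(\<integral>t. weight N t \<partial>lborel) \<le> 2 * C"
proof -
  have [measurable]: "weight N \<in> borel_measurable borel" unfolding weight_def[abs_def] by measurable
  show *: "integrable lborel (weight N)"
    by (rule integrableI_bounded)
       (use weight_nn_integral[of N] weight_nonneg[of N] in \<open>auto simp: less_top[symmetric] top_unique\<close>)
  have "ennreal (\<integral>t. weight N t \<partial>lborel) = (\<integral>\<^sup>+t. ennreal (weight N t) \<partial>lborel)"
    by (rule nn_integral_eq_integral[symmetric, OF *]) (simp add: weight_nonneg)
  also have "\<dots> \<le> ennreal (2 * C)" by (rule weight_nn_integral)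
  finally show "(\<integral>t. weight N t \<partial>lborel) \<le> 2 * C" using C by simp
qed

lemma quot'_integrable:
  assumes "j \<in> window N" shows "period_integrable (quot' N j)"
  unfolding set_integrable_def
proof (rule Bochner_Integration.integrable_bound[OF weight_integrable[of N]])
  show "AE t in lborel. norm (indicat_real {- pi..pi} t *\<^sub>R quot' N j t) \<le> norm (weight N t)"
    using assms by (intro AE_I2) (auto simp: weight_def indicator_def intro!: member_le_sum[of j "window N" "\<lambda>k. \<bar>quot' N k _\<bar>", THEN order_trans])
qed measurable

end

text \<open>The phase factors of the translates of the period are invariant under integer shifts, so they can be pulled out of
a convolution over the integers.\<close>

lemma exp_two_pi_int_shift:
  fixes j k :: int
  shows "expi ((x - of_int j) * (2 * pi * of_int k)) = expi (x * (2 * pi * of_int k))"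
proof -
  have "expi ((x - of_int j) * (2 * pi * of_int k)) = cis (x * (2 * pi * of_int k)) / cis (2 * pi * of_int (j * k))"
    by (simp only: cis_conv_exp[symmetric] cis_divide) (simp add: algebra_simps)
  also have "cis (2 * pi * of_int (j * k)) = 1" by (rule cis_multiple_2pi) auto
  finally show ?thesis by (simp only: cis_conv_exp div_by_1)
qed

context periodized_quotient
begin

lemma quot'_mult_integrable:
  assumes k: "k \<in> window N" and [measurable]: "h \<in> borel_measurable borel"
    and h: "\<And>t. t \<in> {- pi..pi} \<Longrightarrow> cmod (h t) \<le> R"
  shows "period_integrable (\<lambda>t. of_real (quot' N k t) * h t)"
  unfolding set_integrable_def
proof (rule Bochner_Integration.integrable_bound)
  show "integrable lborel (\<lambda>t. (indicator {- pi..pi} t *\<^sub>R quot' N k t) * R)"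
    using quot'_integrable[OF k] unfolding set_integrable_def by (rule integrable_mult_left)
  show "AE t in lborel. norm (indicator {- pi..pi} t *\<^sub>R (of_real (quot' N k t) * h t)) \<le>
      norm ((indicator {- pi..pi} t *\<^sub>R quot' N k t) * R)"
  proof (rule AE_I2)
    fix t
    have "cmod (h t) \<le> \<bar>R\<bar>" if "t \<in> {- pi..pi}" using h[OF that] by linarith
    then show "norm (indicator {- pi..pi} t *\<^sub>R (of_real (quot' N k t) * h t)) \<le>
      norm ((indicator {- pi..pi} t *\<^sub>R quot' N k t) * R)"
      by (auto simp: indicator_def norm_mult abs_mult intro!: mult_left_mono)
  qed
qed measurable

lemma exp_conv_le_on:
  "t \<in> {- pi..pi} \<Longrightarrow> cmod (exp_conv J a t x) \<le> pi * (\<Sum>j\<in>J. cmod (a j))"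
  by (rule order_trans[OF cmod_exp_conv_le]) (auto intro!: mult_right_mono sum_nonneg)

lemma trunc_kernel_eq:
  "trunc_kernel N x = (\<Sum>k\<in>window N. expi (x * (2 * pi * of_int k)) *
     (of_real (quot N k pi) * exp_primitive pi x - of_real (quot N k (- pi)) * exp_primitive (- pi) x
      - (LINT t:{- pi..pi}|lborel. of_real (quot' N k t) * exp_primitive t x)))"
  unfolding trunc_kernel_def
proof (intro sum.cong refl arg_cong2[where f = "(*)"])
  fix k assume k: "k \<in> window N"
  show "(LINT t:{- pi..pi}|lborel. of_real (quot N k t) * expi (x * t)) =
    of_real (quot N k pi) * exp_primitive pi x - of_real (quot N k (- pi)) * exp_primitive (- pi) x
      - (LINT t:{- pi..pi}|lborel. of_real (quot' N k t) * exp_primitive t x)"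
  proof (rule fourier_integral_by_parts[OF quot_has_derivative[OF _ k] quot'_continuous[OF k] _ quot_measurable quot'_integrable[OF k]])
    fix t :: real assume "t \<in> {- pi..pi} - {0}"
    from quot_nonneg[OF this, of N k] quot_le_1[OF this k] show "\<bar>quot N k t\<bar> \<le> 1" by simp
  qed
qed

text \<open>Integration by parts on every translate of the period. The phases have modulus 1 and the quotients at \<open>\<plusminus>\<pi>\<close>
sum to 1, so the boundary terms do not grow with the truncation.\<close>

lemma trunc_kernel_conv_le:
  assumes J: "finite J"
  shows "cmod (\<Sum>j\<in>J. a j * trunc_kernel N (x - of_int j)) \<le>
    cmod (exp_conv J a pi x) + cmod (exp_conv J a (- pi) x)
     + (\<integral>t. weight N t * cmod (exp_conv J a t x) \<partial>lborel)"
proof -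
  let ?S = "\<lambda>t. exp_conv J a t x"
  let ?W = "window N"
  define e where "e k = expi (x * (2 * pi * of_int k))" for k :: int
  have ne: "cmod (e k) = 1" for k unfolding e_def by (rule norm_exp_i_times)
  define I where "I k j = (LINT t:{- pi..pi}|lborel. of_real (quot' N k t) * exp_primitive t (x - of_int j))" for k j :: int
  have Isum: "(\<Sum>j\<in>J. a j * I k j) = (LINT t:{- pi..pi}|lborel. of_real (quot' N k t) * ?S t)" if k: "k \<in> ?W" for k
  proof -
    have i: "period_integrable (\<lambda>t. of_real (quot' N k t) * exp_primitive t (x - of_int j))" for j :: int
    proof (rule quot'_mult_integrable[OF k])
      show "cmod (exp_primitive t (x - of_int j)) \<le> pi" if "t \<in> {- pi..pi}" for t
        using cmod_exp_primitive_le[of t "x - of_int j"] that by (auto simp: abs_le_iff)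
    qed measurable
    have "(LINT t:{- pi..pi}|lborel. of_real (quot' N k t) * ?S t) = 
      (\<integral>t. (\<Sum>j\<in>J. a j * (indicator {- pi..pi} t *\<^sub>R (of_real (quot' N k t) * exp_primitive t (x - of_int j)))) \<partial>lborel)"
      unfolding set_lebesgue_integral_def exp_conv_def
      by (intro Bochner_Integration.integral_cong refl)
         (simp add: sum_distrib_left scaleR_sum_right scaleR_conv_of_real mult_ac)
    also have "\<dots> = (\<Sum>j\<in>J. a j * I k j)"
      unfolding I_def set_lebesgue_integral_def
      by (simp only: Bochner_Integration.integral_sum[OF integrable_mult_right[OF i[unfolded set_integrable_def]]] integral_mult_right_zero)
    finally show ?thesis by simp
  qed
  have "(\<Sum>j\<in>J. a j * trunc_kernel N (x - of_int j)) =
     (\<Sum>j\<in>J. \<Sum>k\<in>?W. e k * (of_real (quot N k pi) * (a j * exp_primitive pi (x - of_int j))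
        - of_real (quot N k (- pi)) * (a j * exp_primitive (- pi) (x - of_int j)) - a j * I k j))"
    unfolding trunc_kernel_eq exp_two_pi_int_shift e_def[symmetric] I_def[symmetric]
    by (simp add: sum_distrib_left algebra_simps)
  also have "\<dots> = (\<Sum>k\<in>?W. \<Sum>j\<in>J. e k * (of_real (quot N k pi) * (a j * exp_primitive pi (x - of_int j))
        - of_real (quot N k (- pi)) * (a j * exp_primitive (- pi) (x - of_int j)) - a j * I k j))"
    by (rule sum.swap)
  also have "\<dots> = (\<Sum>k\<in>?W. e k * (of_real (quot N k pi) * ?S pi
        - of_real (quot N k (- pi)) * ?S (- pi) - (LINT t:{- pi..pi}|lborel. of_real (quot' N k t) * ?S t)))"
  proof (rule sum.cong[OF refl])
    fix k assume k: "k \<in> ?W"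
    have "(\<Sum>j\<in>J. e k * (of_real (quot N k pi) * (a j * exp_primitive pi (x - of_int j))
        - of_real (quot N k (- pi)) * (a j * exp_primitive (- pi) (x - of_int j)) - a j * I k j))
      = e k * (of_real (quot N k pi) * ?S pi - of_real (quot N k (- pi)) * ?S (- pi) - (\<Sum>j\<in>J. a j * I k j))"
      by (simp add: exp_conv_def sum_distrib_left[symmetric] sum_subtractf)
    then show "(\<Sum>j\<in>J. e k * (of_real (quot N k pi) * (a j * exp_primitive pi (x - of_int j))
        - of_real (quot N k (- pi)) * (a j * exp_primitive (- pi) (x - of_int j)) - a j * I k j))
      = e k * (of_real (quot N k pi) * ?S pi
        - of_real (quot N k (- pi)) * ?S (- pi) - (LINT t:{- pi..pi}|lborel. of_real (quot' N k t) * ?S t))"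
      unfolding Isum[OF k] .
  qed
  finally have "cmod (\<Sum>j\<in>J. a j * trunc_kernel N (x - of_int j)) \<le>
     (\<Sum>k\<in>?W. quot N k pi * cmod (?S pi) + quot N k (- pi) * cmod (?S (- pi)) 
        + (LINT t:{- pi..pi}|lborel. \<bar>quot' N k t\<bar> * cmod (?S t)))"
  proof (simp only:, intro order_trans[OF norm_sum] sum_mono)
    fix k assume k: "k \<in> ?W"
    have q: "0 \<le> quot N k pi" "0 \<le> quot N k (- pi)" by (rule quot_nonneg; simp)+
    have "cmod (LINT t:{- pi..pi}|lborel. of_real (quot' N k t) * ?S t) \<le> (LINT t:{- pi..pi}|lborel. \<bar>quot' N k t\<bar> * cmod (?S t))"
      unfolding set_lebesgue_integral_def
      by (rule order_trans[OF integral_norm_bound]) (simp add: norm_mult)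
    then show "cmod (e k * (of_real (quot N k pi) * ?S pi
        - of_real (quot N k (- pi)) * ?S (- pi) - (LINT t:{- pi..pi}|lborel. of_real (quot' N k t) * ?S t)))
       \<le> quot N k pi * cmod (?S pi) + quot N k (- pi) * cmod (?S (- pi)) 
        + (LINT t:{- pi..pi}|lborel. \<bar>quot' N k t\<bar> * cmod (?S t))"
      unfolding norm_mult ne mult_1
      by (intro order_trans[OF norm_triangle_ineq4] add_mono) (use q in \<open>simp_all add: norm_mult\<close>)
  qed
  also have "\<dots> = (\<Sum>k\<in>?W. quot N k pi) * cmod (?S pi) + (\<Sum>k\<in>?W. quot N k (- pi)) * cmod (?S (- pi))
       + (\<Sum>k\<in>?W. LINT t:{- pi..pi}|lborel. \<bar>quot' N k t\<bar> * cmod (?S t))"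
    by (simp only: sum.distrib sum_distrib_right)
  also have "(\<Sum>k\<in>?W. quot N k pi) = 1" by (rule sum_quot) simp
  also have "(\<Sum>k\<in>?W. quot N k (- pi)) = 1" by (rule sum_quot) simp
  also have "(\<Sum>k\<in>?W. LINT t:{- pi..pi}|lborel. \<bar>quot' N k t\<bar> * cmod (?S t)) = (\<integral>t. weight N t * cmod (?S t) \<partial>lborel)"
  proof -
    have "period_integrable (\<lambda>t. \<bar>quot' N k t\<bar> * cmod (?S t))" if "k \<in> ?W" for k
    proof -
      have "period_integrable (\<lambda>t. norm (of_real (quot' N k t) * ?S t))"
        by (rule set_integrable_norm, rule quot'_mult_integrable[OF that]) 
           (measurable, rule exp_conv_le_on)
      then show ?thesis by (simp add: norm_mult)
    qed
    then show ?thesis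
      unfolding set_lebesgue_integral_def set_integrable_def
      by (subst Bochner_Integration.integral_sum[symmetric])
         (auto intro!: Bochner_Integration.integral_cong simp: weight_def sum_distrib_left sum_distrib_right mult_ac)
  qed
  finally show ?thesis by simp
qed

definition trunc_err :: "nat \<Rightarrow> real \<Rightarrow> complex" where
  "trunc_err N x = trunc_kernel N x / of_real (2 * pi) - of_real (sinc (pi * x))"

lemma trunc_err_eq: "of_real (2 * pi) * trunc_err N x = trunc_kernel N x - (exp_primitive pi x - exp_primitive (- pi) x)"
  by (simp add: trunc_err_def right_diff_distrib sinc_eq_exp_primitive[symmetric])

lemma trunc_err_conv_le:
  assumes J: "finite J"
  shows "cmod (\<Sum>j\<in>J. a j * trunc_err N (x - of_int j)) \<le>
    2 * cmod (exp_conv J a pi x) + 2 * cmod (exp_conv J a (- pi) x)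
     + (\<integral>t. weight N t * cmod (exp_conv J a t x) \<partial>lborel)"
proof -
  let ?e = "\<Sum>j\<in>J. a j * trunc_err N (x - of_int j)"
  have "of_real (2 * pi) * ?e = (\<Sum>j\<in>J. a j * (of_real (2 * pi) * trunc_err N (x - of_int j)))"
    by (simp add: sum_distrib_left mult_ac)
  also have "\<dots> = (\<Sum>j\<in>J. a j * trunc_kernel N (x - of_int j)) - (exp_conv J a pi x - exp_conv J a (- pi) x)"
    unfolding trunc_err_eq exp_conv_def by (simp add: right_diff_distrib sum_subtractf)
  finally have "cmod (of_real (2 * pi) * ?e) \<le> cmod (\<Sum>j\<in>J. a j * trunc_kernel N (x - of_int j))
     + (cmod (exp_conv J a pi x) + cmod (exp_conv J a (- pi) x))"
    by (simp only:) (rule order_trans[OF norm_triangle_ineq4 add_left_mono[OF norm_triangle_ineq4]])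
  moreover have "1 * cmod ?e \<le> (2 * pi) * cmod ?e"
    using pi_gt3 by (intro mult_right_mono) auto
  then have "cmod ?e \<le> cmod (of_real (2 * pi) * ?e)" by (simp add: norm_mult)
  ultimately show ?thesis using trunc_kernel_conv_le[OF J, of a N x] by linarith
qed

lemma trunc_kernel_measurable [measurable]: "trunc_kernel N \<in> borel_measurable borel"
  unfolding trunc_kernel_def[abs_def] set_lebesgue_integral_def
  by measurable

lemma trunc_err_measurable [measurable]: "trunc_err N \<in> borel_measurable borel"
proof -
  have "(\<lambda>x. trunc_kernel N x / of_real (2 * pi) - (exp_primitive pi x - exp_primitive (- pi) x) / of_real (2 * pi)) \<in> borel_measurable borel"
    by measurable
  also have "(\<lambda>x. trunc_kernel N x / of_real (2 * pi) - (exp_primitive pi x - exp_primitive (- pi) x) / of_real (2 * pi)) = trunc_err N"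
    by (auto simp: trunc_err_def sinc_eq_exp_primitive[symmetric])
  finally show ?thesis .
qed

lemma weight_outside: "\<bar>t\<bar> > pi \<Longrightarrow> weight N t = 0"
  by (auto simp: weight_def indicator_def abs_if split: if_splits)

lemma trunc_err_lp_bound:
  assumes p: "1 < p" and J: "finite J" and B: "0 \<le> B"
    and S: "\<And>t. \<bar>t\<bar> \<le> pi \<Longrightarrow> lp_mass p (exp_conv J a t) \<le> ennreal B"
  shows "lp_mass p (\<lambda>x. \<Sum>j\<in>J. a j * trunc_err N (x - of_int j))
    \<le> ennreal (3 powr p * (2 * 2 powr p + (2 * C) powr p) * B)"
  by (rule nn_integral_superposition_le[OF p B _ S weight_integrable weight_nonneg weight_outside weight_integral_le trunc_err_conv_le[OF J]])
     (use C in simp)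

text \<open>The convolution estimate for the unit sequence at 0, combined with the decay of the kernels.\<close>

lemma trunc_err_decay: "cmod (trunc_err N x) \<le> (4 + 2 * C) * (8 / (1 + \<bar>x\<bar>))"
proof -
  let ?B = "8 / (1 + \<bar>x\<bar>)"
  have B: "cmod (exp_primitive t x) \<le> ?B" if "\<bar>t\<bar> \<le> pi" for t
    using that by (rule exp_primitive_decay)
  have e: "exp_conv {0} (\<lambda>_. 1) t x = exp_primitive t x" for t by (simp add: exp_conv_def)
  have "cmod (trunc_err N x) \<le> 2 * cmod (exp_primitive pi x) + 2 * cmod (exp_primitive (- pi) x)
     + (\<integral>t. weight N t * cmod (exp_primitive t x) \<partial>lborel)"
    using trunc_err_conv_le[of "{0}" "\<lambda>_. 1" N x] by (simp add: e)
  also have "(\<integral>t. weight N t * cmod (exp_primitive t x) \<partial>lborel) \<le> (\<integral>t. weight N t * ?B \<partial>lborel)"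
  proof (rule integral_mono_AE')
    show "integrable lborel (\<lambda>t. weight N t * ?B)" using weight_integrable by (rule integrable_mult_left)
    show "AE t in lborel. weight N t * cmod (exp_primitive t x) \<le> weight N t * ?B"
    proof (rule AE_I2)
      fix t show "weight N t * cmod (exp_primitive t x) \<le> weight N t * ?B"
        using mult_left_mono[OF B weight_nonneg, of t N t] weight_outside[of t N]
        by (cases "\<bar>t\<bar> \<le> pi") simp_all
    qed
    show "AE t in lborel. 0 \<le> weight N t * ?B"
      by (intro AE_I2 mult_nonneg_nonneg weight_nonneg) simp
  qed
  also have "\<dots> = (\<integral>t. weight N t \<partial>lborel) * ?B" by (rule integral_mult_left_zero)
  also have "\<dots> \<le> 2 * C * ?B" by (intro mult_right_mono weight_integral_le) auto
  also have "2 * cmod (exp_primitive pi x) \<le> 2 * ?B" using B[of pi] by simp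
  also have "2 * cmod (exp_primitive (- pi) x) \<le> 2 * ?B" using B[of "- pi"] by simp
  finally show ?thesis by (simp add: algebra_simps add_divide_distrib)
qed

lemma ratio_integrable:
  assumes "k \<noteq> 0"
  shows "period_integrable (\<lambda>t. g_at k t / g t)"
  unfolding set_integrable_def
proof (rule Bochner_Integration.integrable_bound)
  show "integrable lborel (\<lambda>t. indicator {- pi..pi} t *\<^sub>R M k)" by simp
  show "AE t in lborel. norm (indicator {- pi..pi} t *\<^sub>R (g_at k t / g t)) \<le> norm (indicator {- pi..pi} t *\<^sub>R M k)"
    using AE_nonzero_on_period
  proof eventually_elim
    case (elim t)
    show ?case
    proof (cases "t \<in> {- pi..pi}")
      case True
      then have t: "t \<in> {- pi..pi} - {0}" using elim by blast
      have "0 \<le> g_at k t / g t"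
        using g_shift_nonneg[OF t] g_pos[OF t] by simp
      then have "\<bar>g_at k t / g t\<bar> \<le> \<bar>M k\<bar>"
        using majorant[OF assms t] by linarith
      then show ?thesis using True by (simp del: abs_divide)
    qed simp
  qed
qed measurable

lemma quot_integrable:
  assumes k: "k \<in> window N"
  shows "period_integrable (quot N k)"
  unfolding set_integrable_def
proof (rule Bochner_Integration.integrable_bound)
  show "integrable lborel (\<lambda>t. indicator {- pi..pi} t *\<^sub>R (1::real))" by simp
  show "AE t in lborel. norm (indicator {- pi..pi} t *\<^sub>R quot N k t) \<le> norm (indicator {- pi..pi} t *\<^sub>R (1::real))"
    using AE_nonzero_on_period
  proof eventually_elim
    case (elim t)
    then show ?case using quot_nonneg[of t N k] quot_le_1[OF _ k, of t] by (auto simp: indicator_def)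
  qed
qed measurable

text \<open>Since the quotients sum to 1, the defect of the central one equals the sum of the others. Both contributions to the
error are therefore bounded by the mass of the quotients with \<open>k \<noteq> 0\<close>, and each of these is at most the ratio
\<open>g(t + 2\<pi>k) / g(t)\<close>.\<close>

lemma trunc_err_small:
  "cmod (trunc_err N x) \<le> (\<Sum>k\<in>window N - {0}. LINT t:{- pi..pi}|lborel. g_at k t / g t)"
proof -
  let ?W = "window N - {0}"
  define e where "e k = expi (x * (2 * pi * of_int k))" for k :: int
  have ne: "cmod (e k) = 1" for k unfolding e_def by (rule norm_exp_i_times)
  define F where "F k = (LINT t:{- pi..pi}|lborel. of_real (quot N k t) * expi (x * t))" for k
  define q where "q k = (LINT t:{- pi..pi}|lborel. quot N k t)" for k
  define D where "D = exp_primitive pi x - exp_primitive (- pi) x"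
  have D_eq: "D = (LINT t:{- pi..pi}|lborel. of_real 1 * expi (x * t))"
    unfolding D_def
    by (subst fourier_integral_by_parts[where v = "\<lambda>_. 0"]) (auto simp: set_integrable_def set_lebesgue_integral_def)
  have int_e: "period_integrable (\<lambda>t. of_real (h t) * expi (x * t))"
    if "period_integrable h" for h
  proof -
    have m: "(\<lambda>t. indicator {- pi..pi} t *\<^sub>R h t) \<in> borel_measurable borel" using that by (auto simp: set_integrable_def)
    have "integrable lborel (\<lambda>t. of_real (indicator {- pi..pi} t *\<^sub>R h t) * expi (x * t))"
    proof (rule Bochner_Integration.integrable_bound[OF that[unfolded set_integrable_def]])
      show "(\<lambda>t. of_real (indicator {- pi..pi} t *\<^sub>R h t) * expi (x * t)) \<in> borel_measurable lborel"
        using m by measurable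
    qed (auto simp: norm_mult simp del: of_real_mult)
    then show ?thesis by (simp add: set_integrable_def scaleR_conv_of_real mult.assoc)
  qed
  have norm_e: "cmod (LINT t:{- pi..pi}|lborel. of_real (h t) * expi (x * t)) \<le> (LINT t:{- pi..pi}|lborel. \<bar>h t\<bar>)" for h
    unfolding set_lebesgue_integral_def
    by (rule order_trans[OF integral_norm_bound]) (simp add: norm_mult del: of_real_mult)
  have abs_q: "(LINT t:{- pi..pi}|lborel. \<bar>quot N k t\<bar>) = q k" for k
    unfolding q_def by (rule set_lebesgue_integral_cong_AE)
       (use AE_nonzero_on_period quot_nonneg in \<open>auto elim!: eventually_mono\<close>)
  have F0: "cmod (F 0 - D) \<le> (\<Sum>k\<in>?W. q k)"
  proof -
    have one: "period_integrable (\<lambda>_. 1::real)" by (simp add: set_integrable_def)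
    have "F 0 - D = (LINT t:{- pi..pi}|lborel. of_real (quot N 0 t) * expi (x * t) - of_real 1 * expi (x * t))"
      unfolding F_def D_eq
      by (rule set_integral_diff(2)[OF int_e[OF quot_integrable[OF zero_in_window]] int_e[OF one], symmetric])
    also have "\<dots> = (LINT t:{- pi..pi}|lborel. of_real (quot N 0 t - 1) * expi (x * t))"
      by (simp add: left_diff_distrib)
    finally have "cmod (F 0 - D) \<le> (LINT t:{- pi..pi}|lborel. \<bar>quot N 0 t - 1\<bar>)"
      using norm_e[of "\<lambda>t. quot N 0 t - 1"] by simp
    also have "\<dots> = (LINT t:{- pi..pi}|lborel. (\<Sum>k\<in>?W. quot N k t))"
    proof (rule set_lebesgue_integral_cong_AE)
      show "AE t\<in>{- pi..pi} in lborel. \<bar>quot N 0 t - 1\<bar> = (\<Sum>k\<in>?W. quot N k t)"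
        using AE_nonzero_on_period
      proof (eventually_elim, intro impI)
        fix t assume "t \<in> {- pi..pi} \<longrightarrow> t \<in> {- pi..pi} - {0}" "t \<in> {- pi..pi}"
        then have t: "t \<in> {- pi..pi} - {0}" by blast
        have "quot N 0 t + (\<Sum>k\<in>?W. quot N k t) = 1"
          using sum_quot[OF t, of N] by (subst (asm) sum.remove[of _ 0]) auto
        moreover have "0 \<le> (\<Sum>k\<in>?W. quot N k t)" by (intro sum_nonneg quot_nonneg[OF t])
        ultimately show "\<bar>quot N 0 t - 1\<bar> = (\<Sum>k\<in>?W. quot N k t)" by linarith
      qed
    qed auto
    also have "\<dots> = (\<Sum>k\<in>?W. q k)"
      unfolding q_def set_lebesgue_integral_def scaleR_sum_right
      by (rule Bochner_Integration.integral_sum) (use quot_integrable in \<open>auto simp: set_integrable_def\<close>)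
    finally show ?thesis .
  qed
  have "of_real (2 * pi) * trunc_err N x = (\<Sum>k\<in>window N. e k * F k) - D"
    unfolding trunc_err_eq D_def trunc_kernel_def e_def F_def ..
  also have "\<dots> = (\<Sum>k\<in>?W. e k * F k) + (F 0 - D)"
    by (subst sum.remove[of _ 0]) (auto simp: e_def)
  finally have "cmod (of_real (2 * pi) * trunc_err N x) \<le> cmod (\<Sum>k\<in>?W. e k * F k) + cmod (F 0 - D)"
    by (simp only: norm_triangle_ineq)
  also have "cmod (\<Sum>k\<in>?W. e k * F k) \<le> (\<Sum>k\<in>?W. q k)"
  proof (rule order_trans[OF norm_sum], rule sum_mono)
    fix k show "cmod (e k * F k) \<le> q k"
      using norm_e[of "quot N k"] unfolding norm_mult ne F_def abs_q by simp
  qed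
  also note F0
  also have "(\<Sum>k\<in>?W. q k) + (\<Sum>k\<in>?W. q k) \<le> 2 * (\<Sum>k\<in>?W. LINT t:{- pi..pi}|lborel. g_at k t / g t)"
  proof -
    have "q k \<le> (LINT t:{- pi..pi}|lborel. g_at k t / g t)" if k: "k \<in> ?W" for k
      unfolding q_def
    proof (rule set_integral_mono_AE)
      show "period_integrable (quot N k)" using k by (intro quot_integrable) auto
      show "period_integrable (\<lambda>t. g_at k t / g t)" using k by (intro ratio_integrable) auto
      show "AE t\<in>{- pi..pi} in lborel. quot N k t \<le> g_at k t / g t"
        using AE_nonzero_on_period by eventually_elim (use quot_le_ratio in auto)
    qed
    then have "(\<Sum>k\<in>?W. q k) \<le> (\<Sum>k\<in>?W. LINT t:{- pi..pi}|lborel. g_at k t / g t)"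
      by (rule sum_mono)
    then show ?thesis by simp
  qed
  finally have "2 * pi * cmod (trunc_err N x) \<le> 2 * (\<Sum>k\<in>?W. LINT t:{- pi..pi}|lborel. g_at k t / g t)"
    by (simp add: norm_mult)
  moreover have "2 * 1 * cmod (trunc_err N x) \<le> 2 * pi * cmod (trunc_err N x)"
    using pi_gt3 by (intro mult_right_mono mult_left_mono) auto
  ultimately show ?thesis by simp
qed

end

section \<open>Removing the truncation\<close>

lemma filterlim_symmetric_intervals: "filterlim (\<lambda>N. {- int N..int N}) (finite_subsets_at_top UNIV) sequentially"
  unfolding filterlim_finite_subsets_at_top
proof (intro allI impI)
  fix X :: "int set" assume "finite X \<and> X \<subseteq> UNIV"
  then have X: "finite X" by simp
  define b where "b = nat (\<Sum>n\<in>X. \<bar>n\<bar>)"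
  have "\<bar>n\<bar> \<le> int b" if "n \<in> X" for n
    using member_le_sum[of n X abs] X that by (simp add: b_def)
  then have "X \<subseteq> {- int N..int N}" if "N \<ge> b" for N using that by force
  then show "\<forall>\<^sub>F N in sequentially. finite {- int N..int N} \<and> X \<subseteq> {- int N..int N} \<and> {- int N..int N} \<subseteq> UNIV"
    unfolding eventually_sequentially by auto
qed

lemma has_sum_symmetric_limit:
  fixes f :: "int \<Rightarrow> 'a::{comm_monoid_add, topological_space}"
  assumes "(f has_sum s) UNIV"
  shows "(\<lambda>N. \<Sum>k\<in>{- int N..int N}. f k) \<longlonglongrightarrow> s"
  using filterlim_compose[OF assms[unfolded has_sum_def] filterlim_symmetric_intervals] .

text \<open>The index of the translate of \<open>[-\<pi>, \<pi>)\<close> that contains \<open>x\<close>.\<close>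

definition cell :: "real \<Rightarrow> int" where "cell x = \<lfloor>(x + pi) / (2 * pi)\<rfloor>"

lemma cell_eq_iff: "cell x = j \<longleftrightarrow> x - 2 * pi * of_int j \<in> {- pi..<pi}"
proof -
  have "cell x = j \<longleftrightarrow> of_int j \<le> (x + pi) / (2 * pi) \<and> (x + pi) / (2 * pi) < of_int j + 1"
    unfolding cell_def by (rule floor_eq_iff)
  also have "\<dots> \<longleftrightarrow> x - 2 * pi * of_int j \<in> {- pi..<pi}"
    using pi_gt_zero by (auto simp: field_simps)
  finally show ?thesis .
qed

abbreviation residue :: "real \<Rightarrow> real" where
  "residue y \<equiv> y - 2 * pi * of_int (cell y)"

lemma cell_measurable [measurable]: "cell \<in> measurable borel (count_space UNIV)"
  unfolding cell_def[abs_def] by measurable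

text \<open>Rescaling \<open>x\<close> to \<open>-\<pi> + 2\<pi>x\<close> turns the cells into unit intervals.\<close>

lemma nn_integral_cell_le:
  fixes b :: "int \<Rightarrow> real"
  assumes b0: "\<And>n. 0 \<le> b n" and B: "\<And>F. finite F \<Longrightarrow> sum b F \<le> B"
  shows "(\<integral>\<^sup>+x. ennreal (b (cell x)) \<partial>lborel) \<le> ennreal (2 * pi * B)"
proof -
  have B0: "0 \<le> B" using B[of "{}"] by simp
  have "(\<integral>\<^sup>+x. ennreal (b (cell x)) \<partial>lborel) = ennreal (2 * pi) * (\<integral>\<^sup>+x. ennreal (b (cell (- pi + 2 * pi * x))) \<partial>lborel)"
    by (subst nn_integral_real_affine[of _ "2 * pi" "- pi"]) auto
  also have "(\<integral>\<^sup>+x. ennreal (b (cell (- pi + 2 * pi * x))) \<partial>lborel) = (\<integral>\<^sup>+x. ennreal (b \<lfloor>x::real\<rfloor>) \<partial>lborel)"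
    by (simp add: cell_def)
  also have "(\<integral>\<^sup>+x. ennreal (b \<lfloor>x::real\<rfloor>) \<partial>lborel) \<le> ennreal B"
  proof (rule nn_integral_le_unit_steps[OF _ b0 _ B])
    show "b \<lfloor>x\<rfloor> \<le> b n" if "x \<in> {of_int n..<of_int n + 1}" for n and x :: real
      using that floor_eq_iff[of x n] by simp
  qed auto
  finally show ?thesis using B0 by (simp add: ennreal_mult mult_left_mono)
qed

context periodized_quotient
begin

definition full_den :: "real \<Rightarrow> real" where
  "full_den x = (\<Sum>\<^sub>\<infinity>j. g_at j x)"

definition full_kernel :: "real \<Rightarrow> complex" where
  "full_kernel x = (LINT y|lborel. of_real (g y / full_den y) * expi (x * y))"

text \<open>A majorant of the quotients on each cell. The central quotient is at most 1 and is not covered by \<open>M\<close>.\<close>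

definition cell_bound :: "int \<Rightarrow> real" where "cell_bound j = (if j = 0 then 1 else M j)"

lemma M_nonneg: "j \<noteq> 0 \<Longrightarrow> 0 \<le> M j"
proof -
  assume j: "j \<noteq> 0"
  have p: "pi \<in> {- pi..pi} - {0}" by simp
  have "0 \<le> g (pi + 2 * pi * of_int j) / g pi"
    using g_shift_nonneg[OF p] g_pos[OF p] by simp
  also have "\<dots> \<le> M j" by (rule majorant[OF j p])
  finally show ?thesis .
qed

lemma cell_bound_nonneg: "0 \<le> cell_bound j"
  using M_nonneg by (simp add: cell_bound_def)

lemma cell_bound_summable: "cell_bound summable_on UNIV"
proof -
  have "(\<lambda>j. M j + (if j = 0 then 1 - M j else 0)) summable_on UNIV"
  proof (rule summable_on_add[OF M_summable])
    have "(\<lambda>j. if j = 0 then 1 - M j else 0) summable_on {0}" by simp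
    then show "(\<lambda>j. if j = 0 then 1 - M j else 0) summable_on UNIV"
      by (subst summable_on_cong_neutral[of "{0}" UNIV _ "\<lambda>j. if j = 0 then 1 - M j else 0"]) auto
  qed
  moreover have "(\<lambda>j. M j + (if j = 0 then 1 - M j else 0)) = cell_bound" by (auto simp: cell_bound_def)
  ultimately show ?thesis by simp
qed

lemma sum_cell_bound_le: "finite F \<Longrightarrow> sum cell_bound F \<le> infsum cell_bound UNIV"
  by (rule finite_sum_le_infsum[OF cell_bound_summable]) (auto simp: cell_bound_nonneg)

lemma quot_le_cell_bound:
  assumes x: "x \<in> {- pi..pi} - {0}" and k: "k \<in> window N"
  shows "quot N k x \<le> cell_bound k"
  using quot_le_1[OF x k] quot_le_ratio[OF x, of N k] majorant[OF _ x, of k] by (auto simp: cell_bound_def)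

lemma g_shift_summable:
  assumes x: "x \<in> {- pi..pi} - {0}"
  shows "(\<lambda>j. g_at j x) summable_on UNIV"
proof (rule summable_on_comparison_test)
  show "(\<lambda>j. cell_bound j * g x) summable_on UNIV"
    by (rule summable_on_cmult_left[OF cell_bound_summable])
  fix j :: int
  show "g_at j x \<le> cell_bound j * g x"
    using majorant[OF _ x, of j] g_pos[OF x] by (simp add: cell_bound_def divide_le_eq)
  show "0 \<le> g_at j x" by (rule g_shift_nonneg[OF x])
qed

lemma den_tendsto:
  assumes x: "x \<in> {- pi..pi} - {0}"
  shows "(\<lambda>N. den N x) \<longlonglongrightarrow> full_den x"
  unfolding den_def window_def full_den_def
  by (rule has_sum_symmetric_limit, rule has_sum_infsum, rule g_shift_summable[OF x])

lemma full_den_periodic: "full_den (x + 2 * pi * of_int k) = full_den x"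
proof -
  have "full_den (x + 2 * pi * of_int k) = (\<Sum>\<^sub>\<infinity>j. g (x + 2 * pi * of_int (j + k)))"
    unfolding full_den_def by (simp add: algebra_simps)
  also have "\<dots> = full_den x"
    unfolding full_den_def
    by (rule infsum_reindex_bij_betw) (rule bij_betwI[where g = "\<lambda>j. j - k"], auto)
  finally show ?thesis .
qed

text \<open>The truncated quotients put next to each other on their cells, that is, \<open>g\<close> divided by the truncated
periodization on the first \<open>2 N + 1\<close> cells.\<close>

definition glued :: "nat \<Rightarrow> real \<Rightarrow> real" where
  "glued N y = (\<Sum>k\<in>window N. indicator {- pi..<pi} (y - 2 * pi * of_int k) * quot N k (y - 2 * pi * of_int k))"

lemma glued_eq:
  "glued N y = (if cell y \<in> window N then quot N (cell y) (residue y) else 0)"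
proof -
  have "glued N y = (\<Sum>k\<in>window N. if k = cell y then quot N k (y - 2 * pi * of_int k) else 0)"
  proof (unfold glued_def, rule sum.cong[OF refl])
    fix k
    have e: "y - 2 * pi * of_int k \<in> {- pi..<pi} \<longleftrightarrow> k = cell y"
      by (subst cell_eq_iff[symmetric]) auto
    show "indicator {- pi..<pi} (y - 2 * pi * of_int k) * quot N k (y - 2 * pi * of_int k)
      = (if k = cell y then quot N k (y - 2 * pi * of_int k) else 0)"
      unfolding indicator_def e by simp
  qed
  then show ?thesis by simp
qed

lemma glued_measurable [measurable]: "glued N \<in> borel_measurable borel"
  unfolding glued_def[abs_def] by measurable

lemma trunc_kernel_eq_glued:
  "integrable lborel (\<lambda>y. of_real (glued N y) * expi (x * y))"
  "trunc_kernel N x = (LINT y|lborel. of_real (glued N y) * expi (x * y))"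
proof -
  define f where "f k t = of_real (indicator {- pi..<pi} t * quot N k t) * expi (x * (t + 2 * pi * of_int k))" for k t
  have int: "integrable lborel (f k)" if k: "k \<in> window N" for k
  proof (rule Bochner_Integration.integrable_bound)
    show "integrable lborel (\<lambda>t. indicator {- pi..pi} t *\<^sub>R quot N k t)"
      using quot_integrable[OF k] by (simp add: set_integrable_def)
    show "AE t in lborel. norm (f k t) \<le> norm (indicator {- pi..pi} t *\<^sub>R quot N k t)"
      unfolding f_def norm_mult norm_exp_i_times by (auto simp: indicator_def)
  qed (unfold f_def, measurable)
  have eq: "expi (x * (2 * pi * of_int k)) * (LINT t:{- pi..pi}|lborel. of_real (quot N k t) * expi (x * t))
     = (LINT t|lborel. f k t)" for k
  proof -
    have "expi (x * (2 * pi * of_int k)) * (LINT t:{- pi..pi}|lborel. of_real (quot N k t) * expi (x * t))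
      = (LINT t|lborel. expi (x * (2 * pi * of_int k)) * (indicator {- pi..pi} t *\<^sub>R (of_real (quot N k t) * expi (x * t))))"
      unfolding set_lebesgue_integral_def by (rule integral_mult_right_zero[symmetric])
    also have "\<dots> = (LINT t|lborel. f k t)"
    proof (rule integral_cong_AE)
      show "AE t in lborel. expi (x * (2 * pi * of_int k)) * (indicator {- pi..pi} t *\<^sub>R (of_real (quot N k t) * expi (x * t))) = f k t"
        using AE_lborel_singleton[of pi]
      proof eventually_elim
        case (elim t)
        have "expi (x * (t + 2 * pi * of_int k)) = expi (x * (2 * pi * of_int k)) * expi (x * t)"
          by (simp add: exp_add[symmetric] algebra_simps)
        then show ?case using elim unfolding f_def by (auto simp: indicator_def simp del: of_real_mult)
      qed
    qed (unfold f_def, measurable)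
    finally show ?thesis .
  qed
  have shift1: "integrable lborel (\<lambda>y. f k (- (2 * pi * of_int k) + 1 * y))" if "k \<in> window N" for k
    by (rule lborel_integrable_real_affine[OF int[OF that]]) simp
  have shift2: "(LINT t|lborel. f k t) = (LINT y|lborel. f k (- (2 * pi * of_int k) + 1 * y))" for k
    using lborel_integral_real_affine[of 1 "f k" "- (2 * pi * of_int k)"] by simp
  have g: "(\<lambda>y. of_real (glued N y) * expi (x * y)) = (\<lambda>y. \<Sum>k\<in>window N. f k (- (2 * pi * of_int k) + 1 * y))"
  proof
    fix y
    have "- c + 1 * y = y - c" "y - c + c = y" for c :: real by simp_all
    then have "f k (- (2 * pi * of_int k) + 1 * y) = of_real (indicator {- pi..<pi} (y - 2 * pi * of_int k) * quot N k (y - 2 * pi * of_int k))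
        * expi (x * y)" for k
      unfolding f_def by (simp only:)
    then show "of_real (glued N y) * expi (x * y) = (\<Sum>k\<in>window N. f k (- (2 * pi * of_int k) + 1 * y))"
      unfolding glued_def by (simp only: of_real_sum sum_distrib_right)
  qed
  show "integrable lborel (\<lambda>y. of_real (glued N y) * expi (x * y))"
    unfolding g by (intro Bochner_Integration.integrable_sum shift1)
  show "trunc_kernel N x = (LINT y|lborel. of_real (glued N y) * expi (x * y))"
    unfolding g trunc_kernel_def eq
    by (subst Bochner_Integration.integral_sum[OF shift1]) (simp_all add: shift2)
qed

lemma AE_off_lattice: "AE y in lborel. residue y \<in> {- pi..pi} - {0}"
proof -
  have "countable (range (\<lambda>k::int. 2 * pi * of_int k))" by simp
  then have "AE y in lborel. y \<notin> range (\<lambda>k::int. 2 * pi * of_int k)"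
    by (rule AE_not_in[OF countable_imp_null_set_lborel])
  then show ?thesis
  proof eventually_elim
    case (elim y)
    have "residue y \<in> {- pi..<pi}" using cell_eq_iff by blast
    moreover have "residue y \<noteq> 0" using elim by (auto simp: image_iff)
    ultimately show ?case by auto
  qed
qed

lemma glued_tendsto:
  assumes y: "residue y \<in> {- pi..pi} - {0}"
  shows "(\<lambda>N. glued N y) \<longlonglongrightarrow> g y / full_den y"
proof -
  define t where "t = residue y"
  have yt: "y = t + 2 * pi * of_int (cell y)" by (simp add: t_def)
  have t: "t \<in> {- pi..pi} - {0}" using y by (simp add: t_def)
  have fd: "full_den y = full_den t" by (subst yt) (rule full_den_periodic)
  have "g t \<le> full_den t"
    by (rule LIMSEQ_le_const[OF den_tendsto[OF t]]) (use g_le_den[OF t] in auto)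
  then have "full_den t \<noteq> 0" using g_pos[OF t] by linarith
  then have "(\<lambda>N. g y / den N t) \<longlonglongrightarrow> g y / full_den t"
    by (intro tendsto_divide tendsto_const den_tendsto t)
  moreover have "eventually (\<lambda>N. g y / den N t = glued N y) sequentially"
    using eventually_ge_at_top[of "nat \<bar>cell y\<bar>"]
  proof eventually_elim
    case (elim N)
    then have "cell y \<in> window N" by (auto simp: window_def)
    then show ?case by (simp add: glued_eq t_def[symmetric] quot_def yt[symmetric])
  qed
  ultimately show ?thesis unfolding fd by (rule Lim_transform_eventually)
qed

text \<open>Dominated convergence on the line. Off the countable lattice \<open>2\<pi>\<int>\<close> the periodization converges, and the values on each
cell are dominated by a summable sequence.\<close>

lemma trunc_kernel_tendsto: "(\<lambda>N. trunc_kernel N x) \<longlonglongrightarrow> full_kernel x"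
  unfolding trunc_kernel_eq_glued(2) full_kernel_def
proof (rule integral_dominated_convergence)
  have "(\<lambda>y. g y / full_den y) \<in> borel_measurable borel"
  proof (rule measurable_discrete_difference)
    show "(\<lambda>y. lim (\<lambda>N. glued N y)) \<in> borel_measurable borel"
      by (rule borel_measurable_lim_metric) measurable
    show "countable (range (\<lambda>k::int. 2 * pi * of_int k))" by simp
    fix y :: real assume "y \<notin> range (\<lambda>k::int. 2 * pi * of_int k)"
    then have "residue y \<noteq> 0" by (auto simp: image_iff)
    moreover have "residue y \<in> {- pi..<pi}" using cell_eq_iff by blast
    ultimately show "lim (\<lambda>N. glued N y) = g y / full_den y"
      by (intro limI glued_tendsto) auto
  qed auto
  then show "(\<lambda>y. of_real (g y / full_den y) * expi (x * y)) \<in> borel_measurable lborel"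
    by measurable
  show "integrable lborel (\<lambda>y. cell_bound (cell y))"
  proof (rule integrableI_bounded)
    have "(\<integral>\<^sup>+y. ennreal (norm (cell_bound (cell y))) \<partial>lborel) \<le> ennreal (2 * pi * infsum cell_bound UNIV)"
      using nn_integral_cell_le[OF cell_bound_nonneg sum_cell_bound_le] by (simp add: cell_bound_nonneg)
    then show "(\<integral>\<^sup>+y. ennreal (norm (cell_bound (cell y))) \<partial>lborel) < \<infinity>"
      by (rule le_less_trans) simp
  qed measurable
  show "AE y in lborel. (\<lambda>N. of_real (glued N y) * expi (x * y)) \<longlonglongrightarrow> of_real (g y / full_den y) * expi (x * y)"
    using AE_off_lattice by eventually_elim (intro tendsto_intros glued_tendsto)
  fix N
  show "(\<lambda>y. of_real (glued N y) * expi (x * y)) \<in> borel_measurable lborel" by measurable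
  show "AE y in lborel. norm (of_real (glued N y) * expi (x * y)) \<le> cell_bound (cell y)"
    using AE_off_lattice
  proof eventually_elim
    case (elim y)
    have "\<bar>glued N y\<bar> \<le> cell_bound (cell y)"
      using quot_le_cell_bound[OF elim, of "cell y" N] quot_nonneg[OF elim, of N "cell y"] cell_bound_nonneg[of "cell y"]
      by (simp add: glued_eq)
    then show ?case by (simp add: norm_mult del: of_real_mult)
  qed
qed

definition full_err :: "real \<Rightarrow> complex" where
  "full_err x = full_kernel x / of_real (2 * pi) - of_real (sinc (pi * x))"

lemma trunc_err_tendsto: "(\<lambda>N. trunc_err N x) \<longlonglongrightarrow> full_err x"
  unfolding trunc_err_def full_err_def by (intro tendsto_intros trunc_kernel_tendsto) auto

lemma full_err_measurable [measurable]: "full_err \<in> borel_measurable borel"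
  by (rule borel_measurable_LIMSEQ_metric[OF trunc_err_measurable trunc_err_tendsto])

lemma full_err_decay: "cmod (full_err x) \<le> (4 + 2 * C) * (8 / (1 + \<bar>x\<bar>))"
  by (rule LIMSEQ_le_const2[OF tendsto_norm[OF trunc_err_tendsto]]) (use trunc_err_decay in auto)

lemma full_err_small:
  assumes "\<And>F. finite F \<Longrightarrow> 0 \<notin> F \<Longrightarrow> (\<Sum>k\<in>F. LINT t:{- pi..pi}|lborel. g_at k t / g t) \<le> e"
  shows "cmod (full_err x) \<le> e"
  by (rule LIMSEQ_le_const2[OF tendsto_norm[OF trunc_err_tendsto]]) (use order_trans[OF trunc_err_small assms] in auto)

text \<open>Fatou's lemma carries the bound for the truncated kernels over to their pointwise limit.\<close>

lemma full_err_lp_bound: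
  assumes p: "1 < p" and J: "finite J" and B: "0 \<le> B"
    and S: "\<And>t. \<bar>t\<bar> \<le> pi \<Longrightarrow> lp_mass p (exp_conv J a t) \<le> ennreal B"
  shows "lp_mass p (\<lambda>x. \<Sum>j\<in>J. a j * full_err (x - of_int j))
    \<le> ennreal (3 powr p * (2 * 2 powr p + (2 * C) powr p) * B)" (is "_ \<le> ?K")
proof -
  let ?f = "\<lambda>N x. ennreal (cmod (\<Sum>j\<in>J. a j * trunc_err N (x - of_int j)) powr p)"
  have "(\<lambda>N. ?f N x) \<longlonglongrightarrow> ennreal (cmod (\<Sum>j\<in>J. a j * full_err (x - of_int j)) powr p)" for x
    using p by (intro tendsto_ennrealI tendsto_powr' tendsto_intros trunc_err_tendsto) auto
  then have "lp_mass p (\<lambda>x. \<Sum>j\<in>J. a j * full_err (x - of_int j))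
     = (\<integral>\<^sup>+x. liminf (\<lambda>N. ?f N x) \<partial>lborel)"
    by (intro nn_integral_cong lim_imp_Liminf[symmetric] trivial_limit_sequentially)
  also have "\<dots> \<le> liminf (\<lambda>N. \<integral>\<^sup>+x. ?f N x \<partial>lborel)"
    by (rule nn_integral_liminf) measurable
  also have "\<dots> \<le> ?K"
    by (rule Liminf_le) (auto intro!: always_eventually trunc_err_lp_bound[OF p J B S])
  finally show ?thesis .
qed

end

section \<open>Convergence of convolution operators\<close>

lemma sinc_decay: "cmod (of_real (sinc (pi * x))) \<le> 16 / (1 + \<bar>x\<bar>)"
proof -
  have "1 * cmod (of_real (sinc (pi * x))) \<le> cmod (of_real (2 * pi)) * cmod (of_real (sinc (pi * x)))"
    using pi_gt3 by (intro mult_right_mono) auto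
  also have "\<dots> = cmod (exp_primitive pi x - exp_primitive (- pi) x)"
    unfolding sinc_eq_exp_primitive[symmetric] norm_mult ..
  also have "\<dots> \<le> 8 / (1 + \<bar>x\<bar>) + 8 / (1 + \<bar>x\<bar>)"
    by (intro order_trans[OF norm_triangle_ineq4] add_mono exp_primitive_decay) auto
  finally show ?thesis by (simp add: add_divide_distrib[symmetric])
qed

lemma summable_inverse_powr:
  assumes "1 < q"
  shows "(\<lambda>j::int. (1 / (1 + \<bar>real_of_int j\<bar>)) powr q) summable_on UNIV"
proof -
  let ?f = "\<lambda>j::int. (1 / (1 + \<bar>real_of_int j\<bar>)) powr q"
  have "summable (\<lambda>n. real n powr (- q))" using assms by (subst summable_real_powr_iff) simp
  then have "summable (\<lambda>n. real (Suc n) powr (- q))" by (subst summable_Suc_iff)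
  then have "summable (\<lambda>n. norm ((1 / (1 + real n)) powr q))"
    by (simp add: powr_divide powr_minus_divide add.commute)
  then have s: "(\<lambda>n. (1 / (1 + real n)) powr q) summable_on UNIV"
    by (rule norm_summable_imp_summable_on)
  have "?f summable_on range int"
    by (subst summable_on_reindex) (use s in \<open>auto simp: o_def\<close>)
  moreover have "?f summable_on range (\<lambda>n. - int n)"
    by (subst summable_on_reindex) (use s in \<open>auto simp: o_def inj_on_def\<close>)
  ultimately have "?f summable_on (range int \<union> range (\<lambda>n. - int n))"
    by (rule summable_on_union)
  moreover have "range int \<union> range (\<lambda>n. - int n) = UNIV"
    by (auto simp: image_iff) (metis int_cases2)
  ultimately show ?thesis by simp
qed

lemma one_plus_abs_le_mult:
  fixes x y :: real
  shows "1 + \<bar>y\<bar> \<le> (1 + \<bar>x\<bar>) * (1 + \<bar>x - y\<bar>)"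
proof -
  have "\<bar>y\<bar> \<le> \<bar>x\<bar> + \<bar>x - y\<bar>" by linarith
  moreover have "0 \<le> \<bar>x\<bar> * \<bar>x - y\<bar>" by simp
  moreover have "(1 + \<bar>x\<bar>) * (1 + \<bar>x - y\<bar>) = 1 + \<bar>x\<bar> + \<bar>x - y\<bar> + \<bar>x\<bar> * \<bar>x - y\<bar>"
    by (simp add: algebra_simps)
  ultimately show ?thesis by linarith
qed

text \<open>Young's inequality: \<open>1 / (1 + |x|)\<close> is in \<open>l\<^sup>q\<close> for the conjugate exponent \<open>q > 1\<close>.\<close>

lemma lp_times_decaying_summable:
  assumes p: "1 < p" and f: "in_lp p f" and D: "0 \<le> D" "\<And>x. cmod (E x) \<le> D / (1 + \<bar>x\<bar>)"
  shows "(\<lambda>j. f j * E (x - of_int j)) summable_on UNIV"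
proof -
  define q where "q = p / (p - 1)"
  have q: "1 < q" "1 / p + 1 / q = 1"
    using p unfolding q_def by (auto simp: field_simps)
  define R where "R = D * (1 + \<bar>x\<bar>)"
  have R: "0 \<le> R" using D by (simp add: R_def)
  have "(\<lambda>j. norm (f j) powr p + R powr q * (1 / (1 + \<bar>real_of_int j\<bar>)) powr q) summable_on UNIV"
    using f unfolding in_lp_def by (intro summable_on_add summable_on_cmult_right summable_inverse_powr q)
  then have "(\<lambda>j. norm (f j * E (x - of_int j))) summable_on UNIV"
  proof (rule summable_on_comparison_test)
    fix j :: int
    have "cmod (E (x - of_int j)) \<le> D / (1 + \<bar>x - of_int j\<bar>)" by (rule D)
    also have "\<dots> \<le> R * (1 / (1 + \<bar>real_of_int j\<bar>))"
    proof -
      have "D * (1 + \<bar>real_of_int j\<bar>) \<le> D * ((1 + \<bar>x\<bar>) * (1 + \<bar>x - of_int j\<bar>))"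
        by (intro mult_left_mono one_plus_abs_le_mult D)
      then show ?thesis by (simp add: R_def field_simps)
    qed
    finally have "cmod (E (x - of_int j)) powr q \<le> (R * (1 / (1 + \<bar>real_of_int j\<bar>))) powr q"
      using q by (intro powr_mono2) auto
    also have "\<dots> = R powr q * (1 / (1 + \<bar>real_of_int j\<bar>)) powr q"
      using R by (subst powr_mult) auto
    finally have E: "cmod (E (x - of_int j)) powr q \<le> R powr q * (1 / (1 + \<bar>real_of_int j\<bar>)) powr q" .
    have "norm (f j * E (x - of_int j)) \<le> norm (f j) powr p / p + cmod (E (x - of_int j)) powr q / q"
      unfolding norm_mult by (rule Youngs_inequality) (use p q in auto)
    also have "\<dots> \<le> norm (f j) powr p + cmod (E (x - of_int j)) powr q"
      using p q(1) divide_left_mono[of 1 p "norm (f j) powr p"]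
        divide_left_mono[of 1 q "cmod (E (x - of_int j)) powr q"] by simp
    also note E
    finally show "norm (f j * E (x - of_int j)) \<le> norm (f j) powr p + R powr q * (1 / (1 + \<bar>real_of_int j\<bar>)) powr q"
      by simp
  qed auto
  then show ?thesis by (rule abs_summable_summable)
qed

lemma summable_small_tail:
  fixes b :: "int \<Rightarrow> real"
  assumes b: "b summable_on UNIV" "\<And>j. 0 \<le> b j" and e: "0 < e"
  shows "\<exists>N. \<forall>F. finite F \<longrightarrow> F \<inter> {- int N..int N} = {} \<longrightarrow> sum b F \<le> e"
proof -
  have "(\<lambda>N. sum b {- int N..int N}) \<longlonglongrightarrow> infsum b UNIV"
    by (rule has_sum_symmetric_limit[OF has_sum_infsum[OF b(1)]])
  then have "eventually (\<lambda>N. infsum b UNIV - e < sum b {- int N..int N}) sequentially"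
    by (rule order_tendstoD) (use e in simp)
  then obtain N where N: "infsum b UNIV - e < sum b {- int N..int N}"
    by (auto simp: eventually_sequentially)
  have "sum b F \<le> e" if F: "finite F" "F \<inter> {- int N..int N} = {}" for F
  proof -
    have "sum b F + sum b {- int N..int N} = sum b (F \<union> {- int N..int N})"
      by (rule sum.union_disjoint[symmetric]) (use F in auto)
    also have "\<dots> \<le> infsum b UNIV"
      by (rule finite_sum_le_infsum[OF b(1)]) (use F b in auto)
    finally show ?thesis using N by linarith
  qed
  then show ?thesis by blast
qed

lemma ennreal_tendsto_0I:
  fixes F :: "'a \<Rightarrow> ennreal"
  assumes "\<And>e. 0 < e \<Longrightarrow> eventually (\<lambda>n. F n \<le> ennreal e) G"
  shows "(F \<longlongrightarrow> 0) G"
proof (rule order_tendstoI)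
  fix a :: ennreal assume "0 < a"
  then obtain b where b: "0 < b" "b < a" using dense by blast
  then have "b \<noteq> top" by auto
  then obtain r where r: "b = ennreal r" "0 \<le> r" by (cases b) auto
  with b have "0 < r" by (cases "r = 0") auto
  from assms[OF this] show "eventually (\<lambda>n. F n < a) G"
    by eventually_elim (use b r in auto)
qed simp

lemma nn_integral_decay_finite:
  assumes p: "1 < p" and D: "0 \<le> D"
  shows "(\<integral>\<^sup>+x. ennreal ((D / (1 + \<bar>x\<bar>)) powr p) \<partial>lborel) < \<infinity>"
proof -
  let ?b = "\<lambda>n::int. (1 / (1 + \<bar>real_of_int n\<bar>)) powr p"
  define c where "c = (2 * D) powr p"
  have "(\<integral>\<^sup>+x. ennreal ((D / (1 + \<bar>x\<bar>)) powr p) \<partial>lborel) \<le> ennreal (c * infsum ?b UNIV)"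
  proof (rule nn_integral_le_unit_steps[where b = "\<lambda>n. c * ?b n"])
    fix n :: int and x :: real assume x: "x \<in> {of_int n..<of_int n + 1}"
    have "D / (1 + \<bar>x\<bar>) \<le> 2 * D * (1 / (1 + \<bar>real_of_int n\<bar>))"
    proof -
      have "1 + \<bar>real_of_int n\<bar> \<le> 2 * (1 + \<bar>x\<bar>)" using x by auto
      then have "D * (1 + \<bar>real_of_int n\<bar>) \<le> D * (2 * (1 + \<bar>x\<bar>))" by (intro mult_left_mono D)
      then show ?thesis by (simp add: field_simps)
    qed
    then have "(D / (1 + \<bar>x\<bar>)) powr p \<le> (2 * D * (1 / (1 + \<bar>real_of_int n\<bar>))) powr p"
      using p D by (intro powr_mono2) auto
    also have "\<dots> = c * ?b n" unfolding c_def by (rule powr_mult)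
    finally show "(D / (1 + \<bar>x\<bar>)) powr p \<le> c * ?b n" .
  next
    fix F :: "int set" assume "finite F"
    then have "sum ?b F \<le> infsum ?b UNIV"
      by (intro finite_sum_le_infsum summable_inverse_powr p) auto
    then show "(\<Sum>n\<in>F. c * ?b n) \<le> c * infsum ?b UNIV"
      unfolding sum_distrib_left[symmetric] by (intro mult_left_mono) (auto simp: c_def)
  qed (auto simp: c_def)
  then show ?thesis by (rule le_less_trans) simp
qed

text \<open>For a finite part of \<open>f\<close>, dominated convergence gives convergence to 0; the uniform bound \<open>K\<close> makes the remaining
tail small for all \<open>n\<close> at once. The tail is itself an infinite series, to which the bound for finite sequences
extends by Fatou's lemma.\<close>

lemma kernel_convergence:
  fixes E :: "nat \<Rightarrow> real \<Rightarrow> complex" and f :: "int \<Rightarrow> complex"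
  assumes p: "1 < p" and f: "in_lp p f"
    and E [measurable]: "\<And>n. E n \<in> borel_measurable borel"
    and D: "0 \<le> D" "\<And>n x. cmod (E n x) \<le> D / (1 + \<bar>x\<bar>)"
    and lim: "\<And>x. (\<lambda>n. E n x) \<longlonglongrightarrow> 0"
    and K: "0 \<le> K" "\<And>n J a. finite J \<Longrightarrow> lp_mass p (\<lambda>x. \<Sum>j\<in>J. a j * E n (x - of_int j))
       \<le> ennreal (K * lp_sum p J a)"
  shows "(\<lambda>x. \<Sum>\<^sub>\<infinity>j. f j * E n (x - of_int j)) \<in> borel_measurable borel"
    and "(\<lambda>n. lp_mass p (\<lambda>x. \<Sum>\<^sub>\<infinity>j. f j * E n (x - of_int j))) \<longlonglongrightarrow> 0"
proof -
  define S where "S J n x = (\<Sum>j\<in>J. f j * E n (x - of_int j))" for J n x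
  define T where "T n x = (\<Sum>\<^sub>\<infinity>j. f j * E n (x - of_int j))" for n x
  have S [measurable]: "S J n \<in> borel_measurable borel" for J n unfolding S_def[abs_def] by measurable
  have ST: "(\<lambda>N. S {- int N..int N} n x) \<longlonglongrightarrow> T n x" for n x
    unfolding S_def T_def
    by (rule has_sum_symmetric_limit, rule has_sum_infsum, rule lp_times_decaying_summable[OF p f D])
  have T [measurable]: "T n \<in> borel_measurable borel" for n
    by (rule borel_measurable_LIMSEQ_metric[OF S ST])
  then show "(\<lambda>x. \<Sum>\<^sub>\<infinity>j. f j * E n (x - of_int j)) \<in> borel_measurable borel"
    by (simp add: T_def[abs_def])
  have E_lim: "(\<lambda>n. lp_mass p (E n)) \<longlonglongrightarrow> (\<integral>\<^sup>+x. 0 \<partial>(lborel :: real measure))"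
  proof (rule nn_integral_dominated_convergence)
    show "AE x in lborel. ennreal (cmod (E n x) powr p) \<le> ennreal ((D / (1 + \<bar>x\<bar>)) powr p)" for n
      using D p by (intro AE_I2 ennreal_leI powr_mono2) auto
    show "AE x in lborel. (\<lambda>n. ennreal (cmod (E n x) powr p)) \<longlonglongrightarrow> 0"
    proof (rule AE_I2)
      fix x
      have "(\<lambda>n. cmod (E n x) powr p) \<longlonglongrightarrow> cmod 0 powr p"
        using p by (intro tendsto_powr' tendsto_intros lim) auto
      then have "(\<lambda>n. ennreal (cmod (E n x) powr p)) \<longlonglongrightarrow> ennreal (cmod 0 powr p)"
        by (rule tendsto_ennrealI)
      then show "(\<lambda>n. ennreal (cmod (E n x) powr p)) \<longlonglongrightarrow> 0" by simp
    qed
  qed (use nn_integral_decay_finite[OF p D(1)] in auto)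
  have head: "(\<lambda>n. lp_mass p (S J n)) \<longlonglongrightarrow> 0" if J: "finite J" for J
  proof -
    have le: "lp_mass p (S J n) \<le>
       (\<Sum>j\<in>J. ennreal (real (card J) powr p * cmod (f j) powr p) * lp_mass p (E n))" for n
    proof -
      have "lp_mass p (S J n) \<le>
        (\<integral>\<^sup>+x. (\<Sum>j\<in>J. ennreal (real (card J) powr p * cmod (f j) powr p) * ennreal (cmod (E n (x - of_int j)) powr p)) \<partial>lborel)"
      proof (rule nn_integral_mono)
        fix x
        have "cmod (S J n x) powr p \<le> (\<Sum>j\<in>J. cmod (f j * E n (x - of_int j))) powr p"
          unfolding S_def using p by (intro powr_mono2 norm_sum) auto
        also have "\<dots> \<le> real (card J) powr p * (\<Sum>j\<in>J. cmod (f j * E n (x - of_int j)) powr p)"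
          by (rule powr_sum_le[OF p]) auto
        also have "\<dots> = (\<Sum>j\<in>J. real (card J) powr p * cmod (f j) powr p * cmod (E n (x - of_int j)) powr p)"
          by (simp add: norm_mult powr_mult sum_distrib_left mult.assoc)
        finally have "ennreal (cmod (S J n x) powr p) \<le> ennreal (\<Sum>j\<in>J. real (card J) powr p * cmod (f j) powr p * cmod (E n (x - of_int j)) powr p)"
          by (rule ennreal_leI)
        also have "\<dots> = (\<Sum>j\<in>J. ennreal (real (card J) powr p * cmod (f j) powr p) * ennreal (cmod (E n (x - of_int j)) powr p))"
          by (simp add: ennreal_mult[symmetric])
        finally show "ennreal (cmod (S J n x) powr p) \<le> (\<Sum>j\<in>J. ennreal (real (card J) powr p * cmod (f j) powr p) * ennreal (cmod (E n (x - of_int j)) powr p))" .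
      qed
      also have "\<dots> = (\<Sum>j\<in>J. ennreal (real (card J) powr p * cmod (f j) powr p) * lp_mass p (\<lambda>x. E n (x - of_int j)))"
        by (subst nn_integral_sum) (auto simp: nn_integral_cmult)
      also have "\<dots> = (\<Sum>j\<in>J. ennreal (real (card J) powr p * cmod (f j) powr p) * lp_mass p (E n))"
      proof (intro sum.cong refl arg_cong2[where f = "(*)"])
        fix j
        show "lp_mass p (\<lambda>x. E n (x - of_int j)) = lp_mass p (E n)"
          by (subst (2) nn_integral_real_affine[of _ 1 "- of_int j"]) auto
      qed
      finally show ?thesis .
    qed
    have "(\<lambda>n. \<Sum>j\<in>J. ennreal (real (card J) powr p * cmod (f j) powr p) * lp_mass p (E n))
      \<longlonglongrightarrow> (\<Sum>j\<in>J. ennreal (real (card J) powr p * cmod (f j) powr p) * (\<integral>\<^sup>+x. 0 \<partial>(lborel :: real measure)))"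
      by (intro tendsto_sum ennreal_tendsto_cmult E_lim) simp
    then have lim0: "(\<lambda>n. \<Sum>j\<in>J. ennreal (real (card J) powr p * cmod (f j) powr p) * lp_mass p (E n)) \<longlonglongrightarrow> 0"
      by simp
    show ?thesis
      by (rule tendsto_sandwich[OF _ _ tendsto_const lim0]) (auto intro: always_eventually le)
  qed
  show "(\<lambda>n. lp_mass p (\<lambda>x. \<Sum>\<^sub>\<infinity>j. f j * E n (x - of_int j))) \<longlonglongrightarrow> 0"
    unfolding T_def[symmetric]
  proof (rule ennreal_tendsto_0I)
    fix e :: real assume e: "0 < e"
    define d where "d = e / (2 powr p * (1 + K))"
    have q: "0 < 2 powr p * (1 + K)" using K(1) by (intro mult_pos_pos) auto
    have d: "0 < d" "2 powr p * (d + K * d) = e"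
    proof -
      show "0 < d" unfolding d_def by (rule divide_pos_pos[OF e q])
      have "2 powr p * (d + K * d) = (2 powr p * (1 + K)) * d" by (simp add: algebra_simps)
      also have "\<dots> = e" using K(1) by (simp add: d_def)
      finally show "2 powr p * (d + K * d) = e" .
    qed
    obtain N0 where N0: "\<And>F. finite F \<Longrightarrow> F \<inter> {- int N0..int N0} = {} \<Longrightarrow> (\<Sum>j\<in>F. cmod (f j) powr p) \<le> d"
      using summable_small_tail[OF f[unfolded in_lp_def] _ d(1)] by auto
    let ?J = "{- int N0..int N0}"
    have tail: "lp_mass p (\<lambda>x. T n x - S ?J n x) \<le> ennreal (K * d)" for n
    proof -
      let ?h = "\<lambda>N x. ennreal (cmod (S {- int N..int N} n x - S ?J n x) powr p)"
      have "(\<lambda>N. ?h N x) \<longlonglongrightarrow> ennreal (cmod (T n x - S ?J n x) powr p)" for x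
        using p by (intro tendsto_ennrealI tendsto_powr' tendsto_intros ST) auto
      then have "lp_mass p (\<lambda>x. T n x - S ?J n x) = (\<integral>\<^sup>+x. liminf (\<lambda>N. ?h N x) \<partial>lborel)"
        by (intro nn_integral_cong lim_imp_Liminf[symmetric] trivial_limit_sequentially)
      also have "\<dots> \<le> liminf (\<lambda>N. \<integral>\<^sup>+x. ?h N x \<partial>lborel)"
        by (rule nn_integral_liminf) measurable
      also have "\<dots> \<le> ennreal (K * d)"
      proof (rule Liminf_le)
        show "eventually (\<lambda>N. (\<integral>\<^sup>+x. ?h N x \<partial>lborel) \<le> ennreal (K * d)) sequentially"
          using eventually_ge_at_top[of N0]
        proof eventually_elim
          case (elim N)
          let ?F = "{- int N..int N} - ?J"
          have "S {- int N..int N} n x - S ?J n x = (\<Sum>j\<in>?F. f j * E n (x - of_int j))" for x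
            unfolding S_def by (subst sum_diff) (use elim in auto)
          then have "(\<integral>\<^sup>+x. ?h N x \<partial>lborel) \<le> ennreal (K * (\<Sum>j\<in>?F. cmod (f j) powr p))"
            using K(2)[of ?F f n] by simp
          also have "\<dots> \<le> ennreal (K * d)"
            using K(1) by (intro ennreal_leI mult_left_mono N0) auto
          finally show ?case .
        qed
      qed auto
      finally show ?thesis .
    qed
    have "eventually (\<lambda>n. lp_mass p (S ?J n) < ennreal d) sequentially"
      by (rule order_tendstoD(2)[OF head]) (use d in auto)
    then show "eventually (\<lambda>n. lp_mass p (T n) \<le> ennreal e) sequentially"
    proof eventually_elim
      case (elim n)
      have "lp_mass p (T n) \<le> 
        (\<integral>\<^sup>+x. ennreal (2 powr p) * (ennreal (cmod (S ?J n x) powr p) + ennreal (cmod (T n x - S ?J n x) powr p)) \<partial>lborel)"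
      proof (rule nn_integral_mono)
        fix x
        have "cmod (T n x) powr p \<le> (cmod (S ?J n x) + cmod (T n x - S ?J n x)) powr p"
          using p norm_triangle_ineq[of "S ?J n x" "T n x - S ?J n x"] by (intro powr_mono2) auto
        also have "\<dots> \<le> 2 powr p * (cmod (S ?J n x) powr p + cmod (T n x - S ?J n x) powr p)"
          by (rule powr_add_le[OF p]) auto
        finally have "ennreal (cmod (T n x) powr p) \<le> ennreal (2 powr p * (cmod (S ?J n x) powr p + cmod (T n x - S ?J n x) powr p))"
          by (rule ennreal_leI)
        then show "ennreal (cmod (T n x) powr p) \<le> ennreal (2 powr p) * (ennreal (cmod (S ?J n x) powr p) + ennreal (cmod (T n x - S ?J n x) powr p))"
          by (simp add: ennreal_mult)
      qed
      also have "\<dots> = ennreal (2 powr p) * (lp_mass p (S ?J n) + lp_mass p (\<lambda>x. T n x - S ?J n x))"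
        by (simp add: nn_integral_cmult nn_integral_add)
      also have "\<dots> \<le> ennreal (2 powr p) * (ennreal d + ennreal (K * d))"
        using elim by (intro mult_left_mono add_mono tail) auto
      also have "\<dots> = ennreal (2 powr p) * ennreal (d + K * d)"
        using d(1) K(1) by (subst ennreal_plus) auto
      also have "\<dots> = ennreal (2 powr p * (d + K * d))"
        using d(1) K(1) by (intro ennreal_mult[symmetric]) auto
      finally show ?case unfolding d(2) .
    qed
  qed
qed

section \<open>Families of cardinal interpolators\<close>

text \<open>Reduces the limit over the index set to sequences, for which dominated convergence is valid.\<close>

lemma sequential_limit_along_unbounded:
  fixes F :: "real \<Rightarrow> ennreal"
  assumes seq: "\<And>s. (\<And>n. s n \<in> A) \<Longrightarrow> filterlim s at_top sequentially \<Longrightarrow> (\<lambda>n. F (s n)) \<longlonglongrightarrow> 0"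
  shows "(F \<longlongrightarrow> 0) (at_top_in A)"
proof (rule ccontr)
  assume "\<not> ?thesis"
  then obtain e where e: "0 < e" "\<not> eventually (\<lambda>\<alpha>. F \<alpha> < e) (at_top_in A)"
    by (auto simp: order_tendsto_iff)
  have "\<exists>\<alpha>\<in>A. real n \<le> \<alpha> \<and> e \<le> F \<alpha>" for n
  proof (rule ccontr)
    assume "\<not> ?thesis"
    then have "\<forall>\<alpha>\<ge>real n. \<alpha> \<in> A \<longrightarrow> F \<alpha> < e" by force
    then show False using e(2) unfolding eventually_inf_principal eventually_at_top_linorder by blast
  qed
  then obtain s where s: "\<And>n. s n \<in> A" "\<And>n. real n \<le> s n" "\<And>n. e \<le> F (s n)" by metis
  have "filterlim s at_top sequentially"
    by (rule filterlim_at_top_mono[OF filterlim_real_sequentially]) (simp add: s)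
  from seq[OF s(1) this] have "eventually (\<lambda>n. F (s n) < e) sequentially"
    using e(1) by (rule order_tendstoD(2))
  then show False using s(3) by (auto simp: eventually_sequentially leD)
qed

lemma ennreal_sum_le_infsum:
  fixes f :: "'a \<Rightarrow> ennreal"
  assumes "finite F" "F \<subseteq> A"
  shows "sum f F \<le> infsum f A"
  using assms by (subst nonneg_infsum_complete) (auto intro: SUP_upper)

lemma spline_like_family_periodized_quotient:
  assumes "spline_like_family A \<phi>"
  obtains C M where "0 \<le> C" "(\<lambda>j. \<bar>M j\<bar>) summable_on UNIV"
    "\<And>\<alpha>. \<alpha> \<in> A \<Longrightarrow> \<exists>m. periodized_quotient (fhat (\<phi> \<alpha>)) (deriv (fhat (\<phi> \<alpha>))) m C (\<lambda>j. \<bar>M j\<bar>)"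
proof -
  from assms[unfolded spline_like_family_def, THEN conjunct2, THEN conjunct1]
  obtain C0 :: real where C0: "\<forall>\<alpha>\<in>A. (\<Sum>\<^sub>\<infinity>j\<in>(UNIV :: int set). \<Sum>\<^sub>\<infinity>k\<in>UNIV - {j}.
           \<integral>\<^sup>+\<xi>\<in>{-pi..pi}. ennreal \<bar>fhat (\<phi> \<alpha>) (\<xi> + 2 * pi * of_int j) / fhat (\<phi> \<alpha>) \<xi> *
              (deriv (fhat (\<phi> \<alpha>)) (\<xi> + 2 * pi * of_int k) / fhat (\<phi> \<alpha>) \<xi>)\<bar> \<partial>lborel)
        \<le> ennreal C0"
    by (rule exE)
  from assms[unfolded spline_like_family_def, THEN conjunct2, THEN conjunct2, THEN conjunct2]
  obtain M :: "int \<Rightarrow> real" where M: "(\<lambda>j. \<bar>M j\<bar>) summable_on UNIV"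
     "\<forall>\<alpha>\<in>A. \<forall>j. j \<noteq> 0 \<longrightarrow> (\<forall>\<xi>. \<bar>\<xi>\<bar> \<le> pi \<and> \<xi> \<noteq> 0 \<longrightarrow>
           fhat (\<phi> \<alpha>) (\<xi> + 2 * pi * of_int j) / fhat (\<phi> \<alpha>) \<xi> \<le> M j)"
    by (elim exE conjE)
  show ?thesis
  proof (rule that[of "max C0 0" M])
    fix \<alpha> assume \<alpha>: "\<alpha> \<in> A"
    let ?g = "fhat (\<phi> \<alpha>)"
    from \<alpha> have ic: "interpolating_conditions (\<phi> \<alpha>)"
      by (rule bspec[OF assms[unfolded spline_like_family_def, THEN conjunct1]])
    then obtain m where m: "0 < m" "\<And>x. x \<in> {- pi..pi} - {0} \<Longrightarrow> m \<le> ?g x"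
      unfolding interpolating_conditions_def by blast
    have "periodized_quotient ?g (deriv ?g) m (max C0 0) (\<lambda>j. \<bar>M j\<bar>)"
    proof
      show "(?g has_real_derivative deriv ?g x) (at x)" if "x \<noteq> 0" for x
        using ic that unfolding interpolating_conditions_def
        by (intro field_differentiable_derivI) blast
      show "continuous_on (- {0}) (deriv ?g)"
        using ic unfolding interpolating_conditions_def by blast
      show "0 \<le> ?g x" if "x \<noteq> 0" for x
        using ic that unfolding interpolating_conditions_def by blast
      show "?g (x + 2 * pi * of_int j) / ?g x \<le> \<bar>M j\<bar>" if "j \<noteq> 0" "x \<in> {- pi..pi} - {0}" for j x
      proof -
        have "\<bar>x\<bar> \<le> pi \<and> x \<noteq> 0" using that(2) by auto
        then have "?g (x + 2 * pi * of_int j) / ?g x \<le> M j"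
          using M(2) \<alpha> that(1) by blast
        also have "\<dots> \<le> \<bar>M j\<bar>" by (rule abs_ge_self)
        finally show ?thesis .
      qed
      fix J :: "int set" assume J: "finite J"
      let ?c = "\<lambda>j k. \<integral>\<^sup>+\<xi>\<in>{- pi..pi}. ennreal \<bar>?g (\<xi> + 2 * pi * of_int j) / ?g \<xi> *
              (deriv ?g (\<xi> + 2 * pi * of_int k) / ?g \<xi>)\<bar> \<partial>lborel"
      have "(\<Sum>j\<in>J. \<Sum>k\<in>J - {j}. ?c j k) \<le> (\<Sum>j\<in>J. \<Sum>\<^sub>\<infinity>k\<in>UNIV - {j}. ?c j k)"
        by (intro sum_mono ennreal_sum_le_infsum) (use J in auto)
      also have "\<dots> \<le> (\<Sum>\<^sub>\<infinity>j\<in>UNIV. \<Sum>\<^sub>\<infinity>k\<in>UNIV - {j}. ?c j k)"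
        by (intro ennreal_sum_le_infsum J) simp
      also have "\<dots> \<le> ennreal C0" by (rule bspec[OF C0 \<alpha>])
      also have "\<dots> \<le> ennreal (max C0 0)" by (intro ennreal_leI) simp
      finally show "(\<Sum>j\<in>J. \<Sum>k\<in>J - {j}. ?c j k) \<le> ennreal (max C0 0)" .
    qed (use m M(1) in auto)
    then show "\<exists>m. periodized_quotient ?g (deriv ?g) m (max C0 0) (\<lambda>j. \<bar>M j\<bar>)" ..
  qed (use M in auto)
qed

text \<open>The normalizing factors \<open>(2\<pi>)\<^sup>-\<^sup>1\<^sup>/\<^sup>2\<close> of the transform and of its inversion combine to \<open>1 / (2\<pi>)\<close>.\<close>

lemma fundamental_eq_full_kernel:
  assumes "periodized_quotient (fhat \<phi>) g' m C M"
  shows "fundamental \<phi> x = periodized_quotient.full_kernel (fhat \<phi>) x / of_real (2 * pi)"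
proof -
  interpret periodized_quotient "fhat \<phi>" g' m C M by fact
  define c where "c = complex_of_real (1 / sqrt (2 * pi))"
  have c: "c * c = 1 / of_real (2 * pi)"
    unfolding c_def of_real_mult[symmetric] by simp
  have "fundamental \<phi> x = c * (LINT y|lborel. c * (of_real (fhat \<phi> y / full_den y) * expi (x * y)))"
    unfolding fundamental_def inverse_fourier_def fundamental_hat_def full_den_def c_def
    by (simp only: of_real_mult mult.assoc)
  also have "\<dots> = c * c * full_kernel x"
    unfolding full_kernel_def integral_mult_right_zero by (simp only: mult.assoc)
  finally show ?thesis unfolding c by simp
qed

text \<open>The mean over the period of each ratio \<open>g(t + 2\<pi>k) / g(t)\<close> with \<open>k \<noteq> 0\<close> tends to 0 by dominated convergence, and
the summable majorants allow the limit to be taken inside the sum over \<open>k\<close>.\<close>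

lemma family_error_tendsto_0:
  assumes fam: "spline_like_family A \<phi>" and s: "\<And>n. s n \<in> A" "filterlim s at_top sequentially"
    and M: "(\<lambda>j. \<bar>M j\<bar>) summable_on UNIV"
    and pq: "\<And>n. periodized_quotient (fhat (\<phi> (s n))) (deriv (fhat (\<phi> (s n)))) (m n) C (\<lambda>j. \<bar>M j\<bar>)"
  shows "(\<lambda>n. periodized_quotient.full_err (fhat (\<phi> (s n))) x) \<longlonglongrightarrow> 0"
proof -
  let ?ratio = "\<lambda>n k t. fhat (\<phi> (s n)) (t + 2 * pi * of_int k) / fhat (\<phi> (s n)) t"
  define r where "r n k = (LINT t:{- pi..pi}|lborel. ?ratio n k t)" for n k
  have ratio: "0 \<le> ?ratio n k t"
      "?ratio n k t \<le> \<bar>M k\<bar>" 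
    if t: "t \<in> {- pi..pi} - {0}" and k: "k \<noteq> 0" for n t k
  proof -
    interpret periodized_quotient "fhat (\<phi> (s n))" "deriv (fhat (\<phi> (s n)))" "m n" C "\<lambda>j. \<bar>M j\<bar>" by (rule pq)
    show "0 \<le> ?ratio n k t"
      using g_shift_nonneg[OF t] g_pos[OF t] by simp
    show "?ratio n k t \<le> \<bar>M k\<bar>"
      by (rule majorant[OF k t])
  qed
  have meas [measurable]: "fhat (\<phi> (s n)) \<in> borel_measurable borel" for n
    by (rule periodized_quotient.g_measurable[OF pq])
  have r_le: "r n k \<le> 2 * pi * \<bar>M k\<bar>" if k: "k \<noteq> 0" for n k
  proof -
    have "r n k \<le> (LINT t:{- pi..pi}|lborel. \<bar>M k\<bar>)"
      unfolding r_def
    proof (rule set_integral_mono_AE)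
      show "period_integrable (\<lambda>t. ?ratio n k t)"
        by (rule periodized_quotient.ratio_integrable[OF pq k])
      show "AE t\<in>{- pi..pi} in lborel. ?ratio n k t \<le> \<bar>M k\<bar>"
        using AE_nonzero_on_period by eventually_elim (use ratio(2)[OF _ k] in blast)
    qed (simp add: set_integrable_def)
    then show ?thesis by (simp add: set_lebesgue_integral_def)
  qed
  have r_lim: "(\<lambda>n. r n k) \<longlonglongrightarrow> 0" if k: "k \<noteq> 0" for k
  proof -
    have "(\<lambda>n. r n k) \<longlonglongrightarrow> (\<integral>t. 0 \<partial>(lborel :: real measure))"
      unfolding r_def set_lebesgue_integral_def
    proof (rule integral_dominated_convergence)
      show "integrable lborel (\<lambda>t. indicator {- pi..pi} t *\<^sub>R \<bar>M k\<bar>)" by simp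
      have fs: "filterlim s (at_top_in A) sequentially"
        unfolding filterlim_inf filterlim_principal using s by simp
      have B3: "AE \<xi> in lborel. \<bar>\<xi>\<bar> \<le> pi \<longrightarrow>
        ((\<lambda>\<alpha>. fhat (\<phi> \<alpha>) (\<xi> + 2 * pi * of_int k) / fhat (\<phi> \<alpha>) \<xi>) \<longlongrightarrow> 0) (at_top_in A)"
        using fam[unfolded spline_like_family_def, THEN conjunct2, THEN conjunct2, THEN conjunct1] k by blast
      show "AE t in lborel. (\<lambda>n. indicator {- pi..pi} t *\<^sub>R (?ratio n k t)) \<longlonglongrightarrow> 0"
        using B3
      proof eventually_elim
        case (elim t)
        show ?case
        proof (cases "t \<in> {- pi..pi}")
          case True
          then have "((\<lambda>\<alpha>. fhat (\<phi> \<alpha>) (t + 2 * pi * of_int k) / fhat (\<phi> \<alpha>) t) \<longlongrightarrow> 0) (at_top_in A)"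
            using elim by (auto simp: abs_le_iff)
          from filterlim_compose[OF this fs] show ?thesis using True by simp
        qed simp
      qed
      fix n
      show "AE t in lborel. norm (indicator {- pi..pi} t *\<^sub>R (?ratio n k t)) \<le> indicator {- pi..pi} t *\<^sub>R \<bar>M k\<bar>"
        using AE_nonzero_on_period
      proof eventually_elim
        case (elim t)
        show ?case
        proof (cases "t \<in> {- pi..pi}")
          case True
          with elim have "t \<in> {- pi..pi} - {0}" by blast
          from ratio[OF this k, of n] True show ?thesis by (simp del: abs_divide)
        qed simp
      qed
    qed measurable
    then show ?thesis by simp
  qed
  show ?thesis
  proof (rule metric_LIMSEQ_I)
    fix e :: real assume e: "0 < e"
    have "(\<lambda>j. 2 * pi * \<bar>M j\<bar>) summable_on UNIV" by (rule summable_on_cmult_right[OF M])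
    from summable_small_tail[OF this, of "e / 2"] e obtain N0 where
      N0: "\<And>F. finite F \<Longrightarrow> F \<inter> {- int N0..int N0} = {} \<Longrightarrow> (\<Sum>j\<in>F. 2 * pi * \<bar>M j\<bar>) \<le> e / 2" by auto
    let ?I = "{- int N0..int N0} - {0}"
    have "(\<lambda>n. \<Sum>k\<in>?I. r n k) \<longlonglongrightarrow> (\<Sum>k\<in>?I. 0)"
      by (intro tendsto_sum r_lim) auto
    then have "eventually (\<lambda>n. (\<Sum>k\<in>?I. r n k) < e / 4) sequentially"
      by (rule order_tendstoD(2)) (use e in simp)
    then obtain n0 where n0: "\<And>n. n \<ge> n0 \<Longrightarrow> (\<Sum>k\<in>?I. r n k) < e / 4"
      by (auto simp: eventually_sequentially)
    have r0: "0 \<le> r n k" if "k \<noteq> 0" for n k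
      unfolding r_def set_lebesgue_integral_def
    proof (rule integral_nonneg_AE)
      show "AE t in lborel. 0 \<le> indicator {- pi..pi} t *\<^sub>R (?ratio n k t)"
        using AE_nonzero_on_period
      proof eventually_elim
        case (elim t)
        show ?case using elim ratio(1)[OF _ that, of t n] by (cases "t \<in> {- pi..pi}") auto
      qed
    qed
    have "dist (periodized_quotient.full_err (fhat (\<phi> (s n))) x) 0 < e" if n: "n \<ge> n0" for n
    proof -
      interpret periodized_quotient "fhat (\<phi> (s n))" "deriv (fhat (\<phi> (s n)))" "m n" C "\<lambda>j. \<bar>M j\<bar>" by (rule pq)
      have "cmod (full_err x) \<le> e / 4 + e / 2"
      proof (rule full_err_small)
        fix F :: "int set" assume F: "finite F" "0 \<notin> F"
        have "(\<Sum>k\<in>F. r n k) = (\<Sum>k\<in>F \<inter> {- int N0..int N0}. r n k) + (\<Sum>k\<in>F - {- int N0..int N0}. r n k)"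
          by (subst sum.union_disjoint[symmetric]) (use F in \<open>auto simp: Int_Diff_Un\<close>)
        also have "(\<Sum>k\<in>F \<inter> {- int N0..int N0}. r n k) \<le> (\<Sum>k\<in>?I. r n k)"
          by (rule sum_mono2) (use F r0 in auto)
        also have "(\<Sum>k\<in>?I. r n k) \<le> e / 4" using n0[OF n] by simp
        also have "(\<Sum>k\<in>F - {- int N0..int N0}. r n k) \<le> (\<Sum>k\<in>F - {- int N0..int N0}. 2 * pi * \<bar>M k\<bar>)"
          using F by (intro sum_mono r_le) auto
        also have "\<dots> \<le> e / 2" by (rule N0) (use F in auto)
        finally show "(\<Sum>k\<in>F. LINT t:{- pi..pi}|lborel. ?ratio n k t) \<le> e / 4 + e / 2"
          by (simp add: r_def)
      qed
      then show ?thesis using e by simp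
    qed
    then show "\<exists>n0. \<forall>n\<ge>n0. dist (periodized_quotient.full_err (fhat (\<phi> (s n))) x) 0 < e" by blast
  qed
qed

lemma Lp_norm_le:
  assumes p: "1 < p" and h: "h \<in> borel_measurable borel" and e: "0 < e"
    and le: "lp_mass p h \<le> ennreal (e powr p)"
  shows "Lp_norm p h \<le> ennreal e"
proof -
  define I where "I = (\<integral>\<^sup>+x. ennreal (cmod (h x) powr p) \<partial>lebesgue)"
  have [measurable]: "h \<in> borel_measurable borel" by (rule h)
  have I: "I \<le> ennreal (e powr p)"
    unfolding I_def using le by (subst nn_integral_completion) auto
  have "h \<in> borel_measurable lebesgue" by (rule measurable_completion) simp
  moreover have "I < \<infinity>" using I by (rule le_less_trans) simp
  ultimately have "Lp_norm p h = ennreal (enn2real I powr (1 / p))"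
    by (simp add: Lp_norm_def I_def)
  also have "\<dots> \<le> ennreal ((e powr p) powr (1 / p))"
    using p enn2real_mono[OF I] by (intro ennreal_leI powr_mono2) auto
  also have "(e powr p) powr (1 / p) = e" using p e by (simp add: powr_powr)
  finally show ?thesis .
qed

theorem proposition2:
  fixes A :: "real set" and \<phi> :: "real \<Rightarrow> real \<Rightarrow> real"
    and p :: real and f :: "int \<Rightarrow> complex"
  assumes "A \<subseteq> {0<..}" and "\<not> bdd_above A"
    and "spline_like_family A \<phi>"
    and "1 < p"
    and "in_lp p f"
  shows "((\<lambda>\<alpha>. Lp_norm p (\<lambda>x. interpolation (\<phi> \<alpha>) f x - whittaker f x)) \<longlongrightarrow> 0) (at_top_in A)"
proof (rule sequential_limit_along_unbounded)
  fix s :: "nat \<Rightarrow> real" assume s: "\<And>n. s n \<in> A" "filterlim s at_top sequentially"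
  note p = \<open>1 < p\<close> and f = \<open>in_lp p f\<close>
  obtain C M where C: "0 \<le> C" and M: "(\<lambda>j. \<bar>M j\<bar>) summable_on UNIV"
    and ex: "\<And>\<alpha>. \<alpha> \<in> A \<Longrightarrow> \<exists>m. periodized_quotient (fhat (\<phi> \<alpha>)) (deriv (fhat (\<phi> \<alpha>))) m C (\<lambda>j. \<bar>M j\<bar>)"
    by (rule spline_like_family_periodized_quotient[OF \<open>spline_like_family A \<phi>\<close>]) (rule that)
  have "\<forall>n. \<exists>m. periodized_quotient (fhat (\<phi> (s n))) (deriv (fhat (\<phi> (s n)))) m C (\<lambda>j. \<bar>M j\<bar>)"
    by (intro allI ex s(1))
  then obtain m where "\<forall>n. periodized_quotient (fhat (\<phi> (s n))) (deriv (fhat (\<phi> (s n)))) (m n) C (\<lambda>j. \<bar>M j\<bar>)"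
    by (rule choice[THEN exE])
  then have pq: "periodized_quotient (fhat (\<phi> (s n))) (deriv (fhat (\<phi> (s n)))) (m n) C (\<lambda>j. \<bar>M j\<bar>)" for n
    by (rule spec)
  define E where "E n = periodized_quotient.full_err (fhat (\<phi> (s n)))" for n
  define T where "T n x = (\<Sum>\<^sub>\<infinity>j. f j * E n (x - of_int j))" for n x
  obtain K where K: "0 \<le> K" "\<And>J a t. finite J \<Longrightarrow> \<bar>t\<bar> \<le> pi \<Longrightarrow>
    lp_mass p (exp_conv J a t) \<le> ennreal (K * lp_sum p J a)"
    using exp_conv_lp_bound[OF p] by (elim exE conjE) blast
  define K' where "K' = 3 powr p * (2 * 2 powr p + (2 * C) powr p) * K"
  have E_meas: "E n \<in> borel_measurable borel" for n
    unfolding E_def by (rule periodized_quotient.full_err_measurable[OF pq])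
  have E_decay: "cmod (E n x) \<le> ((4 + 2 * C) * 8) / (1 + \<bar>x\<bar>)" for n x
    using periodized_quotient.full_err_decay[OF pq, of n x] by (simp add: E_def)
  have E_lim: "(\<lambda>n. E n x) \<longlonglongrightarrow> 0" for x
    unfolding E_def by (rule family_error_tendsto_0[OF \<open>spline_like_family A \<phi>\<close> s M pq])
  have E_lp: "lp_mass p (\<lambda>x. \<Sum>j\<in>J. a j * E n (x - of_int j))
       \<le> ennreal (K' * lp_sum p J a)" if J: "finite J" for n J a
  proof -
    have "0 \<le> K * lp_sum p J a" using K(1) by (intro mult_nonneg_nonneg sum_nonneg) auto
    from periodized_quotient.full_err_lp_bound[OF pq p J this K(2)[OF J]]
    show ?thesis by (simp add: E_def K'_def mult.assoc)
  qed
  have D0: "0 \<le> (4 + 2 * C) * 8" and K'0: "0 \<le> K'" using C K(1) by (auto simp: K'_def)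
  have conv: "T n \<in> borel_measurable borel" 
     "(\<lambda>n. lp_mass p (T n)) \<longlonglongrightarrow> 0" for n
    unfolding T_def[abs_def] by (rule kernel_convergence[OF p f E_meas D0 E_decay E_lim K'0 E_lp]; assumption)+
  have T: "interpolation (\<phi> (s n)) f x - whittaker f x = T n x" for n x
  proof -
    have sE: "(\<lambda>j. f j * E n (x - of_int j)) summable_on UNIV"
      by (rule lp_times_decaying_summable[OF p f D0 E_decay])
    have sW: "(\<lambda>j. f j * of_real (sinc (pi * (x - of_int j)))) summable_on UNIV"
      by (rule lp_times_decaying_summable[OF p f _ sinc_decay]) simp
    have "fundamental (\<phi> (s n)) y = E n y + of_real (sinc (pi * y))" for y
      unfolding fundamental_eq_full_kernel[OF pq] E_def periodized_quotient.full_err_def[OF pq] by simp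
    then have "interpolation (\<phi> (s n)) f x = (\<Sum>\<^sub>\<infinity>j. f j * E n (x - of_int j) + f j * of_real (sinc (pi * (x - of_int j))))"
      unfolding interpolation_def by (simp only: distrib_left)
    also have "\<dots> = T n x + whittaker f x"
      unfolding T_def whittaker_def by (rule infsum_add[OF sE sW])
    finally show ?thesis by simp
  qed
  show "(\<lambda>n. Lp_norm p (\<lambda>x. interpolation (\<phi> (s n)) f x - whittaker f x)) \<longlonglongrightarrow> 0"
    unfolding T
  proof (rule ennreal_tendsto_0I)
    fix e :: real assume e: "0 < e"
    have "0 < ennreal (e powr p)" using e by (simp add: ennreal_less_zero_iff)
    then have "eventually (\<lambda>n. lp_mass p (T n) < ennreal (e powr p)) sequentially"
      by (rule order_tendstoD(2)[OF conv(2)])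
    then show "eventually (\<lambda>n. Lp_norm p (T n) \<le> ennreal e) sequentially"
      by eventually_elim (rule Lp_norm_le[OF p conv(1) e less_imp_le])
  qed
qed

end
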